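(* Fix an integer $r>0$ and partitions $\alpha,\beta_1,\beta_2$. Then in $\Lambda_1\otimes_{\mathbb Z}\Lambda_2$, \[ \tau^r_{\alpha,\emptyset}\,\tau^r_{\beta_1,\beta_2}=\sum_{\lambda}\sum_{T_1\in \mathrm{RW}_{\lambda/\beta_1}(\alpha)}\Big(\tau^r_{\lambda,\beta_2}+\sum_{a_{T_2}}\tau^r_{t(a_{T_2})}\Big), \] where $\lambda$ runs over partitions containing $\beta_1$, and the inner sum runs over arrows $a_{T_2}:(\lambda,\beta_2)\to(\gamma_1,\gamma_2)$ of the Remmel–Whitney quiver (so $T_2\in\mathrm{RW}_{\gamma_1/\lambda}(\beta_2/\gamma_2)$) that satisfy the $r$-th row rule and such that the tableau $S=\mathrm{Slide}_{T_1}(T_2)$ (of shape $\delta/\beta_1$ for some $\delta$, defining the arrow $a_S:(\beta_1,\beta_2)\to(\delta,\gamma_2)$) satisfies the reverse $r$-th row rule, i.e. $R_r(i)>\mathrm{row}_S(i)$ for all $i$, where $R_r$ is computed from $\beta_2/\gamma_2$.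
   Context: Partitions are Young diagrams in English notation (rows numbered $1,2,\dots$ top to bottom, columns left to right); $\alpha/\beta$ is a skew shape; standard tableaux of shape $\alpha/\beta$ are fillings by $1,\dots,|\alpha|-|\beta|$ increasing along rows and down columns; the row of an entry is the row index of its box. $\mathrm{rl}(\alpha/\beta)$: write $1,\dots,|\alpha|-|\beta|$ into $\alpha/\beta$ right to left along each row, rows top to bottom. $\mathrm{RW}_{\gamma/\delta}(\alpha/\beta)$: standard tableaux $T$ of shape $\gamma/\delta$ such that (i) if $i,i+1$ are in the same row of $\mathrm{rl}(\alpha/\beta)$ then $i+1$ is strictly right of and weakly above $i$ in $T$; (ii) if $i$ is directly above $j$ in a column of $\mathrm{rl}(\alpha/\beta)$ then $j$ is strictly below and weakly left of $i$ in $T$. $\Lambda_1,\Lambda_2$: symmetric functions in $x$'s and $y$'s; $s_{\alpha_1,\alpha_2}=s_{\alpha_1}(x)s_{\alpha_2}(y)$. Remmel–Whitney quiver: vertices are pairs of partitions; for distinct pairs with $\alpha_1\subseteq\beta_1$, $\beta_2\subseteq\alpha_2$, one arrow $a_T:(\alpha_1,\alpha_2)\to(\beta_1,\beta_2)$ per $T\in\mathrm{RW}_{\beta_1/\alpha_1}(\alpha_2/\beta_2)$; $t(a)$ is the target. Row rule: the $r$-th row rule filling of a partition $\alpha$ puts $r+i-j$ in the box in row $i$, column $j$. For an arrow $a_T:(\alpha_1,\alpha_2)\to(\beta_1,\beta_2)$ and $i\in\{1,\dots,|\beta_1|-|\alpha_1|\}$, let $R_r(i)$ be the entry of the $r$-th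 row rule filling of $\alpha_2$ at the box of $\alpha_2/\beta_2$ labelled $i$ in $\mathrm{rl}(\alpha_2/\beta_2)$, and $\mathrm{row}_T(i)$ the row of $i$ in $T$. $a_T$ satisfies the $r$-th row rule if $R_r(i)\le\mathrm{row}_T(i)$ for all $i$, and the reverse $r$-th row rule if $R_r(i)>\mathrm{row}_T(i)$ for all $i$. The basis $\tau^r$ is defined recursively on $|\alpha_2|$ by $\tau^r_{\alpha_1,\alpha_2}=s_{\alpha_1,\alpha_2}-\sum_a\tau^r_{t(a)}$, the sum over arrows $a$ with source $(\alpha_1,\alpha_2)$ satisfying the $r$-th row rule. Infusion: for partitions $\alpha\subseteq\beta\subseteq\gamma$ and standard tableaux $T_1$ of shape $\beta/\alpha$, $T_2$ of shape $\gamma/\beta$, go through the boxes of $T_1$ in decreasing order of their labels and for each such box (label $i$) perform a jeu-de-taquin slide of the current $T_2$ into it (repeatedly moving the smaller of the entries to the right and below the empty box into it until the empty box reaches the outside); the box vacated at the outside is labelled $i$. The resulting tableau from $T_2$ is $\mathrm{Slide}_{T_1}(T_2)$, and the labelled vacated boxes form $\mathrm{Slide}^{T_2}(T_1)$. *)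

theory Defs
  imports "HOL-Library.Poly_Mapping" "Graph_Theory.Digraph"
begin

section \<open>Partitions and skew shapes\<close>

text \<open>A partition is identified with its Young diagram in English notation: the box
  \<open>(i, j)\<close> lies in row \<open>i\<close> and column \<open>j\<close>, both counted from 1.\<close>

type_synonym box = "nat \<times> nat"

typedef partition =
  "{D :: box set. finite D \<and> (\<forall>(i, j) \<in> D. 1 \<le> i \<and> 1 \<le> j \<and> {1..i} \<times> {1..j} \<subseteq> D)}"
  morphisms boxes Partition
  by (rule exI[of _ "{}"]) simp

setup_lifting type_definition_partition

instantiation partition :: order_bot
begin

lift_definition less_eq_partition :: "partition \<Rightarrow> partition \<Rightarrow> bool" is "(\<subseteq>)" .
lift_definition less_partition :: "partition \<Rightarrow> partition \<Rightarrow> bool" is "(\<subset>)" .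
lift_definition bot_partition :: partition is "{}" by simp

instance by standard (transfer; auto)+

end

abbreviation empty_partition :: partition ("\<emptyset>")
  where "\<emptyset> \<equiv> bot"

definition skew :: "partition \<Rightarrow> partition \<Rightarrow> box set"
  where "skew \<alpha> \<beta> = boxes \<alpha> - boxes \<beta>"

section \<open>Tableaux\<close>

text \<open>A filling is a function on all of \<open>\<nat> \<times> \<nat>\<close> with value 0 exactly at the boxes that are not
  filled. Thus a filling determines its shape, and entries are positive.\<close>

type_synonym filling = "box \<Rightarrow> nat"

definition shape :: "filling \<Rightarrow> box set"
  where "shape T = {b. T b \<noteq> 0}"

definition standard_tableau :: "box set \<Rightarrow> filling \<Rightarrow> bool" where
  "standard_tableau D T \<longleftrightarrow>
     shape T = D \<and> bij_betw T D {1..card D} \<and>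
     (\<forall>i j j'. (i, j) \<in> D \<and> (i, j') \<in> D \<and> j < j' \<longrightarrow> T (i, j) < T (i, j')) \<and>
     (\<forall>i i' j. (i, j) \<in> D \<and> (i', j) \<in> D \<and> i < i' \<longrightarrow> T (i, j) < T (i', j))"

definition semistandard_tableau :: "box set \<Rightarrow> filling \<Rightarrow> bool" where
  "semistandard_tableau D T \<longleftrightarrow>
     shape T = D \<and>
     (\<forall>i j j'. (i, j) \<in> D \<and> (i, j') \<in> D \<and> j < j' \<longrightarrow> T (i, j) \<le> T (i, j')) \<and>
     (\<forall>i i' j. (i, j) \<in> D \<and> (i', j) \<in> D \<and> i < i' \<longrightarrow> T (i, j) < T (i', j))"

definition box_of :: "filling \<Rightarrow> nat \<Rightarrow> box"
  where "box_of T i = (THE b. T b = i)"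

definition row_of :: "filling \<Rightarrow> nat \<Rightarrow> nat"
  where "row_of T i = fst (box_of T i)"

definition col_of :: "filling \<Rightarrow> nat \<Rightarrow> nat"
  where "col_of T i = snd (box_of T i)"

text \<open>The label of a box in the reading filling is its position in the order that runs through
  the rows top to bottom and through each row right to left.\<close>

definition rl :: "box set \<Rightarrow> filling" where
  "rl D b = (if b \<in> D
     then card {c \<in> D. fst c < fst b \<or> fst c = fst b \<and> snd b \<le> snd c} else 0)"

definition RW :: "partition \<Rightarrow> partition \<Rightarrow> partition \<Rightarrow> partition \<Rightarrow> filling set" where
  "RW \<gamma> \<delta> \<alpha> \<beta> = {T.
     let L = rl (skew \<alpha> \<beta>); n = card (skew \<alpha> \<beta>) in
     standard_tableau (skew \<gamma> \<delta>) T \<and> card (skew \<gamma> \<delta>) = n \<and>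
     (\<forall>i \<in> {1..<n}. row_of L i = row_of L (i + 1) \<longrightarrow>
        col_of T i < col_of T (i + 1) \<and> row_of T (i + 1) \<le> row_of T i) \<and>
     (\<forall>i \<in> {1..n}. \<forall>j \<in> {1..n}. row_of L j = row_of L i + 1 \<and> col_of L j = col_of L i \<longrightarrow>
        row_of T i < row_of T j \<and> col_of T j \<le> col_of T i)}"

section \<open>Jeu de taquin and infusion\<close>

text \<open>The tail-recursive equation holds unconditionally; the recursion stops whenever the shape of
  \<open>T\<close> is finite.\<close>

partial_function (tailrec) jdt_slide :: "filling \<Rightarrow> box \<Rightarrow> filling" where
  "jdt_slide T b =
     (let right = (fst b, snd b + 1); below = (fst b + 1, snd b) in
      if T right = 0 \<and> T below = 0 then T
      else if T below = 0 \<or> T right \<noteq> 0 \<and> T right < T below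
      then jdt_slide (T(b := T right, right := 0)) right
      else jdt_slide (T(b := T below, below := 0)) below)"

definition Slide :: "filling \<Rightarrow> filling \<Rightarrow> filling" where
  "Slide T1 T2 =
     fold (\<lambda>i T. jdt_slide T (box_of T1 i)) (rev [1..<Suc (card (shape T1))]) T2"

section \<open>The Remmel--Whitney quiver and the row rules\<close>

type_synonym vertex = "partition \<times> partition"

text \<open>An arrow is a triple consisting of its source, its target and its tableau.\<close>

type_synonym arrow = "vertex \<times> vertex \<times> filling"

definition RW_quiver :: "(vertex, arrow) pre_digraph" where
  "RW_quiver =
     \<lparr>verts = UNIV,
      arcs = {((\<alpha>\<^sub>1, \<alpha>\<^sub>2), (\<beta>\<^sub>1, \<beta>\<^sub>2), T) | \<alpha>\<^sub>1 \<alpha>\<^sub>2 \<beta>\<^sub>1 \<beta>\<^sub>2 T.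
        (\<alpha>\<^sub>1, \<alpha>\<^sub>2) \<noteq> (\<beta>\<^sub>1, \<beta>\<^sub>2) \<and> \<alpha>\<^sub>1 \<le> \<beta>\<^sub>1 \<and> \<beta>\<^sub>2 \<le> \<alpha>\<^sub>2 \<and> T \<in> RW \<beta>\<^sub>1 \<alpha>\<^sub>1 \<alpha>\<^sub>2 \<beta>\<^sub>2},
      tail = (\<lambda>(v, w, T). v),
      head = (\<lambda>(v, w, T). w)\<rparr>"

text \<open>The entries of a row rule filling may be nonpositive.\<close>

definition row_rule_filling :: "int \<Rightarrow> box \<Rightarrow> int"
  where "row_rule_filling r = (\<lambda>(i, j). r + int i - int j)"

definition row_rule_entry :: "int \<Rightarrow> partition \<Rightarrow> partition \<Rightarrow> nat \<Rightarrow> int"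
  where "row_rule_entry r \<alpha>\<^sub>2 \<beta>\<^sub>2 i = row_rule_filling r (box_of (rl (skew \<alpha>\<^sub>2 \<beta>\<^sub>2)) i)"

fun row_rule :: "int \<Rightarrow> arrow \<Rightarrow> bool" where
  "row_rule r ((\<alpha>\<^sub>1, \<alpha>\<^sub>2), (\<beta>\<^sub>1, \<beta>\<^sub>2), T) \<longleftrightarrow>
     (\<forall>i \<in> {1..card (skew \<beta>\<^sub>1 \<alpha>\<^sub>1)}. row_rule_entry r \<alpha>\<^sub>2 \<beta>\<^sub>2 i \<le> int (row_of T i))"

fun reverse_row_rule :: "int \<Rightarrow> arrow \<Rightarrow> bool" where
  "reverse_row_rule r ((\<alpha>\<^sub>1, \<alpha>\<^sub>2), (\<beta>\<^sub>1, \<beta>\<^sub>2), T) \<longleftrightarrow>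
     (\<forall>i \<in> {1..card (skew \<beta>\<^sub>1 \<alpha>\<^sub>1)}. row_rule_entry r \<alpha>\<^sub>2 \<beta>\<^sub>2 i > int (row_of T i))"

section \<open>Power series in two alphabets\<close>

text \<open>The ring \<open>\<Lambda>\<^sub>1 \<otimes> \<Lambda>\<^sub>2\<close> is regarded as a subring of the ring of formal power series
  over the integers in the two alphabets \<open>x\<^sub>1, x\<^sub>2, \<dots>\<close> and \<open>y\<^sub>1, y\<^sub>2, \<dots>\<close>, by
  \<open>f \<otimes> g \<mapsto> f(x) g(y)\<close>. Exponent vectors are finitely supported. (The variables \<open>X 0\<close>
  and \<open>Y 0\<close> do not occur in symmetric functions.)\<close>

datatype variable = X nat | Y nat

type_synonym monomial = "variable \<Rightarrow>\<^sub>0 nat"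

typedef pseries = "UNIV :: (monomial \<Rightarrow> int) set"
  morphisms mcoeff Pseries ..

setup_lifting type_definition_pseries

lemma finite_monomial_factorizations: "finite {(a, b). a + b = (m :: monomial)}"
proof -
  let ?F = "{f :: variable \<Rightarrow> nat. \<forall>v.
    (v \<in> Poly_Mapping.keys m \<longrightarrow>
       f v \<in> {..Max (Poly_Mapping.lookup m ` Poly_Mapping.keys m)}) \<and>
    (v \<notin> Poly_Mapping.keys m \<longrightarrow> f v = 0)}"
  let ?S = "{(a, b). a + b = m}"
  have "finite ?F"
    by (intro finite_set_of_finite_funs Poly_Mapping.finite_keys finite_atMost)
  moreover have "(\<lambda>p. Poly_Mapping.lookup (fst p)) ` ?S \<subseteq> ?F"
  proof (rule image_subsetI)
    fix p assume "p \<in> ?S"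
    then have m: "m = fst p + snd p" by auto
    then have le: "Poly_Mapping.lookup (fst p) v \<le> Poly_Mapping.lookup m v" for v
      by (simp add: lookup_add)
    have "Poly_Mapping.lookup (fst p) v \<le> Max (Poly_Mapping.lookup m ` Poly_Mapping.keys m)"
      if "v \<in> Poly_Mapping.keys m" for v
      using that by (intro order_trans[OF le] Max_ge) auto
    moreover have "Poly_Mapping.lookup (fst p) v = 0" if "v \<notin> Poly_Mapping.keys m" for v
      using le[of v] that by (simp add: in_keys_iff)
    ultimately show "Poly_Mapping.lookup (fst p) \<in> ?F" by blast
  qed
  moreover have "inj_on (\<lambda>p. Poly_Mapping.lookup (fst p)) ?S"
    by (rule inj_onI) (auto simp: lookup_inject)
  ultimately show ?thesis
    by (meson finite_imageD finite_subset)
qed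

instantiation pseries :: comm_ring_1
begin

lift_definition zero_pseries :: pseries is "\<lambda>_. 0" .
lift_definition one_pseries :: pseries is "\<lambda>m. if m = 0 then 1 else 0" .
lift_definition uminus_pseries :: "pseries \<Rightarrow> pseries" is "\<lambda>f m. - f m" .
lift_definition plus_pseries :: "pseries \<Rightarrow> pseries \<Rightarrow> pseries" is "\<lambda>f g m. f m + g m" .
lift_definition minus_pseries :: "pseries \<Rightarrow> pseries \<Rightarrow> pseries" is "\<lambda>f g m. f m - g m" .
lift_definition times_pseries :: "pseries \<Rightarrow> pseries \<Rightarrow> pseries"
  is "\<lambda>f g m. \<Sum>(a, b) \<in> {(a, b). a + b = m}. f a * g b" .

instance
proof
  fix f g h :: pseries
  show "f + g + h = f + (g + h)" "f + g = g + f" "0 + f = f" "- f + f = 0" "f - g = f + - g"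
    by (transfer; simp add: add_ac)+
  show "(0 :: pseries) \<noteq> 1"
    by transfer (metis zero_neq_one)
  show "(f + g) * h = f * h + g * h"
    by transfer (simp add: distrib_right sum.distrib case_prod_unfold)
  show "f * g = g * f"
  proof (transfer, rule ext)
    fix f g :: "monomial \<Rightarrow> int" and m
    show "(\<Sum>(a, b) \<in> {(a, b). a + b = m}. f a * g b) =
          (\<Sum>(a, b) \<in> {(a, b). a + b = m}. g a * f b)"
      by (rule sum.reindex_bij_witness[of _ prod.swap prod.swap])
         (auto simp: add.commute mult.commute)
  qed
  show "1 * f = f"
  proof (transfer, rule ext)
    fix f :: "monomial \<Rightarrow> int" and m
    have "(\<Sum>(a, b) \<in> {(a, b). a + b = m}. (if a = 0 then 1 else 0) * f b) =
          (\<Sum>(a, b) \<in> {(0 :: monomial, m)}. f b)"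
      by (rule sum.mono_neutral_cong_right[OF finite_monomial_factorizations]) (auto split: if_splits)
    then show "(\<Sum>(a, b) \<in> {(a, b). a + b = m}. (if a = 0 then 1 else 0) * f b) = f m"
      by simp
  qed
  show "f * g * h = f * (g * h)"
  proof (transfer, rule ext)
    fix f g h :: "monomial \<Rightarrow> int" and m
    let ?F = "\<lambda>m. {(a, b). a + b = (m :: monomial)}"
    have fin: "finite {p. fst p + snd p = u}" for u :: monomial
      using finite_monomial_factorizations[of u] by (simp add: case_prod_unfold)
    have "(\<Sum>(u, c) \<in> ?F m. (\<Sum>(a, b) \<in> ?F u. f a * g b) * h c) =
          (\<Sum>(u, c) \<in> ?F m. \<Sum>(a, b) \<in> ?F u. f a * g b * h c)"
      by (simp add: sum_distrib_right case_prod_unfold)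
    also have "\<dots> = (\<Sum>(p, q) \<in> Sigma (?F m) (\<lambda>p. ?F (fst p)). f (fst q) * g (snd q) * h (snd p))"
      by (subst sum.Sigma[symmetric]) (auto simp: fin case_prod_unfold)
    also have "\<dots> = (\<Sum>(p, q) \<in> Sigma (?F m) (\<lambda>p. ?F (snd p)). f (fst p) * (g (fst q) * h (snd q)))"
      by (rule sum.reindex_bij_witness[of _
            "\<lambda>((a, v), (b, c)). ((a + b, c), (a, b))" "\<lambda>((u, c), (a, b)). ((a, b + c), (b, c))"])
         (auto simp: ac_simps)
    also have "\<dots> = (\<Sum>(a, v) \<in> ?F m. \<Sum>(b, c) \<in> ?F v. f a * (g b * h c))"
      by (subst sum.Sigma[symmetric]) (auto simp: fin case_prod_unfold)
    also have "\<dots> = (\<Sum>(a, v) \<in> ?F m. f a * (\<Sum>(b, c) \<in> ?F v. g b * h c))"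
      by (simp add: sum_distrib_left case_prod_unfold)
    finally show "(\<Sum>(u, c) \<in> ?F m. (\<Sum>(a, b) \<in> ?F u. f a * g b) * h c) =
                  (\<Sum>(a, v) \<in> ?F m. f a * (\<Sum>(b, c) \<in> ?F v. g b * h c))" .
  qed
qed

end

section \<open>Schur functions and the basis given by the row rule\<close>

definition weight :: "(nat \<Rightarrow> variable) \<Rightarrow> filling \<Rightarrow> monomial"
  where "weight v T = (\<Sum>b \<in> shape T. Poly_Mapping.single (v (T b)) 1)"

lift_definition schur :: "(nat \<Rightarrow> variable) \<Rightarrow> partition \<Rightarrow> pseries"
  is "\<lambda>v \<alpha> m. int (card {T. semistandard_tableau (boxes \<alpha>) T \<and> weight v T = m})" .

definition schur2 :: "vertex \<Rightarrow> pseries"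
  where "schur2 = (\<lambda>(\<alpha>\<^sub>1, \<alpha>\<^sub>2). schur X \<alpha>\<^sub>1 * schur Y \<alpha>\<^sub>2)"

lemma finite_boxes [simp]: "finite (boxes \<alpha>)"
  using boxes[of \<alpha>] by auto

lemma finite_partitions_card_le: "finite {\<mu>. card (boxes \<mu>) \<le> n}"
proof -
  have "boxes \<mu> \<subseteq> {1..n} \<times> {1..n}" if n: "card (boxes \<mu>) \<le> n" for \<mu>
  proof clarify
    fix i j assume "(i, j) \<in> boxes \<mu>"
    then have ij: "1 \<le> i" "1 \<le> j" "{1..i} \<times> {1..j} \<subseteq> boxes \<mu>"
      using boxes[of \<mu>] by auto
    have "i * j \<le> n"
      using card_mono[OF finite_boxes ij(3)] n by (simp add: card_cartesian_product)
    moreover have "i \<le> i * j" "j \<le> i * j"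
      using ij(1,2) by simp_all
    ultimately have "i \<le> n" "j \<le> n"
      by (blast intro: order_trans)+
    then show "i \<in> {1..n} \<and> j \<in> {1..n}"
      using ij(1,2) by simp
  qed
  then have "boxes ` {\<mu>. card (boxes \<mu>) \<le> n} \<subseteq> Pow ({1..n} \<times> {1..n})"
    by auto
  moreover have "inj_on boxes {\<mu>. card (boxes \<mu>) \<le> n}"
    by (simp add: boxes_inject inj_on_def)
  ultimately show ?thesis
    by (meson finite_Pow_iff finite_SigmaI finite_atLeastAtMost finite_imageD finite_subset)
qed

lemma finite_fillings:
  assumes "finite D"
  shows "finite {T :: filling. shape T = D \<and> T ` D \<subseteq> {..n}}"
proof (rule finite_subset)
  show "{T. shape T = D \<and> T ` D \<subseteq> {..n}} \<subseteq>
        {T. \<forall>b. (b \<in> D \<longrightarrow> T b \<in> {..n}) \<and> (b \<notin> D \<longrightarrow> T b = 0)}"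
    by (auto simp: shape_def)
  show "finite {T. \<forall>b. (b \<in> D \<longrightarrow> T b \<in> {..n}) \<and> (b \<notin> D \<longrightarrow> T b = 0)}"
    by (rule finite_set_of_finite_funs) (use assms in auto)
qed

lemma finite_RW: "finite (RW \<gamma> \<delta> \<alpha> \<beta>)"
proof (rule finite_subset)
  show "RW \<gamma> \<delta> \<alpha> \<beta> \<subseteq> {T. shape T = skew \<gamma> \<delta> \<and> T ` skew \<gamma> \<delta> \<subseteq> {..card (skew \<gamma> \<delta>)}}"
    by (auto simp: RW_def Let_def standard_tableau_def bij_betw_def)
  show "finite \<dots>"
    by (rule finite_fillings) (simp add: skew_def)
qed

lemma card_RW:
  assumes "T \<in> RW \<gamma> \<delta> \<alpha> \<beta>" "\<delta> \<le> \<gamma>"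
  shows "card (boxes \<gamma>) \<le> card (boxes \<delta>) + card (boxes \<alpha>)"
proof -
  have "boxes \<delta> \<subseteq> boxes \<gamma>"
    using assms(2) by (simp add: less_eq_partition.rep_eq)
  then have "card (boxes \<gamma>) = card (boxes \<delta>) + card (boxes \<gamma> - boxes \<delta>)"
    by (metis card_Diff_subset card_mono finite_boxes le_add_diff_inverse rev_finite_subset)
  moreover have "card (boxes \<gamma> - boxes \<delta>) = card (boxes \<alpha> - boxes \<beta>)"
    using assms(1) by (simp add: RW_def skew_def Let_def)
  moreover have "card (boxes \<alpha> - boxes \<beta>) \<le> card (boxes \<alpha>)"
    by (simp add: card_mono)
  ultimately show ?thesis by simp
qed

lemma finite_RW_pairs: "finite {(\<mu>, T). \<delta> \<le> \<mu> \<and> T \<in> RW \<mu> \<delta> \<alpha> \<beta>}"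
proof (rule finite_subset)
  show "{(\<mu>, T). \<delta> \<le> \<mu> \<and> T \<in> RW \<mu> \<delta> \<alpha> \<beta>} \<subseteq>
        Sigma {\<mu>. card (boxes \<mu>) \<le> card (boxes \<delta>) + card (boxes \<alpha>)} (\<lambda>\<mu>. RW \<mu> \<delta> \<alpha> \<beta>)"
    using card_RW by auto
  show "finite \<dots>"
    by (intro finite_SigmaI finite_partitions_card_le finite_RW)
qed

lemma finite_out_arcs_RW_quiver: "finite (out_arcs RW_quiver v)"
proof -
  obtain \<alpha>1 \<alpha>2 where v: "v = (\<alpha>1, \<alpha>2)" by force
  let ?P = "\<lambda>n. {\<mu>. card (boxes \<mu>) \<le> n}"
  let ?S = "Sigma (?P (card (boxes \<alpha>1) + card (boxes \<alpha>2)) \<times> ?P (card (boxes \<alpha>2)))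
              (\<lambda>(\<beta>1, \<beta>2). RW \<beta>1 \<alpha>1 \<alpha>2 \<beta>2)"
  have "out_arcs RW_quiver v \<subseteq> Pair v ` ?S"
    by (auto simp: RW_quiver_def v card_RW less_eq_partition.rep_eq card_mono)
  moreover have "finite ?S"
    by (intro finite_SigmaI finite_partitions_card_le) (auto simp: finite_RW)
  ultimately show ?thesis
    using finite_subset by blast
qed

lemma finite_semistandard_weight:
  assumes "inj v"
  shows "finite {T. semistandard_tableau (boxes \<alpha>) T \<and> weight v T = m}"
proof (rule finite_subset)
  let ?n = "Max (v -` Poly_Mapping.keys m)"
  have fin: "finite (v -` Poly_Mapping.keys m)"
    using assms by (intro finite_vimageI Poly_Mapping.finite_keys)
  have "T b \<in> v -` Poly_Mapping.keys m" if "shape T = boxes \<alpha>" "b \<in> boxes \<alpha>" "weight v T = m" for T b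
  proof -
    have "Poly_Mapping.lookup (weight v T) (v (T b)) =
          (\<Sum>c \<in> boxes \<alpha>. Poly_Mapping.lookup (Poly_Mapping.single (v (T c)) (1 :: nat)) (v (T b)))"
      unfolding that(3)[symmetric] weight_def that(1) by (rule lookup_sum)
    also have "\<dots> \<noteq> 0"
      using that(2) by (auto simp: lookup_single when_def)
    finally show ?thesis
      using that by (simp add: in_keys_iff)
  qed
  then show "{T. semistandard_tableau (boxes \<alpha>) T \<and> weight v T = m} \<subseteq>
             {T. shape T = boxes \<alpha> \<and> T ` boxes \<alpha> \<subseteq> {..?n}}"
    using Max_ge[OF fin] by (auto simp: semistandard_tableau_def)
  show "finite {T. shape T = boxes \<alpha> \<and> T ` boxes \<alpha> \<subseteq> {..?n}}"
    by (rule finite_fillings) simp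
qed

lemma RW_quiver_decreasing:
  assumes "a \<in> arcs RW_quiver"
  shows "card (boxes (snd (head RW_quiver a))) < card (boxes (snd (tail RW_quiver a)))"
proof -
  obtain \<alpha>1 \<alpha>2 \<beta>1 \<beta>2 T where a: "a = ((\<alpha>1, \<alpha>2), (\<beta>1, \<beta>2), T)"
    and ne: "(\<alpha>1, \<alpha>2) \<noteq> (\<beta>1, \<beta>2)" and le: "\<alpha>1 \<le> \<beta>1" "\<beta>2 \<le> \<alpha>2"
    and T: "T \<in> RW \<beta>1 \<alpha>1 \<alpha>2 \<beta>2"
    using assms unfolding RW_quiver_def by auto
  have eq: "card (boxes \<beta>1 - boxes \<alpha>1) = card (boxes \<alpha>2 - boxes \<beta>2)"
    using T by (simp add: RW_def skew_def Let_def)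
  have sub: "boxes \<alpha>1 \<subseteq> boxes \<beta>1" "boxes \<beta>2 \<subseteq> boxes \<alpha>2"
    using le by (simp_all add: less_eq_partition.rep_eq)
  have "boxes \<beta>2 \<noteq> boxes \<alpha>2"
  proof
    assume *: "boxes \<beta>2 = boxes \<alpha>2"
    then have "boxes \<beta>1 = boxes \<alpha>1"
      using eq sub by auto
    with * ne show False
      by (simp add: boxes_inject)
  qed
  with sub have "card (boxes \<beta>2) < card (boxes \<alpha>2)"
    by (simp add: psubset_card_mono psubsetI)
  then show ?thesis
    by (simp add: a RW_quiver_def)
qed

function tau :: "int \<Rightarrow> vertex \<Rightarrow> pseries" where
  "tau r v = schur2 v -
     (\<Sum>a | a \<in> out_arcs RW_quiver v \<and> row_rule r a. tau r (head RW_quiver a))"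
  by pat_completeness auto

termination
  by (relation "measure (\<lambda>(r, v). card (boxes (snd v)))") (auto dest: RW_quiver_decreasing)

declare tau.simps [simp del]

end

(* A tableau T in RW_{gamma/delta}(alpha/beta) is the same thing as a picture in the sense of
   Zelevinsky: a bijection from alpha/beta to gamma/delta such that it and its inverse send every pair
   of boxes p, q with q weakly south-east of p to a pair in which the second box lies weakly south-west
   of the first. Infusion replaces two adjacent growth steps e, c by c, e unless c is a right or lower
   neighbour of e. This local rule is an involution, and each step of it preserves pictures on both
   sides, so infusion is an involution on pairs of pictures. Infusing with the only picture between
   straight shapes proves the Littlewood-Richardson rule.

   By induction on |beta_2| the theorem reduces to a bijection between the pairs (T_1, T_2) in which T_2
   satisfies the row rule and the triples (S_1, T_1'', T_2') in which S_1 and T_2' satisfy the row rule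
   and the slide of T_2' satisfies the reverse row rule. It cuts S = Slide_{T_1}(T_2) into the boxes S_1
   that satisfy the row rule, which form an order ideal, and the rest. Sliding outwards never makes
   a box violate the row rule, and the boxes that still violate it move as if the others were absent;
   hence T_2 and T_2' satisfy the row rule simultaneously. *)
theory Submission
  imports Defs
begin

section \<open>Pictures\<close>

text \<open>Since \<tau> is defined by a recursion with subtractions, the product is never expanded
  directly. Solved for the Schur function, the recursion says that s at a vertex is the sum of
  \<tau> over the row-rule arrows leaving it, the trivial arrow included. Multiplying by s_\<alpha>
  and expanding in two ways (Littlewood-Richardson rule before the arrows, or arrows before the
  product formula) gives two sums over the same arrows. Their nontrivial terms agree by induction,
  and the trivial term is the formula sought.

  The row rule is compatible with pictures because pictures satisfy a quantitative estimate: a step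
  of k rows down and l columns right in the domain moves the image at least k rows down and at least
  l columns left. Signs alone would not compare with the entries r + i - j.

  Tableaux are kept as lists of boxes in label order, so that a slide is a pass of local switches
  along a list. Its dependence on the labels is harmless, because boxes competing for the same hole
  have comparable preimages.\<close>

definition nwle :: "'a::linorder \<times> 'a \<Rightarrow> 'a \<times> 'a \<Rightarrow> bool" where
  "nwle a b \<longleftrightarrow> fst a \<le> fst b \<and> snd a \<le> snd b"

definition swle :: "'a::linorder \<times> 'a \<Rightarrow> 'a \<times> 'a \<Rightarrow> bool" where
  "swle a b \<longleftrightarrow> fst a \<le> fst b \<and> snd b \<le> snd a"

text \<open>Convexity replaces a pair of partitions: skew shapes can then be cut and moved without
  choosing inner and outer shapes each time.\<close>

definition conv :: "('a::linorder \<times> 'a) set \<Rightarrow> bool" where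
  "conv S \<longleftrightarrow> (\<forall>a\<in>S. \<forall>c\<in>S. \<forall>b. nwle a b \<and> nwle b c \<longrightarrow> b \<in> S)"

definition adj :: "'a::{plus,one} \<times> 'a \<Rightarrow> 'a \<times> 'a \<Rightarrow> bool" where
  "adj e c \<longleftrightarrow> c = (fst e, snd e + 1) \<or> c = (fst e + 1, snd e)"

text \<open>If the weak condition holds in both directions, the two strict clauses follow. Spelled
  out, they make one direction strong enough to be recovered from neighbouring boxes, which is the
  form in which Remmel-Whitney tableaux present it. The coordinates are of any ordered type, so that
  integer points are covered as well.\<close>

definition dir :: "'a::linorder \<times> 'a \<Rightarrow> 'a \<times> 'a \<Rightarrow> 'b::linorder \<times> 'b \<Rightarrow> 'b \<times> 'b \<Rightarrow> bool" where
  "dir a a' b b' \<longleftrightarrow> (nwle a a' \<longrightarrow> swle b b' \<and>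
     (snd a < snd a' \<longrightarrow> snd b' < snd b) \<and> (fst a < fst a' \<longrightarrow> fst b < fst b'))"

text \<open>The points of \<open>I\<close> name the boxes of a picture: \<open>x \<in> I\<close> sends the box \<open>d x\<close> to the box \<open>c x\<close>.\<close>

definition pict :: "'x set \<Rightarrow> ('x \<Rightarrow> 'a::linorder \<times> 'a) \<Rightarrow> ('x \<Rightarrow> 'a \<times> 'a) \<Rightarrow> bool" where
  "pict I d c \<longleftrightarrow> (\<forall>x\<in>I. \<forall>y\<in>I. dir (d x) (d y) (c x) (c y) \<and> dir (c x) (c y) (d x) (d y))"

lemmas order_defs = nwle_def swle_def

lemma pictD1:
  assumes "pict I d c" "x \<in> I" "y \<in> I" "nwle (d x) (d y)"
  shows "snd (c y) \<le> snd (c x)" "fst (c x) \<le> fst (c y)"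
    "snd (d x) < snd (d y) \<Longrightarrow> snd (c y) < snd (c x)"
    "fst (d x) < fst (d y) \<Longrightarrow> fst (c x) < fst (c y)"
  using assms unfolding pict_def dir_def swle_def by blast+

lemma pictD2:
  assumes "pict I d c" "x \<in> I" "y \<in> I" "nwle (c x) (c y)"
  shows "snd (d y) \<le> snd (d x)" "fst (d x) \<le> fst (d y)"
    "snd (c x) < snd (c y) \<Longrightarrow> snd (d y) < snd (d x)"
    "fst (c x) < fst (c y) \<Longrightarrow> fst (d x) < fst (d y)"
  using assms unfolding pict_def dir_def swle_def by blast+

lemma convD: "conv S \<Longrightarrow> a \<in> S \<Longrightarrow> c \<in> S \<Longrightarrow> nwle a b \<Longrightarrow> nwle b c \<Longrightarrow> b \<in> S"
  unfolding conv_def by blast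

lemma conv_insert_image:
  assumes "conv (insert h (c ` I))" "y \<in> I" "nwle h b" "nwle b (c y)" "b \<noteq> h"
  shows "\<exists>z\<in>I. c z = b"
proof -
  have "b \<in> insert h (c ` I)"
    by (rule convD[OF assms(1), of h "c y"]) (use assms(2-4) in auto)
  then show ?thesis using assms(5) by auto
qed

text \<open>Hence every linear extension of \<open>swle\<close> on the domain, in particular the reading order, gives the same slide.\<close>

lemma swle_comparable_at_hole:
  fixes d c :: "'x \<Rightarrow> int \<times> int"
  assumes P: "pict I d c" and cd: "conv (d ` I)" and h: "h \<notin> c ` I"
    and p: "p \<in> I" "q \<in> I" "adj h (c p)" "adj h (c q)"
  shows "swle (d p) (d q) \<or> swle (d q) (d p)"
proof -
  have *: "swle (d p) (d q) \<or> swle (d q) (d p)"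
    if p: "p \<in> I" and q: "q \<in> I" and cp: "c p = (fst h, snd h + 1)" and cq: "c q = (fst h + 1, snd h)" for p q
  proof (rule ccontr)
    assume "\<not> ?thesis"
    then consider "fst (d p) < fst (d q)" "snd (d p) < snd (d q)" | "fst (d q) < fst (d p)" "snd (d q) < snd (d p)"
      unfolding swle_def by linarith
    then show False
    proof cases
      case 1
      \<comment> \<open>The corner in the row of \<open>d p\<close> and the column of
        \<open>d q\<close> would be sent strictly left of \<open>c p\<close> and strictly above
        \<open>c q\<close>, while staying weakly below and right of the hole, hence exactly onto the
        hole.\<close>
      have "(fst (d p), snd (d q)) \<in> d ` I"
        by (rule convD[OF cd, of "d p" "d q"]) (use 1 p q in \<open>auto simp: nwle_def\<close>)
      then obtain m where m: "m \<in> I" "d m = (fst (d p), snd (d q))" by auto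
      have "fst h \<le> fst (c m)" "snd (c m) < snd h + 1"
        using pictD1(2,3)[OF P p m(1)] 1 m(2) cp by (auto simp: nwle_def)
      moreover have "fst (c m) < fst h + 1" "snd h \<le> snd (c m)"
        using pictD1(1,4)[OF P m(1) q] 1 m(2) cq by (auto simp: nwle_def)
      ultimately have "c m = h" by (auto simp: prod_eq_iff)
      with h m(1) show False by auto
    next
      case 2
      then show False
        using pictD1(3)[OF P q p] cp cq by (auto simp: nwle_def)
    qed
  qed
  consider "c p = c q" | "c p = (fst h, snd h + 1)" "c q = (fst h + 1, snd h)"
    | "c q = (fst h, snd h + 1)" "c p = (fst h + 1, snd h)"
    using p(3,4) unfolding adj_def by auto
  then show ?thesis
  proof cases
    case 1
    then have n: "nwle (c p) (c q)" by (simp add: nwle_def)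
    show ?thesis using pictD2(1,2)[OF P p(1,2) n] by (simp add: swle_def)
  next
    case 2 then show ?thesis using * p by blast
  next
    case 3 then show ?thesis using * p by blast
  qed
qed

lemma pict_inj:
  assumes "pict I d c" "x \<in> I" "y \<in> I"
  shows "c x = c y \<longleftrightarrow> d x = d y"
proof -
  have *: "d x = d y" if "c x = c y"
    using pictD2(1,2)[OF assms(1,2,3)] pictD2(1,2)[OF assms(1,3,2)] that
    by (simp add: nwle_def prod_eq_iff)
  have "c x = c y" if "d x = d y"
    using pictD1(1,2)[OF assms(1,2,3)] pictD1(1,2)[OF assms(1,3,2)] that
    by (simp add: nwle_def prod_eq_iff)
  with * show ?thesis by blast
qed

text \<open>Only relations involving \<open>p\<close> can change. Moving \<open>c p\<close> into the
  hole makes it comparable with the boxes behind the other neighbour \<open>q\<close> of the hole.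
  For these, \<open>d p\<close> precedes \<open>d q\<close> by leastness, and \<open>d q\<close>
  precedes their preimages by the old picture condition.\<close>

lemma pict_fill_hole:
  fixes d c :: "'x \<Rightarrow> int \<times> int"
  assumes P: "pict I d c" and inj: "inj_on c I" and cc: "conv (insert h (c ` I))" and h: "h \<notin> c ` I"
    and p: "p \<in> I" and ap: "adj h (c p)"
    and least: "\<And>q. q \<in> I \<Longrightarrow> adj h (c q) \<Longrightarrow> swle (d p) (d q)"
  shows "pict I d (c(p := h))"
proof -
  obtain i j where hij: "h = (i, j)" by force
  have main: "dir (d p) (d u) h (c u) \<and> dir (d u) (d p) (c u) h
      \<and> dir h (c u) (d p) (d u) \<and> dir (c u) h (d u) (d p)"
    if u: "u \<in> I" "u \<noteq> p" for u
  proof -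
    obtain k l where ukl: "c u = (k, l)" by force
    have neh: "(k, l) \<noteq> (i, j)" using h u(1) ukl hij by (metis imageI)
    have nec: "c u \<noteq> c p" using inj u p by (auto dest: inj_onD)
    have ned: "d u \<noteq> d p" using pict_inj[OF P u(1) p] nec by blast
    \<comment> \<open>From a box \<open>u\<close> south-east of the hole and in a lower row,
      convexity produces a box \<open>z\<close> in the column of the hole and from it the neighbour
      \<open>q\<close> directly below the hole, where \<open>least\<close> applies.\<close>
    have right: "\<exists>z\<in>I. c z = (k, j) \<and> swle (d p) (d z)"
      if A: "i < k" "j \<le> l" "c p = (i, j + 1)"
    proof -
      obtain z where z: "z \<in> I" "c z = (k, j)"
        using conv_insert_image[OF cc u(1), of "(k, j)"] A hij ukl
          unfolding nwle_def by (auto simp del: add_le_cancel_left)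
      obtain q where q: "q \<in> I" "c q = (i + 1, j)"
        using conv_insert_image[OF cc z(1), of "(i + 1, j)"] A hij z(2)
          unfolding nwle_def by (auto simp del: add_le_cancel_left)
      have "swle (d p) (d q)" using least[OF q(1)] q(2) hij by (simp add: adj_def)
      moreover have "swle (d q) (d z)" using pictD2(1,2)[OF P q(1) z(1)] q(2) z(2) A
        by (auto simp: nwle_def swle_def)
      ultimately show ?thesis using z by (auto simp: swle_def)
    qed
    have below: "\<exists>z\<in>I. c z = (i, l) \<and> swle (d p) (d z)"
      if A: "j < l" "i \<le> k" "c p = (i + 1, j)"
    proof -
      obtain z where z: "z \<in> I" "c z = (i, l)"
        using conv_insert_image[OF cc u(1), of "(i, l)"] A hij ukl
          unfolding nwle_def by (auto simp del: add_le_cancel_left)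
      obtain q where q: "q \<in> I" "c q = (i, j + 1)"
        using conv_insert_image[OF cc z(1), of "(i, j + 1)"] A hij z(2)
          unfolding nwle_def by (auto simp del: add_le_cancel_left)
      have "swle (d p) (d q)" using least[OF q(1)] q(2) hij by (simp add: adj_def)
      moreover have "swle (d q) (d z)" using pictD2(1,2)[OF P q(1) z(1)] q(2) z(2) A
        by (auto simp: nwle_def swle_def)
      ultimately show ?thesis using z by (auto simp: swle_def)
    qed
    from ap consider (R) "c p = (i, j + 1)" | (B) "c p = (i + 1, j)"
      by (auto simp: adj_def hij)
    then show ?thesis
    proof cases
      case R
      have nlj: "l \<le> j + 1 \<Longrightarrow> j \<le> l \<Longrightarrow> i \<le> k \<Longrightarrow> i < k"
        using neh nec ukl R by (cases "l = j") auto
      \<comment> \<open>Columns \<open>j\<close> and \<open>j + 1\<close> are the critical ones: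
        boxes of the former become newly comparable with \<open>p\<close>, boxes of the latter
        become strictly right of it.\<close>
      have X1: "snd (d u) \<le> snd (d p) \<and> fst (d p) \<le> fst (d u) \<and> (l = j + 1 \<longrightarrow> snd (d u) < snd (d p))"
        if ik: "i < k" and lj: "l = j \<or> l = j + 1"
      proof -
        obtain z where z: "z \<in> I" "c z = (k, j)" "swle (d p) (d z)"
          using right ik lj R by auto
        show ?thesis
          using pictD2[OF P z(1) u(1)] z(2,3) ukl lj by (auto simp: nwle_def swle_def)
      qed
      have a: "dir (d p) (d u) h (c u)"
      proof (cases "nwle (d p) (d u)")
        case True
        have n: "l \<le> j + 1" "i \<le> k" "snd (d p) \<le> snd (d u)"
          "snd (d p) < snd (d u) \<Longrightarrow> l < j + 1" "fst (d p) < fst (d u) \<Longrightarrow> i < k"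
          using pictD1[OF P p u(1) True] True R ukl by (auto simp: nwle_def)
        have "l \<noteq> j + 1" using X1 n nlj by linarith
        moreover have "l \<noteq> j" if "snd (d p) < snd (d u)" using X1 n nlj that by linarith
        ultimately show ?thesis using n unfolding dir_def hij ukl swle_def by force
      qed (simp add: dir_def)
      have b: "dir (d u) (d p) (c u) h"
        unfolding dir_def hij ukl
        using pictD1[OF P u(1) p] R ukl by (auto simp: swle_def nwle_def)
      have c: "dir (c u) h (d u) (d p)"
        unfolding dir_def hij ukl
        using pictD2[OF P u(1) p] R ukl by (auto simp: swle_def nwle_def)
      have d: "dir h (c u) (d p) (d u)"
      proof (cases "nwle h (c u)")
        case True
        then have T: "i \<le> k" "j \<le> l" by (auto simp: hij ukl nwle_def)
        consider "l = j" "i < k" | "l = j + 1" "i < k" | "l > j + 1"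
          using T nlj by linarith
        then show ?thesis
        proof cases
          case 1
          then have x: "snd (d u) \<le> snd (d p)" "fst (d p) \<le> fst (d u)" using X1 by auto
          have "fst (d p) \<noteq> fst (d u)"
          proof
            assume e: "fst (d p) = fst (d u)"
            with x ned have "snd (d u) < snd (d p)" by (metis prod_eq_iff order.not_eq_order_implies_strict)
            then show False using pictD1(3)[OF P u(1) p] e R ukl 1 by (auto simp: nwle_def)
          qed
          then show ?thesis using x 1 unfolding dir_def hij ukl swle_def by auto
        next
          case 2
          then show ?thesis using X1 pictD2[OF P p u(1)] R ukl
            unfolding dir_def hij ukl swle_def by (auto simp: nwle_def)
        next
          case 3
          then show ?thesis using pictD2[OF P p u(1)] R ukl T
            unfolding dir_def hij ukl swle_def by (auto simp: nwle_def)
        qed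
      qed (simp add: dir_def)
      show ?thesis using a b c d by blast
    next
      case B
      have nlj: "k \<le> i + 1 \<Longrightarrow> i \<le> k \<Longrightarrow> j \<le> l \<Longrightarrow> j < l"
        using neh nec ukl B by (cases "k = i") auto
      \<comment> \<open>The transposed situation, with rows \<open>i\<close> and
        \<open>i + 1\<close> in place of the two columns.\<close>
      have X1: "snd (d u) \<le> snd (d p) \<and> fst (d p) \<le> fst (d u) \<and> (k = i + 1 \<longrightarrow> fst (d p) < fst (d u))"
        if ik: "j < l" and lj: "k = i \<or> k = i + 1"
      proof -
        obtain z where z: "z \<in> I" "c z = (i, l)" "swle (d p) (d z)"
          using below ik lj B by auto
        show ?thesis
          using pictD2[OF P z(1) u(1)] z(2,3) ukl lj by (auto simp: nwle_def swle_def)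
      qed
      have a: "dir (d u) (d p) (c u) h"
      proof (cases "nwle (d u) (d p)")
        case True
        have n: "k \<le> i + 1" "j \<le> l" "fst (d u) \<le> fst (d p)"
          "fst (d u) < fst (d p) \<Longrightarrow> k < i + 1" "snd (d u) < snd (d p) \<Longrightarrow> j < l"
          using pictD1[OF P u(1) p True] True B ukl by (auto simp: nwle_def)
        have "k \<noteq> i + 1" using X1 n nlj by linarith
        moreover have "k \<noteq> i" if "fst (d u) < fst (d p)" using X1 n nlj that by linarith
        ultimately show ?thesis using n unfolding dir_def hij ukl swle_def by force
      qed (simp add: dir_def)
      have b: "dir (d p) (d u) h (c u)"
        unfolding dir_def hij ukl
        using pictD1[OF P p u(1)] B ukl by (auto simp: swle_def nwle_def)
      have c: "dir (c u) h (d u) (d p)"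
        unfolding dir_def hij ukl
        using pictD2[OF P u(1) p] B ukl by (auto simp: swle_def nwle_def)
      have d: "dir h (c u) (d p) (d u)"
      proof (cases "nwle h (c u)")
        case True
        then have T: "i \<le> k" "j \<le> l" by (auto simp: hij ukl nwle_def)
        consider "k = i" "j < l" | "k = i + 1" "j < l" | "k > i + 1"
          using T nlj by linarith
        then show ?thesis
        proof cases
          case 1
          then have x: "snd (d u) \<le> snd (d p)" "fst (d p) \<le> fst (d u)" using X1 by auto
          have "snd (d p) \<noteq> snd (d u)"
          proof
            assume e: "snd (d p) = snd (d u)"
            with x ned have "fst (d p) < fst (d u)" by (metis prod_eq_iff order.not_eq_order_implies_strict)
            then show False using pictD1(4)[OF P p u(1)] e B ukl 1 by (auto simp: nwle_def)
          qed
          then show ?thesis using x 1 unfolding dir_def hij ukl swle_def by auto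
        next
          case 2
          then show ?thesis using X1 pictD2[OF P p u(1)] B ukl
            unfolding dir_def hij ukl swle_def by (auto simp: nwle_def)
        next
          case 3
          then show ?thesis using pictD2[OF P p u(1)] B ukl T
            unfolding dir_def hij ukl swle_def by (auto simp: nwle_def)
        qed
      qed (simp add: dir_def)
      show ?thesis using a b c d by blast
    qed
  qed
  have refl: "dir h h (d p) (d p)" "dir (d p) (d p) h h" by (simp_all add: dir_def swle_def)
  have old: "dir (d x) (d y) (c x) (c y) \<and> dir (c x) (c y) (d x) (d y)" if "x \<in> I" "y \<in> I" for x y
    using P that unfolding pict_def by blast
  show ?thesis
    unfolding pict_def
  proof (intro ballI)
    fix x y assume "x \<in> I" "y \<in> I"
    then show "dir (d x) (d y) ((c(p := h)) x) ((c(p := h)) y) \<and>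
        dir ((c(p := h)) x) ((c(p := h)) y) (d x) (d y)"
      using main[of x] main[of y] old[of x y] refl by (cases "x = p"; cases "y = p") simp_all
  qed
qed

section \<open>Sequences of boxes and switching\<close>

text \<open>Adding the boxes of a chain one by one to an inner shape gives a growing sequence of shapes. Labelled by
  position, the boxes of a chain form a standard tableau.\<close>

definition chain :: "box list \<Rightarrow> bool" where
  "chain L \<longleftrightarrow> conv (set L) \<and> sorted_wrt (\<lambda>a b. \<not> nwle b a) L"

lemma nwle_refl [simp]: "nwle a a" and swle_refl [simp]: "swle a a"
  by (simp_all add: order_defs)

lemma nwle_trans: "nwle a b \<Longrightarrow> nwle b c \<Longrightarrow> nwle a c"
  unfolding nwle_def by force

lemma sorted_wrt_irrefl_distinct: "sorted_wrt R L \<Longrightarrow> (\<And>a. \<not> R a a) \<Longrightarrow> distinct L"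
  by (induction L) auto

lemma chain_distinct: "chain L \<Longrightarrow> distinct L"
  unfolding chain_def by (rule sorted_wrt_irrefl_distinct) auto

lemma chain_infix:
  assumes "chain (xs @ ys @ zs)"
  shows "chain ys"
proof -
  have "b \<in> set ys" if "a \<in> set ys" "c \<in> set ys" "nwle a b" "nwle b c" for a b c
  proof -
    have "b \<in> set (xs @ ys @ zs)"
      by (rule convD[of _ a c]) (use assms that in \<open>auto simp: chain_def\<close>)
    then show ?thesis
      using assms that by (auto simp: chain_def sorted_wrt_append)
  qed
  then have "conv (set ys)" unfolding conv_def by blast
  then show ?thesis
    using assms unfolding chain_def by (simp add: sorted_wrt_append)
qed

lemma chain_prefix: "chain (xs @ ys) \<Longrightarrow> chain xs"
  using chain_infix[of "[]" xs ys] by simp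

lemma chain_suffix: "chain (xs @ ys) \<Longrightarrow> chain ys"
  using chain_infix[of xs ys "[]"] by simp

text \<open>Two consecutive boxes form a convex set by themselves, so the neighbour of the first on
  the way to the second must already be the second.\<close>

lemma chain_pair_adj:
  assumes "chain (xs @ e # c # ys)" "nwle e c"
  shows "adj e c"
proof -
  have ch: "chain [e, c]" using chain_infix[of xs "[e, c]" ys] assms by simp
  then have ne: "e \<noteq> c" and cv: "conv {e, c}" by (auto simp: chain_def)
  obtain b where b: "adj e b" "nwle e b" "nwle b c" "b \<noteq> e"
  proof (cases "snd e < snd c")
    case True
    then show ?thesis using that[of "(fst e, snd e + 1)"] assms(2)
      by (cases e) (auto simp: adj_def nwle_def)
  next
    case False
    then show ?thesis using that[of "(fst e + 1, snd e)"] assms(2) ne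
      by (cases e; cases c) (auto simp: adj_def nwle_def)
  qed
  then have "b \<in> {e, c}" using convD[OF cv, of e c b] by simp
  with b show ?thesis by auto
qed

lemma adj_nwle: "adj e c \<Longrightarrow> nwle e (c :: box)"
  by (auto simp: adj_def nwle_def)

text \<open>The first component of the result continues the list of \<open>c\<close>, the second
  that of \<open>e\<close>. Boxes that are not neighbours are added in the opposite order.
  Neighbours can be added in one order only, so the boxes stay where they are and the two lists
  exchange them.\<close>

definition switch :: "box \<Rightarrow> box \<Rightarrow> box \<times> box" where
  "switch e c = (if adj e c then (e, c) else (c, e))"

lemma chain_switch:
  assumes "chain (xs @ e # c # ys)" "switch e c = (c', e')"
  shows "chain (xs @ c' # e' # ys)"
proof (cases "adj e c")
  case True
  then show ?thesis using assms by (simp add: switch_def)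
next
  case False
  then have "\<not> nwle e c" using chain_pair_adj[OF assms(1)] by blast
  moreover have "set (xs @ c # e # ys) = set (xs @ e # c # ys)" by auto
  ultimately have "chain (xs @ c # e # ys)"
    using assms(1) unfolding chain_def by (auto simp: sorted_wrt_append insert_commute)
  then show ?thesis using False assms(2) by (simp add: switch_def)
qed

lemma switch_involution:
  assumes "chain (xs @ e # c # ys)" "switch e c = (c', e')"
  shows "switch c' e' = (e, c)"
proof -
  have "\<not> nwle c e" using assms(1) by (auto simp: chain_def sorted_wrt_append)
  then show ?thesis using assms(2) adj_nwle[of c e] by (auto simp: switch_def split: if_splits)
qed

text \<open>\<open>pass\<close> carries a hole outwards through a list, an ordinary slide;
  \<open>bpass\<close> carries one inwards, a reverse slide; \<open>infuse\<close> fills a whole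
  grid of switches. Its recursion lets the last box of the inner list travel before the others, in
  accordance with decreasing labels.\<close>

fun pass :: "box \<Rightarrow> box list \<Rightarrow> box list \<times> box" where
  "pass e [] = ([], e)"
| "pass e (c # cs) = (let (c', e') = switch e c; (cs', e'') = pass e' cs in (c' # cs', e''))"

fun bpass :: "box list \<Rightarrow> box \<Rightarrow> box \<times> box list" where
  "bpass [] c = (c, [])"
| "bpass (e # es) c = (let (c', es') = bpass es c; (c'', e') = switch e c' in (c'', e' # es'))"

fun infuse :: "box list \<Rightarrow> box list \<Rightarrow> box list \<times> box list" where
  "infuse [] cs = (cs, [])"
| "infuse (e # es) cs = (let (cs', es') = infuse es cs; (cs'', e') = pass e cs' in (cs'', e' # es'))"

lemma infuse_Nil2 [simp]: "infuse es [] = ([], es)"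
  by (induction es) auto

text \<open>The same grid of switches read by columns, as reverse slides of the inner list. This
  second reading yields the involutivity of infusion and the control over the inner list.\<close>

lemma infuse_Cons2:
  "infuse es (c # cs) = (let (c', es1) = bpass es c; (cs', es2) = infuse es1 cs in (c' # cs', es2))"
  by (induction es) (auto simp: Let_def split: prod.splits)

lemma switch_set: "switch e c = (c', e') \<Longrightarrow> {c', e'} = {e, c}"
  by (auto simp: switch_def split: if_splits)

lemma chain_pass:
  assumes "chain (xs @ e # cs @ ys)" "pass e cs = (cs', e')"
  shows "chain (xs @ cs' @ e' # ys)" "length cs' = length cs" "insert e' (set cs') = insert e (set cs)"
proof -
  have "chain (xs @ cs' @ e' # ys) \<and> length cs' = length cs \<and> insert e' (set cs') = insert e (set cs)"
    using assms
  proof (induction cs arbitrary: xs e cs')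
    case (Cons c cs)
    obtain c1 e1 where s: "switch e c = (c1, e1)" by (rule prod.exhaust)
    obtain cs1 where p: "pass e1 cs = (cs1, e')" and cs': "cs' = c1 # cs1"
      using Cons.prems(2) s by (auto split: prod.splits)
    have "chain ((xs @ [c1]) @ e1 # cs @ ys)"
      using chain_switch[of xs e c "cs @ ys"] Cons.prems(1) s by simp
    from Cons.IH[OF this p] switch_set[OF s] show ?case by (auto simp: cs')
  qed simp
  then show "chain (xs @ cs' @ e' # ys)" "length cs' = length cs" "insert e' (set cs') = insert e (set cs)"
    by blast+
qed

lemma chain_bpass:
  assumes "chain (xs @ es @ c # ys)" "bpass es c = (c', es')"
  shows "chain (xs @ c' # es' @ ys)" "length es' = length es" "insert c' (set es') = insert c (set es)"
proof -
  have "chain (xs @ c' # es' @ ys) \<and> length es' = length es \<and> insert c' (set es') = insert c (set es)"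
    using assms
  proof (induction es arbitrary: xs c' es')
    case (Cons e es)
    obtain c1 es1 where b: "bpass es c = (c1, es1)" by (rule prod.exhaust)
    obtain e1 where s: "switch e c1 = (c', e1)" and es': "es' = e1 # es1"
      using Cons.prems(2) b by (auto split: prod.splits)
    have *: "chain ((xs @ [e]) @ c1 # es1 @ ys) \<and> length es1 = length es \<and> insert c1 (set es1) = insert c (set es)"
      using Cons.IH[of "xs @ [e]" c1 es1] Cons.prems(1) b by simp
    then show ?case using chain_switch[of xs e c1 "es1 @ ys"] s switch_set[OF s] by (auto simp: es')
  qed simp
  then show "chain (xs @ c' # es' @ ys)" "length es' = length es" "insert c' (set es') = insert c (set es)"
    by blast+
qed

lemma bpass_pass:
  assumes "chain (xs @ e # cs @ ys)" "pass e cs = (cs', e')"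
  shows "bpass cs' e' = (e, cs)"
  using assms
proof (induction cs arbitrary: xs e cs')
  case (Cons c cs)
  obtain c1 e1 where s: "switch e c = (c1, e1)" by (rule prod.exhaust)
  obtain cs1 where p: "pass e1 cs = (cs1, e')" and cs': "cs' = c1 # cs1"
    using Cons.prems(2) s by (auto split: prod.splits)
  have "chain ((xs @ [c1]) @ e1 # cs @ ys)"
    using chain_switch[of xs e c "cs @ ys"] Cons.prems(1) s by simp
  from Cons.IH[OF this p] have "bpass cs1 e' = (e1, cs)" .
  moreover have "switch c1 e1 = (e, c)"
    using switch_involution[of xs e c "cs @ ys"] Cons.prems(1) s by simp
  ultimately show ?case by (simp add: cs')
qed simp

lemma chain_infuse:
  assumes "chain (xs @ es @ cs @ ys)" "infuse es cs = (cs', es')"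
  shows "chain (xs @ cs' @ es' @ ys)" "length cs' = length cs" "length es' = length es"
    "set cs' \<union> set es' = set es \<union> set cs" "infuse cs' es' = (es, cs)"
proof -
  have "chain (xs @ cs' @ es' @ ys) \<and> length cs' = length cs \<and> length es' = length es
     \<and> set cs' \<union> set es' = set es \<union> set cs \<and> infuse cs' es' = (es, cs)"
    using assms
  proof (induction es arbitrary: xs cs' es')
    case (Cons e es)
    obtain cs1 es1 where i: "infuse es cs = (cs1, es1)" by (rule prod.exhaust)
    obtain e1 where p: "pass e cs1 = (cs', e1)" and es': "es' = e1 # es1"
      using Cons.prems(2) i by (auto split: prod.splits)
    have *: "chain ((xs @ [e]) @ cs1 @ es1 @ ys) \<and> length cs1 = length cs \<and> length es1 = length es
     \<and> set cs1 \<union> set es1 = set es \<union> set cs \<and> infuse cs1 es1 = (es, cs)"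
      using Cons.IH[of "xs @ [e]" cs1 es1] Cons.prems(1) i by simp
    then have ch: "chain (xs @ e # cs1 @ es1 @ ys)" by simp
    note q = chain_pass[OF ch p] bpass_pass[OF ch p]
    \<comment> \<open>Read by columns, the second infusion opens with the reverse slide of
      \<open>e1\<close> through \<open>cs'\<close>, which undoes \<open>pass\<close>.\<close>
    have "infuse cs' (e1 # es1) = (e # es, cs)"
      using * q(4) by (simp add: infuse_Cons2)
    then show ?case using * q by (auto simp: es')
  qed simp
  then show "chain (xs @ cs' @ es' @ ys)" "length cs' = length cs" "length es' = length es"
    "set cs' \<union> set es' = set es \<union> set cs" "infuse cs' es' = (es, cs)"
    by blast+
qed

section \<open>Pictures listed in reading order\<close>

definition rlless :: "box \<Rightarrow> box \<Rightarrow> bool" where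
  "rlless a b \<longleftrightarrow> fst a < fst b \<or> fst a = fst b \<and> snd b < snd a"

definition sdom :: "box list \<Rightarrow> bool" where
  "sdom ds \<longleftrightarrow> sorted_wrt rlless ds \<and> conv (set ds)"

text \<open>Position \<open>k\<close> couples \<open>ds ! k\<close> with \<open>cs ! k\<close>. When
  \<open>ds\<close> is in reading order, \<open>k + 1\<close> is the label of both boxes, so the
  list \<open>cs\<close> alone encodes the tableau.\<close>

definition pic :: "box list \<Rightarrow> box list \<Rightarrow> bool" where
  "pic ds cs \<longleftrightarrow> length ds = length cs \<and> pict {..<length ds} ((!) ds) ((!) cs)"

lemma rlless_irrefl [simp]: "\<not> rlless a a"
  by (simp add: rlless_def)

lemma sdom_distinct: "sdom ds \<Longrightarrow> distinct ds"
  unfolding sdom_def by (rule sorted_wrt_irrefl_distinct) auto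


text \<open>Rotating both the domain and the image by 180 degrees (\<open>nbx\<close>) preserves pictures and turns outward slides
  into inward ones; integer coordinates make the rotation available.\<close>

definition ibox :: "box \<Rightarrow> int \<times> int" where "ibox a = (int (fst a), int (snd a))"
definition nbx :: "box \<Rightarrow> int \<times> int" where "nbx a = (- int (fst a), - int (snd a))"

lemma inj_ibox: "inj_on ibox A" and inj_nbx: "inj_on nbx A"
  by (auto simp: inj_on_def ibox_def nbx_def prod_eq_iff)

lemma ibox_le: "nwle (ibox a) (ibox b) = nwle a b" "swle (ibox a) (ibox b) = swle a b"
  "nwle (nbx a) (nbx b) = nwle b a" "swle (nbx a) (nbx b) = swle b a"
  by (auto simp: ibox_def nbx_def order_defs)

lemma ibox_adj: "adj (ibox a) (ibox b) = adj a b" "adj (nbx a) (nbx b) = adj b a"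
  by (auto simp: ibox_def nbx_def adj_def prod_eq_iff)

lemma dir_ibox: "dir (ibox a) (ibox a') (ibox b) (ibox b') = dir a a' b b'"
  "dir (nbx a) (nbx a') (nbx b) (nbx b') = dir a' a b' b"
  unfolding dir_def ibox_le by (auto simp: ibox_def nbx_def)

lemma pict_ibox: "pict I (ibox \<circ> d) (ibox \<circ> c) = pict I d c"
  "pict I (nbx \<circ> d) (nbx \<circ> c) = pict I d c"
  unfolding pict_def comp_def dir_ibox by blast+

lemma conv_ibox:
  assumes S: "conv S"
  shows "conv (ibox ` S)"
  unfolding conv_def
proof (intro ballI allI impI)
  fix x y b assume xy: "x \<in> ibox ` S" "y \<in> ibox ` S" and le: "nwle x b \<and> nwle b y"
  then obtain a c where ac: "a \<in> S" "c \<in> S" "x = ibox a" "y = ibox c" by auto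
  have b: "b = ibox (nat (fst b), nat (snd b))" (is "b = ibox ?b") using le ac(3,4) by (cases b) (simp add: ibox_def nwle_def)
  have "nwle a ?b \<and> nwle ?b c" using le unfolding ac(3,4) by (subst (asm) (1 2) b) (simp only: ibox_le)
  then have "?b \<in> S" by (intro convD[OF S ac(1,2)]) auto
  then show "b \<in> ibox ` S" by (subst b) (rule imageI)
qed

lemma conv_nbx:
  assumes S: "conv S"
  shows "conv (nbx ` S)"
  unfolding conv_def
proof (intro ballI allI impI)
  fix x y b assume xy: "x \<in> nbx ` S" "y \<in> nbx ` S" and le: "nwle x b \<and> nwle b y"
  then obtain a c where ac: "a \<in> S" "c \<in> S" "x = nbx a" "y = nbx c" by auto
  have b: "b = nbx (nat (- fst b), nat (- snd b))" (is "b = nbx ?b") using le ac(3,4) by (cases b) (simp add: nbx_def nwle_def)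
  have "nwle ?b a \<and> nwle c ?b" using le unfolding ac(3,4) by (subst (asm) (1 2) b) (simp only: ibox_le)
  then have "?b \<in> S" by (intro convD[OF S ac(2,1)]) auto
  then show "b \<in> nbx ` S" by (subst b) (rule imageI)
qed

lemma pict_cong: "(\<And>x. x \<in> I \<Longrightarrow> c x = c' x) \<Longrightarrow> pict I d c = pict I d c'"
  unfolding pict_def by simp

lemma nth_mid: "(((!) (xs @ c # ys))(length xs := h)) k = (xs @ h # ys) ! k"
  by (auto simp: nth_append nth_Cons split: nat.splits)

text \<open>The reading order is a linear extension of \<open>swle\<close>; the earlier of two
  comparable boxes has the smaller label.\<close>

lemma sdom_swle_index:
  assumes "sdom ds" "p < length ds" "q < length ds" "swle (ds ! p) (ds ! q)"
  shows "p \<le> q"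
proof (rule ccontr)
  assume "\<not> p \<le> q"
  then have "rlless (ds ! q) (ds ! p)"
    using assms by (auto simp: sdom_def sorted_wrt_iff_nth_less)
  then show False using assms(4) by (auto simp: rlless_def swle_def)
qed

text \<open>\<open>\<phi>\<close> is \<open>ibox\<close> when the box moves north-west into the hole
  and \<open>nbx\<close> when it moves south-east, so that one proof covers both. Preimages of boxes
  adjacent to the hole are comparable, hence the minimality demanded in \<open>least\<close> already
  makes the box the least one.\<close>

lemma pic_fill_hole:
  fixes \<phi> :: "box \<Rightarrow> int \<times> int"
  assumes ds: "sdom ds" and P: "pic ds (xs @ c # ys)" and ch: "chain L"
    and L: "set L = insert h (set (xs @ c # ys))" "h \<notin> set (xs @ c # ys)" "distinct (xs @ c # ys)"
    and \<phi>: "\<phi> = ibox \<or> \<phi> = nbx" and a: "adj (\<phi> h) (\<phi> c)"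
    and least: "\<And>q. q < length ds \<Longrightarrow> adj (\<phi> h) (\<phi> ((xs @ c # ys) ! q)) \<Longrightarrow>
        swle (\<phi> (ds ! q)) (\<phi> (ds ! length xs)) \<Longrightarrow> q = length xs"
  shows "pic ds (xs @ h # ys)"
proof -
  let ?L = "xs @ c # ys" and ?X = "{..<length ds}" and ?p = "length xs"
  have len: "length ds = length ?L" using P by (simp add: pic_def)
  have im: "((!) zs) ` {..<length zs} = set zs" for zs :: "box list" by (auto simp: set_conv_nth)
  have imL: "((!) ?L) ` ?X = set ?L" using im[of ?L] len by simp
  have tr: "pict I (\<phi> \<circ> d) (\<phi> \<circ> e) = pict I d e" for I :: "nat set" and d e
    using \<phi> pict_ibox by blast
  have cv: "conv (\<phi> ` S)" if "conv S" for S using \<phi> that conv_ibox conv_nbx by blast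
  have inj: "inj_on \<phi> A" for A using \<phi> inj_ibox inj_nbx by blast
  have P': "pict ?X (\<phi> \<circ> (!) ds) (\<phi> \<circ> (!) ?L)"
    using P unfolding tr pic_def by blast
  have pX: "?p \<in> ?X" using len by simp
  have cds: "conv ((\<phi> \<circ> (!) ds) ` ?X)"
    using cv[of "set ds"] ds unfolding image_comp[symmetric] im sdom_def by blast
  have hn: "\<phi> h \<notin> (\<phi> \<circ> (!) ?L) ` ?X"
    using L(2) inj[of UNIV] unfolding image_comp[symmetric] imL
    by (simp add: inj_image_mem_iff del: set_append)
  have "pict ?X (\<phi> \<circ> (!) ds) ((\<phi> \<circ> (!) ?L)(?p := \<phi> h))"
  proof (rule pict_fill_hole[OF P'])
    show "inj_on (\<phi> \<circ> (!) ?L) ?X"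
      using len L(3) inj by (intro comp_inj_on) (auto simp: inj_on_nth)
    show "conv (insert (\<phi> h) ((\<phi> \<circ> (!) ?L) ` ?X))"
      using cv[of "set L"] ch unfolding image_comp[symmetric] imL chain_def L(1) by simp
    show "\<phi> h \<notin> (\<phi> \<circ> (!) ?L) ` ?X" by (rule hn)
    show "?p \<in> ?X" by (rule pX)
    show "adj (\<phi> h) ((\<phi> \<circ> (!) ?L) ?p)" using a by simp
    fix q assume q: "q \<in> ?X" "adj (\<phi> h) ((\<phi> \<circ> (!) ?L) q)"
    have "swle ((\<phi> \<circ> (!) ds) ?p) ((\<phi> \<circ> (!) ds) q) \<or> swle ((\<phi> \<circ> (!) ds) q) ((\<phi> \<circ> (!) ds) ?p)"
      by (rule swle_comparable_at_hole[OF P' cds hn pX q(1)]) (use a q(2) in auto)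
    then show "swle ((\<phi> \<circ> (!) ds) ?p) ((\<phi> \<circ> (!) ds) q)"
      using least[of q] q by auto
  qed
  also have "(\<phi> \<circ> (!) ?L)(?p := \<phi> h) = \<phi> \<circ> ((!) ?L)(?p := h)" by auto
  finally have "pict ?X ((!) ds) (((!) ?L)(?p := h))" unfolding tr .
  also have "pict ?X ((!) ds) (((!) ?L)(?p := h)) = pict ?X ((!) ds) ((!) (xs @ h # ys))"
    by (intro pict_cong nth_mid)
  finally show ?thesis using len unfolding pic_def by simp
qed

text \<open>The chain itself selects the box to be moved. A right or lower neighbour of the hole
  cannot stand before the hole in the chain, and of those behind it the nearest one in the list has
  the earliest preimage.\<close>

lemma pic_step_forward:
  assumes ds: "sdom ds" and P: "pic ds (xs @ c # ys)" and ch: "chain (xs @ h # c # ys)" and a: "adj h c"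
  shows "pic ds (xs @ h # ys)"
proof (rule pic_fill_hole[OF ds P ch _ _ _ disjI1[OF refl]])
  show "distinct (xs @ c # ys)" "h \<notin> set (xs @ c # ys)" using chain_distinct[OF ch] by auto
  show "adj (ibox h) (ibox c)" using a by (simp add: ibox_adj)
  fix q assume q: "q < length ds" "adj (ibox h) (ibox ((xs @ c # ys) ! q))"
    "swle (ibox (ds ! q)) (ibox (ds ! length xs))"
  have len: "length ds = length (xs @ c # ys)" using P by (simp add: pic_def)
  have le: "q \<le> length xs" using sdom_swle_index[OF ds q(1)] q(3) len by (simp add: ibox_le)
  have "\<not> q < length xs"
  proof
    assume l: "q < length xs"
    then have "nwle h (xs ! q)" using q(2) by (auto simp: ibox_adj nth_append intro: adj_nwle)
    then show False using ch l by (auto simp: chain_def sorted_wrt_append)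
  qed
  with le show "q = length xs" by simp
qed auto

lemma pic_step_backward:
  assumes ds: "sdom ds" and P: "pic ds (xs @ c # ys)" and ch: "chain (xs @ c # h # ys)" and a: "adj c h"
  shows "pic ds (xs @ h # ys)"
proof (rule pic_fill_hole[OF ds P ch _ _ _ disjI2[OF refl]])
  show "distinct (xs @ c # ys)" "h \<notin> set (xs @ c # ys)" using chain_distinct[OF ch] by auto
  show "adj (nbx h) (nbx c)" using a by (simp add: ibox_adj)
  fix q assume q: "q < length ds" "adj (nbx h) (nbx ((xs @ c # ys) ! q))"
    "swle (nbx (ds ! q)) (nbx (ds ! length xs))"
  have len: "length ds = length (xs @ c # ys)" using P by (simp add: pic_def)
  have le: "length xs \<le> q" using sdom_swle_index[OF ds _ q(1)] q(3) len by (simp add: ibox_le)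
  have "\<not> length xs < q"
  proof
    assume l: "length xs < q"
    then have y: "(xs @ c # ys) ! q \<in> set ys" using q(1) len by (auto simp: nth_append nth_Cons split: nat.splits)
    have "nwle ((xs @ c # ys) ! q) h" using q(2) by (auto simp: ibox_adj intro: adj_nwle)
    then show False using ch y by (auto simp: chain_def sorted_wrt_append)
  qed
  with le show "q = length xs" by simp
qed auto

lemma pic_switch:
  assumes "sdom ds" "chain (xs @ e # c # ys)" "switch e c = (c', e')"
  shows "pic ds (xs @ c # ys) \<Longrightarrow> pic ds (xs @ c' # ys)" "pic ds (xs @ e # ys) \<Longrightarrow> pic ds (xs @ e' # ys)"
  using pic_step_forward[OF assms(1) _ assms(2)] pic_step_backward[OF assms(1) _ assms(2)] assms(3)
  by (auto simp: switch_def split: if_splits)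

lemma pic_pass:
  assumes "sdom ds" "pic ds (xs @ cs @ ys)" "chain (xs @ e # cs @ ys)" "pass e cs = (cs', e')"
  shows "pic ds (xs @ cs' @ ys)"
  using assms(2-)
proof (induction cs arbitrary: xs e cs')
  case (Cons c cs)
  obtain c1 e1 where s: "switch e c = (c1, e1)" by (rule prod.exhaust)
  obtain cs1 where p: "pass e1 cs = (cs1, e')" and cs': "cs' = c1 # cs1"
    using Cons.prems(3) s by (auto split: prod.splits)
  have "chain ((xs @ [c1]) @ e1 # cs @ ys)"
    using chain_switch[of xs e c "cs @ ys"] Cons.prems(2) s by simp
  moreover have "pic ds ((xs @ [c1]) @ cs @ ys)"
    using pic_switch(1)[OF assms(1), of xs e c "cs @ ys"] Cons.prems s by simp
  ultimately show ?case using Cons.IH[of "xs @ [c1]" e1 cs1] p by (simp add: cs')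
qed simp

lemma pic_bpass:
  assumes "sdom ds" "pic ds (xs @ es @ ys)" "chain (xs @ es @ c # ys)" "bpass es c = (c', es')"
  shows "pic ds (xs @ es' @ ys)"
  using assms(2-)
proof (induction es arbitrary: xs c' es')
  case (Cons e es)
  obtain c1 es1 where b: "bpass es c = (c1, es1)" by (rule prod.exhaust)
  obtain e1 where s: "switch e c1 = (c', e1)" and es': "es' = e1 # es1"
    using Cons.prems(3) b by (auto split: prod.splits)
  have "pic ds ((xs @ [e]) @ es1 @ ys)" using Cons.IH[of "xs @ [e]" c1 es1] Cons.prems b by simp
  moreover have "chain (xs @ e # c1 # es1 @ ys)"
    using chain_bpass(1)[of "xs @ [e]" es c ys c1 es1] Cons.prems b by simp
  ultimately show ?case using pic_switch(2)[OF assms(1), of xs e c1 "es1 @ ys"] s by (simp add: es')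
qed simp

text \<open>The outer list moves by slides and the inner one by reverse slides of the same grid of
  switches, hence two inductions: over \<open>es\<close> by rows and over \<open>cs\<close> by
  columns.\<close>

lemma pic_infuse:
  assumes "sdom dc" "sdom de" "pic dc cs" "pic de es" "chain (es @ cs)" "infuse es cs = (cs', es')"
  shows "pic dc cs'" "pic de es'"
proof -
  show "pic dc cs'" using assms(3,5,6)
  proof (induction es arbitrary: cs' es')
    case (Cons e es)
    obtain cs1 es1 where i: "infuse es cs = (cs1, es1)" by (rule prod.exhaust)
    obtain e1 where p: "pass e cs1 = (cs', e1)" and es': "es' = e1 # es1"
      using Cons.prems(3) i by (auto split: prod.splits)
    have ch: "chain (es @ cs)" using chain_suffix[of "[e]"] Cons.prems(2) by simp
    have "chain ([e] @ cs1 @ es1)" using chain_infuse(1)[of "[e]" es cs "[]"] Cons.prems(2) i by simp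
    then have "chain (e # cs1)" using chain_prefix[of "e # cs1" es1] by simp
    then show ?case using pic_pass[OF assms(1), of "[]" cs1 "[]" e cs' e1] Cons.IH[OF Cons.prems(1) ch i] p by simp
  qed simp
  show "pic de es'" using assms(4,5,6)
  proof (induction cs arbitrary: es cs' es')
    case (Cons c cs)
    obtain c1 es1 where b: "bpass es c = (c1, es1)" by (rule prod.exhaust)
    obtain cs1 where i: "infuse es1 cs = (cs1, es')"
      using Cons.prems(3) b by (auto simp: infuse_Cons2 split: prod.splits)
    have "chain ([c1] @ es1 @ cs)" using chain_bpass(1)[of "[]" es c cs] Cons.prems(2) b by simp
    then have ch: "chain (es1 @ cs)" by (rule chain_suffix)
    have "chain (es @ [c])" using chain_prefix[of "es @ [c]" cs] Cons.prems(2) by simp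
    then have "pic de es1" using pic_bpass[OF assms(2), of "[]" es "[]" c c1 es1] Cons.prems(1) b by simp
    then show ?case using Cons.IH[OF _ ch i] by simp
  qed simp
qed

text \<open>Seen as a set of pairs, a picture can be restricted, cut and merged without tracking
  positions.\<close>

lemma pic_zip:
  "pic ds cs \<longleftrightarrow> length ds = length cs \<and>
    (\<forall>(d, c) \<in> set (zip ds cs). \<forall>(d', c') \<in> set (zip ds cs). dir d d' c c' \<and> dir c c' d d')"
  (is "?l = (_ \<and> ?r)")
proof (cases "length ds = length cs")
  case True
  have z: "set (zip ds cs) = (\<lambda>i. (ds ! i, cs ! i)) ` {..<length ds}"
    using True by (auto simp: set_zip)
  have "?r = pict {..<length ds} ((!) ds) ((!) cs)"
    unfolding z pict_def by simp
  then show ?thesis using True by (simp add: pic_def)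
qed (simp add: pic_def)

lemma pic_sym: "pic ds cs \<Longrightarrow> pic cs ds"
  unfolding pic_def pict_def by simp

lemma pic_length: "pic ds cs \<Longrightarrow> length ds = length cs"
  by (simp add: pic_def)

lemma pic_zipD:
  assumes "pic ds cs" "(d, c) \<in> set (zip ds cs)" "(d', c') \<in> set (zip ds cs)"
  shows "dir d d' c c'" "dir c c' d d'"
  using assms unfolding pic_zip by blast+

lemma pic_subset:
  assumes "pic ds cs" "set (zip ds' cs') \<subseteq> set (zip ds cs)" "length ds' = length cs'"
  shows "pic ds' cs'"
  unfolding pic_zip
proof (intro conjI ballI, safe)
  show "length ds' = length cs'" by (fact assms(3))
qed (use assms(2) pic_zipD[OF assms(1)] in blast)+

lemma pic_append1:
  assumes "pic (dx @ dy) (xs @ ys)" "length dx = length xs"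
  shows "pic dx xs"
  using assms(1) by (rule pic_subset) (use assms(2) in auto)

lemma pic_noinv:
  assumes "sdom ds" "pic ds cs"
  shows "sorted_wrt (\<lambda>a b. \<not> nwle b a) cs"
  unfolding sorted_wrt_iff_nth_less
proof (intro allI impI notI)
  fix i j assume ij: "i < j" "j < length cs" and le: "nwle (cs ! j) (cs ! i)"
  have "swle (ds ! j) (ds ! i)"
    using pictD2(1,2)[of "{..<length ds}" "(!) ds" "(!) cs" j i] le assms(2) ij
    by (auto simp: pic_def swle_def)
  then have "j \<le> i" using sdom_swle_index[OF assms(1)] assms(2) ij by (auto simp: pic_def)
  then show False using ij by simp
qed

lemma pic_chain: "sdom ds \<Longrightarrow> pic ds cs \<Longrightarrow> conv (set cs) \<Longrightarrow> chain cs"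
  by (simp add: chain_def pic_noinv)

lemma pic_distinct: "sdom ds \<Longrightarrow> pic ds cs \<Longrightarrow> distinct cs"
  by (rule sorted_wrt_irrefl_distinct[OF pic_noinv]) auto

text \<open>The backward half of the picture condition comes from standardness. If
  \<open>cs ! i\<close> is north-west of \<open>cs ! j\<close>, then \<open>ds ! i\<close> is read
  before \<open>ds ! j\<close>; the only way for \<open>ds ! j\<close> not to be south-west of it is
  to lie strictly to the right, and the strict clauses of the forward half exclude this.\<close>

lemma picI:
  assumes ds: "sdom ds" and len: "length ds = length cs"
    and d: "\<And>i j. i < length ds \<Longrightarrow> j < length ds \<Longrightarrow> dir (ds ! i) (ds ! j) (cs ! i) (cs ! j)"
    and s: "sorted_wrt (\<lambda>a b. \<not> nwle b a) cs"
  shows "pic ds cs"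
  unfolding pic_def pict_def
proof (intro conjI ballI len)
  fix i j assume ij: "i \<in> {..<length ds}" "j \<in> {..<length ds}"
  show "dir (ds ! i) (ds ! j) (cs ! i) (cs ! j)" using d ij by simp
  have dij: "dir (ds ! i) (ds ! j) (cs ! i) (cs ! j)" "dir (ds ! j) (ds ! i) (cs ! j) (cs ! i)"
    using d ij by simp_all
  show "dir (cs ! i) (cs ! j) (ds ! i) (ds ! j)"
  proof (cases "nwle (cs ! i) (cs ! j) \<and> i \<noteq> j")
    case True
    then have "i < j" using s ij len by (metis lessThan_iff linorder_neqE_nat sorted_wrt_nth_less)
    then have "rlless (ds ! i) (ds ! j)"
      using ds ij by (auto simp: sdom_def sorted_wrt_iff_nth_less)
    then show ?thesis using True dij unfolding dir_def nwle_def swle_def rlless_def by linarith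
  next
    case False
    then show ?thesis by (cases "i = j") (auto simp: dir_def swle_def)
  qed
qed

text \<open>Walk along the row and down the column: convexity keeps the path inside
  \<open>D\<close>, and each step costs the image at least one column to the left or one row down.
  The steps are counted because the result is compared with the entries r + i - j.\<close>

lemma row_col_steps:
  fixes f :: "box \<Rightarrow> box"
  assumes cv: "conv D"
    and right: "\<And>i j. (i, j) \<in> D \<Longrightarrow> (i, Suc j) \<in> D \<Longrightarrow>
      fst (f (i, j)) \<le> fst (f (i, Suc j)) \<and> snd (f (i, Suc j)) < snd (f (i, j))"
    and below: "\<And>i j. (i, j) \<in> D \<Longrightarrow> (Suc i, j) \<in> D \<Longrightarrow>
      fst (f (i, j)) < fst (f (Suc i, j)) \<and> snd (f (Suc i, j)) \<le> snd (f (i, j))"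
    and a: "(i, j) \<in> D" "(i + k, j + l) \<in> D"
  shows "fst (f (i, j)) + k \<le> fst (f (i + k, j + l)) \<and> snd (f (i + k, j + l)) + l \<le> snd (f (i, j))"
  using a(2)
proof (induction k)
  case 0
  then show ?case
  proof (induction l)
    case (Suc l)
    then have "(i, j + l) \<in> D" by (intro convD[OF cv a(1) Suc.prems]) (auto simp: nwle_def)
    then show ?case using Suc right[of i "j + l"] by auto
  qed simp
next
  case (Suc k)
  then have "(i + k, j + l) \<in> D" by (intro convD[OF cv a(1) Suc.prems]) (auto simp: nwle_def)
  then show ?case using Suc below[of "i + k" "j + l"] by auto
qed

lemma dir_of_steps:
  fixes f :: "box \<Rightarrow> box"
  assumes cv: "conv D"
    and right: "\<And>i j. (i, j) \<in> D \<Longrightarrow> (i, Suc j) \<in> D \<Longrightarrow>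
      fst (f (i, j)) \<le> fst (f (i, Suc j)) \<and> snd (f (i, Suc j)) < snd (f (i, j))"
    and below: "\<And>i j. (i, j) \<in> D \<Longrightarrow> (Suc i, j) \<in> D \<Longrightarrow>
      fst (f (i, j)) < fst (f (Suc i, j)) \<and> snd (f (Suc i, j)) \<le> snd (f (i, j))"
    and a: "a \<in> D" "b \<in> D"
  shows "dir a b (f a) (f b)"
proof (cases "nwle a b")
  case True
  then have b: "b = (fst a + (fst b - fst a), snd a + (snd b - snd a))" by (cases b) (auto simp: nwle_def)
  have "fst (f a) + (fst b - fst a) \<le> fst (f b) \<and> snd (f b) + (snd b - snd a) \<le> snd (f a)"
    using row_col_steps[OF cv right below, of "fst a" "snd a" "fst b - fst a" "snd b - snd a"] a b[symmetric]
    by simp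
  then show ?thesis unfolding dir_def swle_def by auto
qed (simp add: dir_def)

text \<open>Convexity is asked of the source list alone, so that together with
  \<open>pic_sym\<close> the same estimate serves the inverse picture.\<close>

lemma pic_row_shift:
  assumes P: "pic ds cs" and cv: "conv (set ds)"
    and z: "(a, b) \<in> set (zip ds cs)" "(a', b') \<in> set (zip ds cs)" and le: "nwle a a'"
  shows "fst b + (fst a' - fst a) \<le> fst b' \<and> snd b' + (snd a' - snd a) \<le> snd b"
proof -
  let ?f = "\<lambda>x. the (map_of (zip ds cs) x)"
  have unique: "c = c'" if "(x, c) \<in> set (zip ds cs)" "(x, c') \<in> set (zip ds cs)" for x c c'
    using pic_zipD(1)[OF P that] pic_zipD(1)[OF P that(2,1)]
    by (auto simp: dir_def swle_def prod_eq_iff)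
  have f: "(x, ?f x) \<in> set (zip ds cs)" if x: "x \<in> set ds" for x
  proof -
    obtain c where "map_of (zip ds cs) x = Some c"
      using x pic_length[OF P] by (metis map_of_zip_is_Some)
    then show ?thesis by (simp add: map_of_SomeD)
  qed
  have ad: "a \<in> set ds" "a' \<in> set ds" using z by (auto dest: set_zip_leftD)
  have fa: "?f a = b" "?f a' = b'" using unique f ad z by blast+
  have a': "(fst a + (fst a' - fst a), snd a + (snd a' - snd a)) = a'"
    using le by (cases a') (auto simp: nwle_def)
  have "fst (?f (fst a, snd a)) + (fst a' - fst a) \<le> fst (?f (fst a + (fst a' - fst a), snd a + (snd a' - snd a))) \<and>
     snd (?f (fst a + (fst a' - fst a), snd a + (snd a' - snd a))) + (snd a' - snd a) \<le> snd (?f (fst a, snd a))"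
  proof (rule row_col_steps[OF cv, of ?f])
    show "fst (?f (i, j)) \<le> fst (?f (i, Suc j)) \<and> snd (?f (i, Suc j)) < snd (?f (i, j))"
      if "(i, j) \<in> set ds" "(i, Suc j) \<in> set ds" for i j
      using pic_zipD(1)[OF P f f, OF that] by (auto simp: dir_def nwle_def swle_def)
    show "fst (?f (i, j)) < fst (?f (Suc i, j)) \<and> snd (?f (Suc i, j)) \<le> snd (?f (i, j))"
      if "(i, j) \<in> set ds" "(Suc i, j) \<in> set ds" for i j
      using pic_zipD(1)[OF P f f, OF that] by (auto simp: dir_def nwle_def swle_def)
  qed (use ad a' in auto)
  then show ?thesis by (simp add: a' fa)
qed

lemma set_zip_swap: "(a, b) \<in> set (zip xs ys) \<longleftrightarrow> (b, a) \<in> set (zip ys xs)"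
  by (auto simp: set_zip)

text \<open>\<open>swle_comparable_at_hole\<close> after rotation: the hole lies right of or below
  the two boxes, as in a reverse slide.\<close>

lemma pic_comparable_at_hole:
  assumes ds: "sdom ds" and P: "pic ds cs" and h: "h \<notin> set cs"
    and z: "(a, b) \<in> set (zip ds cs)" "(a', b') \<in> set (zip ds cs)" "adj b h" "adj b' h"
  shows "swle a a' \<or> swle a' a"
proof -
  obtain i j where ij: "i < length ds" "j < length ds" "a = ds ! i" "b = cs ! i" "a' = ds ! j" "b' = cs ! j"
    using z pic_length[OF P] by (auto simp: set_zip)
  let ?X = "{..<length ds}"
  have im: "(!) zs ` {..<length zs} = set zs" for zs :: "box list" by (auto simp: set_conv_nth)
  have "swle ((nbx \<circ> (!) ds) i) ((nbx \<circ> (!) ds) j) \<or> swle ((nbx \<circ> (!) ds) j) ((nbx \<circ> (!) ds) i)"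
  proof (rule swle_comparable_at_hole[where I = ?X and c = "nbx \<circ> (!) cs" and h = "nbx h"])
    show "pict ?X (nbx \<circ> (!) ds) (nbx \<circ> (!) cs)" using P unfolding pict_ibox pic_def by blast
    show "conv ((nbx \<circ> (!) ds) ` ?X)"
      unfolding image_comp[symmetric] im using ds conv_nbx by (auto simp: sdom_def)
    show "nbx h \<notin> (nbx \<circ> (!) cs) ` ?X"
      unfolding image_comp[symmetric] pic_length[OF P] im
      using h inj_nbx[of UNIV] by (simp add: inj_image_mem_iff)
  qed (use ij z in \<open>auto simp: ibox_adj\<close>)
  then show ?thesis using ij by (auto simp: ibox_le)
qed

section \<open>Boxes violating the row rule\<close>

definition unsat :: "int \<Rightarrow> box \<times> box \<Rightarrow> bool" where
  "unsat r = (\<lambda>(d, c). r + int (fst d) - int (snd d) > int (fst c))"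

lemma bpass_snoc:
  "bpass (xs @ [c]) h = (let (h', c') = switch c h; (h'', xs') = bpass xs h' in (h'', xs' @ [c']))"
  by (induction xs) (auto simp: Let_def split: prod.splits)

lemma length_bpass: "length (snd (bpass xs h)) = length xs"
  by (induction xs) (auto simp: case_prod_beta)

lemma bpass_no_adj: "\<forall>x\<in>set xs. \<not> adj x h \<Longrightarrow> bpass xs h = (h, xs)"
  by (induction xs arbitrary: h) (auto simp: switch_def)

text \<open>In the application \<open>d0\<close> is the domain box whose image has just left the
  hole \<open>h\<close>. A box \<open>c\<close> that may enter \<open>h\<close> has a preimage
  north-east of \<open>d0\<close>, in a strictly higher row if \<open>c\<close> lies above
  \<open>h\<close>, so \<open>c\<close> satisfies the row rule along with \<open>d0\<close>. From a
  hole left by a satisfying box onwards, only satisfying boxes move, and moving outwards keeps them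
  satisfying.\<close>

lemma bpass_sat_hole:
  assumes "length dx = length xs" "pic dx xs" "\<not> unsat r (d0, h)"
    "\<And>a b. (a, b) \<in> set (zip dx xs) \<Longrightarrow> dir b h a d0"
  shows "filter (unsat r) (zip dx (snd (bpass xs h))) = filter (unsat r) (zip dx xs)"
  using assms
proof (induction xs arbitrary: dx h d0 rule: rev_induct)
  case (snoc c xs)
  then obtain dx' d where dx: "dx = dx' @ [d]" "length dx' = length xs"
    by (cases dx rule: rev_cases) auto
  have P: "pic dx' xs" using snoc.prems(2) dx by (auto dest: pic_append1)
  show ?case
  proof (cases "adj c h")
    case True
    have dc: "dir c h d d0" using snoc.prems(4)[of d c] dx by (simp)
    then have s: "\<not> unsat r (d, c)"
      using True snoc.prems(3) by (auto simp: unsat_def dir_def adj_def nwle_def swle_def)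
    have s': "\<not> unsat r (d, h)" using s True by (auto simp: unsat_def adj_def)
    have "dir b c a d" if "(a, b) \<in> set (zip dx' xs)" for a b
      using pic_zipD(2)[OF snoc.prems(2), of a b d c] that dx by (simp)
    from snoc.IH[OF dx(2) P s this]
    show ?thesis using True s s' dx by (simp add: bpass_snoc switch_def case_prod_beta length_bpass)
  next
    case False
    have "dir b h a d0" if "(a, b) \<in> set (zip dx' xs)" for a b
      using snoc.prems(4) that dx by (simp)
    from snoc.IH[OF dx(2) P snoc.prems(3) this]
    show ?thesis using False dx by (simp add: bpass_snoc switch_def case_prod_beta length_bpass)
  qed
qed simp

text \<open>A violating box is never held up by another box: if a violating \<open>(a, b)\<close> and a satisfying \<open>(d, c)\<close> both touch
  the hole and \<open>a\<close> precedes \<open>d\<close>, then \<open>d\<close> carries the larger entry of the row rule filling, although the rows of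
  \<open>b\<close> and \<open>c\<close> differ by one only.\<close>

lemma bpass_unsat:
  assumes "sdom (dx @ dy)" "pic (dx @ dy) (xs @ ys)" "length dx = length xs" "chain (xs @ h # ys)"
  shows "filter (unsat r) (zip dx (snd (bpass xs h))) =
    (let U = filter (unsat r) (zip dx xs) in filter (unsat r) (zip (map fst U) (snd (bpass (map snd U) h))))"
  using assms
proof (induction xs arbitrary: dx dy ys h rule: rev_induct)
  case (snoc c xs)
  then obtain dx' d where dx: "dx = dx' @ [d]" "length dx' = length xs"
    by (cases dx rule: rev_cases) auto
  let ?U = "filter (unsat r) (zip dx' xs)"
  have z: "zip dx (xs @ [c]) = zip dx' xs @ [(d, c)]" using dx by (simp)
  have zz: "set (zip dx' xs) \<subseteq> set (zip (dx @ dy) ((xs @ [c]) @ ys))"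
    "(d, c) \<in> set (zip (dx @ dy) ((xs @ [c]) @ ys))"
    using dx by (auto simp: zip_append)
  obtain h' c' where s: "switch c h = (h', c')" by (rule prod.exhaust)
  have ch: "chain (xs @ c # h # ys)" using snoc.prems(4) by simp
  have sd: "sdom (dx' @ d # dy)" using snoc.prems(1) dx by simp
  \<comment> \<open>After the switch, \<open>c'\<close> belongs to the part that is no longer
    touched; the suffixes \<open>dy\<close> and \<open>ys\<close> of the statement absorb
    it.\<close>
  have IH: "filter (unsat r) (zip dx' (snd (bpass xs h'))) =
      filter (unsat r) (zip (map fst ?U) (snd (bpass (map snd ?U) h')))"
  proof -
    have "chain (xs @ h' # c' # ys)" by (rule chain_switch[OF ch s])
    moreover have "pic (dx' @ d # dy) (xs @ c' # ys)"
      using pic_switch(2)[OF sd ch s] snoc.prems(2) dx by simp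
    ultimately show ?thesis using snoc.IH[OF sd, of "c' # ys" h'] dx(2) by (simp add: Let_def)
  qed
  have L: "filter (unsat r) (zip dx (snd (bpass (xs @ [c]) h))) =
      filter (unsat r) (zip dx' (snd (bpass xs h'))) @ filter (unsat r) [(d, c')]"
    using dx by (simp add: bpass_snoc s case_prod_beta length_bpass)
  show ?case
  proof (cases "unsat r (d, c)")
    case True
    then show ?thesis unfolding L z IH Let_def
      by (simp add: bpass_snoc s case_prod_beta length_bpass)
  next
    case sat: False
    show ?thesis
    proof (cases "adj c h")
      case False
      then have "h' = h" "c' = c" using s by (auto simp: switch_def)
      then show ?thesis unfolding L z IH Let_def using sat by simp
    next
      case True
      then have hc: "h' = c" "c' = h" using s by (auto simp: switch_def)
      have sat': "\<not> unsat r (d, h)" using sat True by (auto simp: unsat_def adj_def)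
      have na: "\<not> adj b h" if ab: "(a, b) \<in> set ?U" for a b
      proof
        assume abh: "adj b h"
        have h: "h \<notin> set ((xs @ [c]) @ ys)" using chain_distinct[OF ch] by auto
        have abz: "(a, b) \<in> set (zip (dx @ dy) ((xs @ [c]) @ ys))" using ab zz by auto
        have "rlless a d" using sd ab by (auto simp: sdom_def sorted_wrt_append dest!: set_zip_leftD)
        moreover have "b \<noteq> c" using chain_distinct[OF ch] ab by (auto dest!: set_zip_rightD)
        moreover have "swle a d \<or> swle d a"
          by (rule pic_comparable_at_hole[OF snoc.prems(1,2) h abz zz(2) abh True])
        ultimately show False using sat ab abh True
          by (auto simp: unsat_def adj_def rlless_def swle_def prod_eq_iff)
      qed
      \<comment> \<open>On the full list the hole moves on to \<open>c\<close>, left by a satisfying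
        box, and disturbs no violating box from there. On the list of violating boxes it stays at
        \<open>h\<close>, since none of them touches it.\<close>
      have "filter (unsat r) (zip dx' (snd (bpass xs c))) = ?U"
      proof (rule bpass_sat_hole[OF dx(2) _ sat])
        show "pic dx' xs" using snoc.prems(2) dx by (auto dest: pic_append1[of dx' "d # dy" xs "c # ys"])
        show "dir b c a d" if "(a, b) \<in> set (zip dx' xs)" for a b
          using pic_zipD(2)[OF snoc.prems(2) _ zz(2), of a b] zz that by auto
      qed
      moreover have "bpass (map snd ?U) h = (h, map snd ?U)"
        by (rule bpass_no_adj) (use na in auto)
      ultimately show ?thesis unfolding L z Let_def using hc sat sat' by (simp add: zip_map_fst_snd)
    qed
  qed
qed simp

text \<open>By \<open>bpass_unsat\<close> the violating boxes after a reverse slide depend only on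
  those before it, so agreement of the violating parts persists from slide to slide. In the
  application one of the two pictures is the violating part of the other.\<close>

lemma infuse_unsat:
  assumes "sdom ds" "sdom du" "pic ds ss" "pic du us" "chain (ss @ es)" "chain (us @ es)"
    "filter (unsat r) (zip ds ss) = filter (unsat r) (zip du us)"
  shows "filter (unsat r) (zip ds (snd (infuse ss es))) = filter (unsat r) (zip du (snd (infuse us es)))"
  using assms(3-)
proof (induction es arbitrary: ss us)
  case (Cons e es)
  have *: "chain (snd (bpass ss e) @ es) \<and> pic ds (snd (bpass ss e)) \<and>
     filter (unsat r) (zip ds (snd (bpass ss e))) =
       (let U = filter (unsat r) (zip ds ss) in filter (unsat r) (zip (map fst U) (snd (bpass (map snd U) e)))) \<and>
     snd (infuse ss (e # es)) = snd (infuse (snd (bpass ss e)) es)"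
    if "sdom ds" "pic ds ss" "chain (ss @ e # es)" for ds ss
  proof -
    obtain e' ss' where b: "bpass ss e = (e', ss')" by (rule prod.exhaust)
    have "chain ([e'] @ ss' @ es)" using chain_bpass(1)[of "[]" ss e es] that b by simp
    then have "chain (ss' @ es)" by (rule chain_suffix)
    moreover have ch: "chain (ss @ [e])" using chain_prefix[of "ss @ [e]" es] that by simp
    moreover have "pic ds ss'" using pic_bpass[OF that(1), of "[]" ss "[]"] that(2) ch b by simp
    moreover note bpass_unsat[of ds "[]" ss "[]" e r]
    ultimately show ?thesis using that b pic_length[OF that(2)]
      by (auto simp: infuse_Cons2 split: prod.splits)
  qed
  note 1 = *[OF assms(1) Cons.prems(1,3)] and 2 = *[OF assms(2) Cons.prems(2,4)]
  have "filter (unsat r) (zip ds (snd (bpass ss e))) = filter (unsat r) (zip du (snd (bpass us e)))"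
    using 1 2 Cons.prems(5) by simp
  then show ?case using Cons.IH[of "snd (bpass ss e)" "snd (bpass us e)"] 1 2 by simp
qed simp

section \<open>Partitions and reading words\<close>

lemma boxes_pos: "(i, j) \<in> boxes \<mu> \<Longrightarrow> 1 \<le> i \<and> 1 \<le> j"
  using boxes[of \<mu>] by auto

lemma boxes_down:
  assumes "b \<in> boxes \<mu>" "nwle a b" "1 \<le> fst a" "1 \<le> snd a"
  shows "a \<in> boxes \<mu>"
proof -
  have "{1..fst b} \<times> {1..snd b} \<subseteq> boxes \<mu>"
    using boxes[of \<mu>] assms(1) by (cases b) auto
  then show ?thesis using assms(2-) by (cases a) (auto simp: nwle_def)
qed

lemma partition_of_set:
  assumes "finite D" "\<And>b. b \<in> D \<Longrightarrow> 1 \<le> fst b \<and> 1 \<le> snd b"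
    "\<And>a b. b \<in> D \<Longrightarrow> nwle a b \<Longrightarrow> 1 \<le> fst a \<Longrightarrow> 1 \<le> snd a \<Longrightarrow> a \<in> D"
  obtains \<mu> where "boxes \<mu> = D"
proof
  have "D \<in> {D. finite D \<and> (\<forall>(i, j) \<in> D. 1 \<le> i \<and> 1 \<le> j \<and> {1..i} \<times> {1..j} \<subseteq> D)}"
    using assms(1) assms(2) assms(3) by (fastforce simp: nwle_def)
  then show "boxes (Partition D) = D" by (rule Partition_inverse)
qed

lemma partition_le_iff: "\<mu> \<le> \<nu> \<longleftrightarrow> boxes \<mu> \<subseteq> boxes \<nu>"
  by (simp add: less_eq_partition.rep_eq)

lemma boxes_bot [simp]: "boxes \<emptyset> = {}"
  by (simp add: bot_partition.rep_eq)

lemma skew_bot [simp]: "skew \<mu> \<emptyset> = boxes \<mu>"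
  by (simp add: skew_def)

lemma finite_skew [simp]: "finite (skew \<alpha> \<beta>)"
  by (simp add: skew_def)

lemma conv_skew: "conv (skew \<gamma> \<delta>)"
  unfolding conv_def
proof (intro ballI allI impI)
  fix a c b assume a: "a \<in> skew \<gamma> \<delta>" and c: "c \<in> skew \<gamma> \<delta>" and b: "nwle a b \<and> nwle b c"
  have "1 \<le> fst a" "1 \<le> snd a" using a boxes_pos[of "fst a" "snd a" \<gamma>] by (auto simp: skew_def)
  then have p: "1 \<le> fst a" "1 \<le> snd a" "1 \<le> fst b" "1 \<le> snd b" using b by (auto simp: nwle_def)
  have "b \<in> boxes \<gamma>" using boxes_down[of c \<gamma> b] b c p by (auto simp: skew_def)
  moreover have "b \<notin> boxes \<delta>" using boxes_down[of b \<delta> a] a b p by (auto simp: skew_def)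
  ultimately show "b \<in> skew \<gamma> \<delta>" by (simp add: skew_def)
qed

lemma conv_boxes: "conv (boxes \<mu>)"
  using conv_skew[of \<mu> \<emptyset>] by simp

lemma skew_box_pos: "b \<in> skew \<mu> \<nu> \<Longrightarrow> 1 \<le> fst b \<and> 1 \<le> snd b"
  using boxes_pos[of "fst b" "snd b" \<mu>] by (auto simp: skew_def)

text \<open>\<open>low\<close> makes \<open>A\<close> an order ideal, so that the inner shape
  together with \<open>A\<close> is a partition again.\<close>

lemma skew_split:
  assumes s: "A \<union> B = skew \<gamma> \<beta>" and disj: "A \<inter> B = {}" and le: "\<beta> \<le> \<gamma>"
    and low: "\<And>a b. a \<in> A \<Longrightarrow> b \<in> B \<Longrightarrow> \<not> nwle b a"
  obtains \<mu> where "boxes \<mu> = boxes \<beta> \<union> A" "\<beta> \<le> \<mu>" "\<mu> \<le> \<gamma>" "A = skew \<mu> \<beta>" "B = skew \<gamma> \<mu>"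
proof -
  have sub: "boxes \<beta> \<subseteq> boxes \<gamma>" using le by (simp add: partition_le_iff)
  have A: "A \<subseteq> skew \<gamma> \<beta>" using s by auto
  obtain \<mu> where \<mu>: "boxes \<mu> = boxes \<beta> \<union> A"
  proof (rule partition_of_set)
    show "finite (boxes \<beta> \<union> A)" using finite_subset[OF A] by simp
    show "1 \<le> fst b \<and> 1 \<le> snd b" if "b \<in> boxes \<beta> \<union> A" for b
      using that A skew_box_pos[of b \<gamma> \<beta>] boxes_pos[of "fst b" "snd b" \<beta>] by auto
    fix a b assume b: "b \<in> boxes \<beta> \<union> A" and ab: "nwle a b" "1 \<le> fst a" "1 \<le> snd a"
    show "a \<in> boxes \<beta> \<union> A"
    proof (rule ccontr)
      assume n: "a \<notin> boxes \<beta> \<union> A"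
      have "b \<notin> boxes \<beta>" using boxes_down[of b \<beta> a] ab n by auto
      then have bs: "b \<in> A" using b by auto
      then have "a \<in> boxes \<gamma>" using A boxes_down[of b \<gamma> a] ab by (auto simp: skew_def)
      then have "a \<in> B" using n s by (auto simp: skew_def)
      then show False using low bs ab by blast
    qed
  qed auto
  show ?thesis
    by (rule that[OF \<mu>]) (use \<mu> s sub disj A in \<open>auto simp: partition_le_iff skew_def\<close>)
qed

lemma chain_skew_split:
  assumes ch: "chain (es @ cs)" and s: "set es \<union> set cs = skew \<gamma> \<beta>" and le: "\<beta> \<le> \<gamma>"
  obtains \<mu> where "boxes \<mu> = boxes \<beta> \<union> set es" "\<beta> \<le> \<mu>" "\<mu> \<le> \<gamma>" "set es = skew \<mu> \<beta>" "set cs = skew \<gamma> \<mu>"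
proof (rule skew_split[OF s _ le])
  show "set es \<inter> set cs = {}" using chain_distinct[OF ch] by auto
  show "\<not> nwle b a" if "a \<in> set es" "b \<in> set cs" for a b
    using ch that by (auto simp: chain_def sorted_wrt_append)
qed (use that in blast)

lemma chain_skew_append:
  assumes "chain es" "chain cs" "set es = skew \<mu> \<beta>" "set cs = skew \<gamma> \<mu>" "\<beta> \<le> \<mu>" "\<mu> \<le> \<gamma>"
  shows "chain (es @ cs)" "set es \<union> set cs = skew \<gamma> \<beta>"
proof -
  show s: "set es \<union> set cs = skew \<gamma> \<beta>"
    using assms(3-) by (auto simp: skew_def partition_le_iff)
  have "\<not> nwle b a" if "a \<in> skew \<mu> \<beta>" "b \<in> skew \<gamma> \<mu>" for a b
    using that boxes_down[of a \<mu> b] skew_box_pos[of b \<gamma> \<mu>] by (auto simp: skew_def)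
  moreover have "conv (set (es @ cs))" using conv_skew[of \<gamma> \<beta>] s by simp
  ultimately show "chain (es @ cs)"
    using assms(1-4) unfolding chain_def sorted_wrt_append by blast
qed

section \<open>Reading words as sorted lists and tableaux as lists of boxes\<close>

lemma sorted_wrt_eqI:
  assumes "sorted_wrt R xs" "sorted_wrt R ys" "set xs = set ys" "\<And>a b. R a b \<Longrightarrow> \<not> R b a"
  shows "xs = ys"
  using assms(1-3)
proof (induction xs arbitrary: ys)
  case (Cons x xs)
  then obtain y zs where ys: "ys = y # zs" by (cases ys) auto
  have "x = y"
  proof (rule ccontr)
    assume "x \<noteq> y"
    then have "y \<in> set xs" "x \<in> set zs" using Cons.prems(3) ys by auto
    then have "R x y" "R y x" using Cons.prems(1,2) ys by auto
    then show False using assms(4) by blast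
  qed
  moreover have "x \<notin> set xs" "y \<notin> set zs" using Cons.prems(1,2) ys assms(4) by auto
  ultimately show ?case using Cons.IH[of zs] Cons.prems ys by (auto simp: insert_ident)
qed simp

text \<open>List form of the filling \<open>rl\<close>: position \<open>k\<close> holds the box
  labelled \<open>k + 1\<close>.\<close>

definition rls :: "box set \<Rightarrow> box list" where
  "rls D = (THE ds. sorted_wrt rlless ds \<and> set ds = D)"

lemma rlless_asym: "rlless a b \<Longrightarrow> \<not> rlless b a"
  by (auto simp: rlless_def)

lemma rlless_linear: "a = b \<or> rlless a b \<or> rlless b a"
  by (auto simp: rlless_def prod_eq_iff)

lemma rlless_trans: "rlless a b \<Longrightarrow> rlless b c \<Longrightarrow> rlless a c"
  by (auto simp: rlless_def)

lemma rls_eq: "sorted_wrt rlless ds \<Longrightarrow> rls (set ds) = ds"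
  unfolding rls_def by (rule the_equality) (use sorted_wrt_eqI[of rlless _ ds] rlless_asym in blast)+

lemma rls:
  assumes "finite D"
  shows "sorted_wrt rlless (rls D)" "set (rls D) = D" "length (rls D) = card D"
proof -
  have "\<exists>ds. sorted_wrt rlless ds \<and> set ds = D"
    using assms
  proof (induction D)
    case (insert x D)
    then obtain ds where ds: "sorted_wrt rlless ds" "set ds = D" by blast
    let ?xs = "filter (\<lambda>d. rlless d x) ds" and ?ys = "filter (\<lambda>d. rlless x d) ds"
    have "sorted_wrt rlless (?xs @ x # ?ys)"
      using ds(1) by (auto simp: sorted_wrt_append sorted_wrt_filter intro: rlless_trans)
    moreover have "rlless d x \<or> rlless x d" if "d \<in> set ds" for d
      using that ds(2) insert.hyps(2) rlless_linear[of d x] by blast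
    then have "set (?xs @ x # ?ys) = insert x D"
      using ds(2) by (simp del: split_paired_All) blast
    ultimately show ?case by blast
  qed simp
  then obtain ds where ds: "sorted_wrt rlless ds" "set ds = D" by blast
  then have "rls D = ds" using rls_eq by blast
  then show "sorted_wrt rlless (rls D)" "set (rls D) = D" "length (rls D) = card D"
    using ds distinct_card[of ds] sorted_wrt_irrefl_distinct[of rlless ds] by auto
qed

lemma sdom_rls: "finite D \<Longrightarrow> conv D \<Longrightarrow> sdom (rls D)"
  by (simp add: sdom_def rls)

lemma sdom_rls_skew: "sdom (rls (skew \<alpha> \<beta>))"
  by (simp add: sdom_rls conv_skew)

lemma set_rls_skew [simp]: "set (rls (skew \<alpha> \<beta>)) = skew \<alpha> \<beta>"
  by (simp add: rls)

lemma rls_empty [simp]: "rls {} = []"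
  using rls(2)[of "{}"] by simp

text \<open>Positions are shifted by one because the value 0 marks boxes outside the tableau. In a
  distinct list \<open>takeWhile\<close> stops at the only occurrence of \<open>b\<close>.\<close>

definition fill :: "box list \<Rightarrow> filling" where
  "fill cs b = (if b \<in> set cs then Suc (length (takeWhile (\<lambda>c. c \<noteq> b) cs)) else 0)"

lemma fill_nth: "distinct cs \<Longrightarrow> k < length cs \<Longrightarrow> fill cs (cs ! k) = Suc k"
proof (induction cs arbitrary: k)
  case (Cons c cs)
  then show ?case by (cases k) (auto simp: fill_def)
qed simp

lemma fill_eq_0 [simp]: "fill cs b = 0 \<longleftrightarrow> b \<notin> set cs"
  by (simp add: fill_def)

lemma shape_fill [simp]: "shape (fill cs) = set cs"
  by (auto simp: shape_def)

lemma fill_eq_Suc: "distinct cs \<Longrightarrow> fill cs b = Suc k \<longleftrightarrow> k < length cs \<and> cs ! k = b"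
  by (metis fill_eq_0 fill_nth in_set_conv_nth nat.distinct(1) nat.inject)

lemma box_of_fill: "distinct cs \<Longrightarrow> k < length cs \<Longrightarrow> box_of (fill cs) (Suc k) = cs ! k"
  unfolding box_of_def by (rule the_equality) (auto simp: fill_eq_Suc)

lemma fill_inj:
  assumes "distinct xs" "distinct ys" "fill xs = fill ys"
  shows "xs = ys"
proof (rule nth_equalityI)
  have s: "set xs = set ys" using assms(3) shape_fill by metis
  then show len: "length xs = length ys" using assms(1,2) distinct_card by metis
  show "xs ! k = ys ! k" if "k < length xs" for k
    using that assms len by (metis box_of_fill)
qed

text \<open>An elementary move of jeu de taquin: the hole replaces the moving box in the list and
  takes over its position, that is, its label.\<close>

lemma fill_hole_step:
  assumes "distinct (xs @ h # c # ys)"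
  shows "(fill (xs @ c # ys))(h := fill (xs @ c # ys) c, c := 0) = fill (xs @ h # ys)"
proof
  fix b
  have tw: "takeWhile (\<lambda>x. x \<noteq> b) (xs @ c # ys) = takeWhile (\<lambda>x. x \<noteq> b) (xs @ h # ys)" if "b \<in> set xs"
    using takeWhile_append1[of b xs "\<lambda>x. x \<noteq> b"] that by simp
  show "((fill (xs @ c # ys))(h := fill (xs @ c # ys) c, c := 0)) b = fill (xs @ h # ys) b"
    using assms tw by (auto simp: fill_def takeWhile_append)
qed

lemma rl_eq_fill:
  assumes "finite D"
  shows "rl D = fill (rls D)"
proof
  fix b
  show "rl D b = fill (rls D) b"
  proof (cases "b \<in> D")
    case True
    have d: "distinct (rls D)" using rls(1)[OF assms] by (rule sorted_wrt_irrefl_distinct) simp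
    obtain k where k: "k < length (rls D)" "rls D ! k = b"
      using True rls(2)[OF assms] by (metis in_set_conv_nth)
    have "{c \<in> D. fst c < fst b \<or> fst c = fst b \<and> snd b \<le> snd c} = set (take (Suc k) (rls D))" (is "?S = _")
    proof (intro set_eqI iffI)
      fix c assume "c \<in> ?S"
      then have "c \<in> set (rls D)" and nb: "\<not> rlless b c"
        using rls(2)[OF assms] by (auto simp: rlless_def)
      then obtain l where l: "l < length (rls D)" "rls D ! l = c" by (metis in_set_conv_nth)
      have "\<not> k < l" using sorted_wrt_nth_less[OF rls(1)[OF assms], of k l] nb l k by auto
      then show "c \<in> set (take (Suc k) (rls D))" using l by (auto simp: in_set_conv_nth)
    next
      fix c assume "c \<in> set (take (Suc k) (rls D))"
      then obtain l where "l < length (take (Suc k) (rls D))" "take (Suc k) (rls D) ! l = c"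
        by (metis in_set_conv_nth)
      then have l: "l \<le> k" "l < length (rls D)" "rls D ! l = c" by auto
      then have "c = b \<or> rlless c b"
        using sorted_wrt_nth_less[OF rls(1)[OF assms], of l k] k by (cases "l = k") auto
      moreover have "c \<in> D" using l(2,3) rls(2)[OF assms] by (metis nth_mem)
      ultimately show "c \<in> ?S" by (auto simp: rlless_def)
    qed
    moreover have "card (set (take (Suc k) (rls D))) = Suc k"
      using d k by (subst distinct_card) auto
    ultimately show ?thesis using True fill_nth[OF d k(1)] k(2) by (simp add: rl_def)
  qed (simp add: rl_def fill_def rls(2)[OF assms])
qed

section \<open>Remmel--Whitney tableaux as pictures\<close>

definition pictures :: "box list \<Rightarrow> box set \<Rightarrow> box list set" where
  "pictures ds C = {cs. pic ds cs \<and> set cs = C}"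

lemma standard_fill:
  assumes "distinct cs" "conv (set cs)"
  shows "standard_tableau (set cs) (fill cs) \<longleftrightarrow> sorted_wrt (\<lambda>a b. \<not> nwle b a) cs"
proof
  assume S: "standard_tableau (set cs) (fill cs)"
  show "sorted_wrt (\<lambda>a b. \<not> nwle b a) cs"
    unfolding sorted_wrt_iff_nth_less
  proof (intro allI impI notI)
    fix k l assume kl: "k < l" "l < length cs" and le: "nwle (cs ! l) (cs ! k)"
    \<comment> \<open>From \<open>cs ! l\<close> along its row to \<open>?m\<close> and down the
      column to \<open>cs ! k\<close> the labels never decrease.\<close>
    let ?m = "(fst (cs ! l), snd (cs ! k))"
    have m: "?m \<in> set cs"
      by (rule convD[OF assms(2), of "cs ! l" "cs ! k"]) (use kl le in \<open>auto simp: nwle_def\<close>)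
    have in2: "(fst (cs ! l), snd (cs ! l)) \<in> set cs" "(fst (cs ! k), snd (cs ! k)) \<in> set cs" using kl by auto
    have "fill cs (cs ! l) \<le> fill cs ?m"
    proof (cases "snd (cs ! l) = snd (cs ! k)")
      case True then show ?thesis by (metis order_refl prod.collapse)
    next
      case False
      then have "fill cs (fst (cs ! l), snd (cs ! l)) < fill cs ?m"
        using S m in2 le unfolding standard_tableau_def nwle_def by (metis le_neq_implies_less)
      then show ?thesis by simp
    qed
    also have "fill cs ?m \<le> fill cs (cs ! k)"
    proof (cases "fst (cs ! l) = fst (cs ! k)")
      case False
      then have "fill cs ?m < fill cs (fst (cs ! k), snd (cs ! k))"
        using S m in2 le unfolding standard_tableau_def nwle_def by (metis le_neq_implies_less)
      then show ?thesis by simp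
    qed simp
    finally show False using kl assms(1) by (simp add: fill_nth)
  qed
next
  assume s: "sorted_wrt (\<lambda>a b. \<not> nwle b a) cs"
  have mono: "fill cs a < fill cs b" if ab: "a \<in> set cs" "b \<in> set cs" "nwle a b" "a \<noteq> b" for a b
  proof -
    obtain k l where kl: "k < length cs" "cs ! k = a" "l < length cs" "cs ! l = b"
      using ab(1,2) by (metis in_set_conv_nth)
    have "\<not> l < k" using sorted_wrt_nth_less[OF s, of l k] kl ab(3) by blast
    then have "k < l" using ab(4) kl by (cases "k = l") auto
    then show ?thesis using kl fill_nth[OF assms(1)] by auto
  qed
  have "bij_betw (fill cs) (set cs) {1..card (set cs)}"
    unfolding bij_betw_def
  proof
    show "inj_on (fill cs) (set cs)"
    proof (rule inj_onI)
      fix a b assume ab: "a \<in> set cs" "fill cs a = fill cs b"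
      then obtain k where "fill cs a = Suc k" by (metis fill_eq_0 not0_implies_Suc)
      moreover have "fill cs b = Suc k" using ab(2) \<open>fill cs a = Suc k\<close> by argo
      ultimately show "a = b" unfolding fill_eq_Suc[OF assms(1)] by blast
    qed
    show "fill cs ` set cs = {1..card (set cs)}"
    proof (intro equalityI subsetI)
      fix k assume "k \<in> fill cs ` set cs"
      then obtain l where "l < length cs" "k = fill cs (cs ! l)" by (metis imageE in_set_conv_nth)
      then show "k \<in> {1..card (set cs)}"
        using assms(1) by (simp add: fill_nth distinct_card)
    next
      fix k assume "k \<in> {1..card (set cs)}"
      then obtain l where "k = Suc l" "l < length cs"
        using distinct_card[OF assms(1)] by (cases k) auto
      then show "k \<in> fill cs ` set cs" using fill_nth[OF assms(1)] by (metis imageI nth_mem)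
    qed
  qed
  then show "standard_tableau (set cs) (fill cs)"
    unfolding standard_tableau_def using mono by (auto simp: nwle_def)
qed

lemma standard_is_fill:
  assumes "standard_tableau D T" "finite D"
  obtains cs where "distinct cs" "set cs = D" "T = fill cs"
proof -
  have b: "bij_betw T D {1..card D}" and sh: "\<And>b. T b \<noteq> 0 \<longleftrightarrow> b \<in> D"
    using assms(1) unfolding standard_tableau_def shape_def by auto
  define g where "g = inv_into D T"
  have g: "g k \<in> D" "T (g k) = k" if "k \<in> {1..card D}" for k
    using that b unfolding g_def by (auto simp: bij_betw_def inv_into_into f_inv_into_f)
  have gT: "g (T x) = x" if "x \<in> D" for x
    using that b unfolding g_def by (auto simp: bij_betw_def)
  let ?cs = "map g [1..<Suc (card D)]"
  have inj: "inj_on g {1..card D}" by (rule inj_on_inverseI[of _ T]) (rule g)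
  have set: "set ?cs = D"
  proof (intro equalityI subsetI)
    show "x \<in> D" if "x \<in> set ?cs" for x using that g(1) by (auto simp del: upt_Suc)
    show "x \<in> set ?cs" if "x \<in> D" for x
    proof -
      have "T x \<in> {1..card D}" using b that by (auto simp: bij_betw_def)
      then show ?thesis using gT[OF that] by (auto simp del: upt_Suc intro!: image_eqI[of _ _ "T x"])
    qed
  qed
  have dist: "distinct ?cs" using inj by (auto simp: distinct_map atLeastLessThanSuc_atLeastAtMost simp del: upt_Suc)
  have "T b = fill ?cs b" for b
  proof (cases "b \<in> D")
    case True
    have t: "T b \<in> {1..card D}" using b True by (auto simp: bij_betw_def)
    have "?cs ! (T b - 1) = b" using t gT[OF True] by (auto simp: nth_map simp del: upt_Suc)
    then show ?thesis using fill_nth[OF dist, of "T b - 1"] t by (auto simp del: upt_Suc)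
  next
    case False
    then have "T b = 0" using sh by blast
    moreover have "fill ?cs b = 0" using False set by (simp del: upt_Suc)
    ultimately show ?thesis by simp
  qed
  then show ?thesis using that[OF dist set] by blast
qed

text \<open>No box is read between two horizontal neighbours. This links condition (i), stated for
  labels \<open>i\<close> and \<open>i + 1\<close>, to horizontal neighbours of the domain.\<close>

lemma rls_right_neighbour:
  assumes "sorted_wrt rlless ds" "(i, j) \<in> set ds" "(i, Suc j) \<in> set ds"
  obtains k where "Suc k < length ds" "ds ! k = (i, Suc j)" "ds ! Suc k = (i, j)"
proof -
  obtain k l where kl: "k < length ds" "ds ! k = (i, Suc j)" "l < length ds" "ds ! l = (i, j)"
    using assms(2,3) by (metis in_set_conv_nth)
  have s: "rlless (ds ! a) (ds ! b)" if "a < b" "b < length ds" for a b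
    using sorted_wrt_nth_less[OF assms(1)] that by blast
  have "\<not> l < k" "l \<noteq> k" using s[of l k] kl by (auto simp: rlless_def)
  then have lk: "k < l" by simp
  have "\<not> Suc k < l" using s[of k "Suc k"] s[of "Suc k" l] kl by (auto simp: rlless_def)
  then have "l = Suc k" using lk by simp
  then show ?thesis using that kl by blast
qed

text \<open>Conditions (i) and (ii) are the forward picture condition for horizontal and vertical
  neighbours of the domain. \<open>dir_of_steps\<close> extends it to all pairs, and standardness
  supplies the backward half through \<open>picI\<close>.\<close>

lemma RW_fill_iff:
  assumes cs: "distinct cs" "set cs = skew \<gamma> \<delta>"
  shows "fill cs \<in> RW \<gamma> \<delta> \<alpha> \<beta> \<longleftrightarrow> pic (rls (skew \<alpha> \<beta>)) cs"
proof -
  let ?ds = "rls (skew \<alpha> \<beta>)" and ?n = "card (skew \<alpha> \<beta>)"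
  have sd: "sdom ?ds" by (rule sdom_rls_skew)
  have dd: "distinct ?ds" by (rule sdom_distinct[OF sd])
  have len: "length ?ds = ?n" by (simp add: rls)
  have card: "card (skew \<gamma> \<delta>) = length cs" using cs distinct_card by metis
  have Lk: "row_of (rl (skew \<alpha> \<beta>)) (Suc k) = fst (?ds ! k)" "col_of (rl (skew \<alpha> \<beta>)) (Suc k) = snd (?ds ! k)"
    if "k < ?n" for k
    using that len dd by (simp_all add: rl_eq_fill row_of_def col_of_def box_of_fill)
  have Tk: "row_of (fill cs) (Suc k) = fst (cs ! k)" "col_of (fill cs) (Suc k) = snd (cs ! k)"
    if "k < length cs" for k
    using that cs(1) by (simp_all add: row_of_def col_of_def box_of_fill)
  let ?R1 = "\<forall>k. Suc k < ?n \<longrightarrow> fst (?ds ! k) = fst (?ds ! Suc k) \<longrightarrow>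
     snd (cs ! k) < snd (cs ! Suc k) \<and> fst (cs ! Suc k) \<le> fst (cs ! k)"
  let ?R2 = "\<forall>k < ?n. \<forall>l < ?n. fst (?ds ! l) = fst (?ds ! k) + 1 \<and> snd (?ds ! l) = snd (?ds ! k) \<longrightarrow>
     fst (cs ! k) < fst (cs ! l) \<and> snd (cs ! l) \<le> snd (cs ! k)"
  have "fill cs \<in> RW \<gamma> \<delta> \<alpha> \<beta> \<longleftrightarrow> length cs = ?n \<and> sorted_wrt (\<lambda>a b. \<not> nwle b a) cs \<and> ?R1 \<and> ?R2"
  proof (cases "length cs = ?n")
    case True
    have r1: "(\<forall>i \<in> {1..<?n}. P i) \<longleftrightarrow> (\<forall>k. Suc k < ?n \<longrightarrow> P (Suc k))" for P
    proof safe
      fix i assume "\<forall>k. Suc k < ?n \<longrightarrow> P (Suc k)" "i \<in> {1..<?n}" then show "P i" by (cases i) auto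
    qed simp
    have r2: "(\<forall>i \<in> {1..?n}. P i) \<longleftrightarrow> (\<forall>k < ?n. P (Suc k))" for P
    proof safe
      fix i assume "\<forall>k < ?n. P (Suc k)" "i \<in> {1..?n}" then show "P i" by (cases i) auto
    qed simp
    have st: "standard_tableau (skew \<gamma> \<delta>) (fill cs) \<longleftrightarrow> sorted_wrt (\<lambda>a b. \<not> nwle b a) cs"
      using standard_fill[OF cs(1)] conv_skew cs(2) by metis
    show ?thesis unfolding RW_def Let_def mem_Collect_eq st r1 r2
      using True card by (simp add: Lk Tk)
  qed (use card in \<open>simp add: RW_def Let_def\<close>)
  also have "\<dots> \<longleftrightarrow> pic ?ds cs"
  proof
    assume A: "length cs = ?n \<and> sorted_wrt (\<lambda>a b. \<not> nwle b a) cs \<and> ?R1 \<and> ?R2"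
    let ?f = "\<lambda>x. the (map_of (zip ?ds cs) x)"
    have f: "?f (?ds ! k) = cs ! k" if "k < ?n" for k
      using that dd A len map_of_zip_nth[of ?ds cs k] by simp
    have "dir a b (?f a) (?f b)" if ab: "a \<in> set ?ds" "b \<in> set ?ds" for a b
    proof (rule dir_of_steps[of "set ?ds"])
      show "conv (set ?ds)" using sd by (simp add: sdom_def)
      show "fst (?f (i, j)) \<le> fst (?f (i, Suc j)) \<and> snd (?f (i, Suc j)) < snd (?f (i, j))"
        if ij: "(i, j) \<in> set ?ds" "(i, Suc j) \<in> set ?ds" for i j
      proof -
        obtain k where k: "Suc k < ?n" "?ds ! k = (i, Suc j)" "?ds ! Suc k = (i, j)"
          using rls_right_neighbour[OF _ ij] sd len unfolding sdom_def by metis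
        then show ?thesis using A f[of k] f[of "Suc k"] by fastforce
      qed
      show "fst (?f (i, j)) < fst (?f (Suc i, j)) \<and> snd (?f (Suc i, j)) \<le> snd (?f (i, j))"
        if ij: "(i, j) \<in> set ?ds" "(Suc i, j) \<in> set ?ds" for i j
      proof -
        obtain k l where kl: "k < ?n" "?ds ! k = (i, j)" "l < ?n" "?ds ! l = (Suc i, j)"
          using ij len by (metis in_set_conv_nth)
        then show ?thesis using A f[of k] f[of l] by fastforce
      qed
    qed (use ab in auto)
    then have d: "dir (?ds ! k) (?ds ! l) (cs ! k) (cs ! l)" if "k < length ?ds" "l < length ?ds" for k l
      using f[of k] f[of l] that len nth_mem[of k ?ds] nth_mem[of l ?ds] by metis
    show "pic ?ds cs" by (rule picI[OF sd _ d]) (use A len in auto)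
  next
    assume P: "pic ?ds cs"
    then have l: "length cs = ?n" using len by (simp add: pic_def)
    have D: "dir (?ds ! k) (?ds ! l) (cs ! k) (cs ! l)" if "k < ?n" "l < ?n" for k l
      using P that len unfolding pic_def pict_def by simp
    have ?R1
    proof (intro allI impI)
      fix k assume k: "Suc k < ?n" "fst (?ds ! k) = fst (?ds ! Suc k)"
      then have "rlless (?ds ! k) (?ds ! Suc k)"
        using sd len by (auto simp: sdom_def sorted_wrt_iff_nth_less)
      then show "snd (cs ! k) < snd (cs ! Suc k) \<and> fst (cs ! Suc k) \<le> fst (cs ! k)"
        using D[of "Suc k" k] k by (auto simp: dir_def nwle_def swle_def rlless_def)
    qed
    moreover have ?R2 using D by (fastforce simp: dir_def nwle_def swle_def)
    ultimately show "length cs = ?n \<and> sorted_wrt (\<lambda>a b. \<not> nwle b a) cs \<and> ?R1 \<and> ?R2"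
      using l pic_noinv[OF sd P] by blast
  qed
  finally show ?thesis .
qed

lemma bij_betw_fill_RW: "bij_betw fill (pictures (rls (skew \<alpha> \<beta>)) (skew \<gamma> \<delta>)) (RW \<gamma> \<delta> \<alpha> \<beta>)"
  unfolding bij_betw_def
proof
  have d: "distinct cs" if "cs \<in> pictures (rls (skew \<alpha> \<beta>)) (skew \<gamma> \<delta>)" for cs
    using that pic_distinct[OF sdom_rls_skew] by (auto simp: pictures_def)
  show "inj_on fill (pictures (rls (skew \<alpha> \<beta>)) (skew \<gamma> \<delta>))"
    using d fill_inj by (meson inj_onI)
  show "fill ` pictures (rls (skew \<alpha> \<beta>)) (skew \<gamma> \<delta>) = RW \<gamma> \<delta> \<alpha> \<beta>"
  proof (intro equalityI subsetI)
    fix T assume "T \<in> fill ` pictures (rls (skew \<alpha> \<beta>)) (skew \<gamma> \<delta>)"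
    then show "T \<in> RW \<gamma> \<delta> \<alpha> \<beta>" using d RW_fill_iff by (auto simp: pictures_def)
  next
    fix T assume T: "T \<in> RW \<gamma> \<delta> \<alpha> \<beta>"
    then have "standard_tableau (skew \<gamma> \<delta>) T" by (simp add: RW_def Let_def)
    then obtain cs where cs: "distinct cs" "set cs = skew \<gamma> \<delta>" "T = fill cs"
      by (rule standard_is_fill) simp
    then show "T \<in> fill ` pictures (rls (skew \<alpha> \<beta>)) (skew \<gamma> \<delta>)"
      using T RW_fill_iff[OF cs(1,2)] by (auto simp: pictures_def)
  qed
qed

section \<open>Slides as infusion\<close>

text \<open>The list is scanned by increasing labels, and the hole moves at the nearest neighbour it
  meets. The boxes \<open>xs\<close> already passed precede the hole in the chain and are not
  south-east of it. So the neighbour met carries the smaller label, and a hole that meets no further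
  neighbour has reached the outside.\<close>

lemma jdt_slide_fill:
  "chain (xs @ h # cs) \<Longrightarrow> jdt_slide (fill (xs @ cs)) h = fill (xs @ fst (pass h cs))"
proof (induction cs arbitrary: xs h)
  case Nil
  have "\<not> nwle h x" if "x \<in> set xs" for x
    using Nil that by (auto simp: chain_def sorted_wrt_append)
  from this[of "(fst h, snd h + 1)"] this[of "(fst h + 1, snd h)"]
  have "(fst h, snd h + 1) \<notin> set xs" "(fst h + 1, snd h) \<notin> set xs"
    by (auto simp: nwle_def)
  then show ?case by (subst jdt_slide.simps) (simp add: Let_def fill_def)
next
  case (Cons c cs)
  obtain c' h' where s: "switch h c = (c', h')" by (rule prod.exhaust)
  have ch: "chain ((xs @ [c']) @ h' # cs)" using chain_switch[OF Cons.prems s] by simp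
  note IH = Cons.IH[OF ch]
  have dist: "distinct (xs @ h # c # cs)" by (rule chain_distinct[OF Cons.prems])
  have pass: "fst (pass h (c # cs)) = c' # fst (pass h' cs)" by (simp add: s case_prod_beta)
  have nx: "\<not> nwle h x" if "x \<in> set xs" for x
    using Cons.prems that by (auto simp: chain_def sorted_wrt_append)
  show ?case
  proof (cases "adj h c")
    case True
    then have hc: "c' = h" "h' = c" using s by (auto simp: switch_def)
    let ?F = "fill (xs @ c # cs)"
    \<comment> \<open>A competing neighbour of the hole is either empty or stands behind
      \<open>c\<close> in the list, with a larger label.\<close>
    have other: "?F b = 0 \<or> ?F c < ?F b" if "nwle h b" "b \<noteq> h" "b \<noteq> c" for b
    proof (cases "b \<in> set cs")
      case True
      then obtain k where k: "k < length cs" "cs ! k = b" by (metis in_set_conv_nth)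
      have "?F ((xs @ c # cs) ! (length xs + Suc k)) = Suc (length xs + Suc k)"
        by (rule fill_nth) (use dist k in auto)
      moreover have "?F ((xs @ c # cs) ! length xs) = Suc (length xs)"
        by (rule fill_nth) (use dist in auto)
      ultimately show ?thesis using k by (simp add: nth_append)
    next
      case False
      then have "b \<notin> set (xs @ c # cs)" using nx[of b] that by auto
      then show ?thesis by simp
    qed
    have Fc: "?F c \<noteq> 0" by simp
    have "jdt_slide ?F h = jdt_slide (?F(h := ?F c, c := 0)) c"
    proof -
      consider "c = (fst h, snd h + 1)" | "c = (fst h + 1, snd h)" using True by (auto simp: adj_def)
      then show ?thesis
      proof cases
        case 1
        have "?F (fst h + 1, snd h) = 0 \<or> ?F c < ?F (fst h + 1, snd h)"
          by (rule other) (auto simp: nwle_def 1 prod_eq_iff)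
        then show ?thesis using Fc 1 by (subst jdt_slide.simps) (auto simp: Let_def)
      next
        case 2
        have "?F (fst h, snd h + 1) = 0 \<or> ?F c < ?F (fst h, snd h + 1)"
          by (rule other) (auto simp: nwle_def 2 prod_eq_iff)
        then show ?thesis using Fc 2 by (subst jdt_slide.simps) (auto simp: Let_def)
      qed
    qed
    then show ?thesis using IH unfolding pass fill_hole_step[OF dist] by (simp add: hc)
  next
    case False
    then show ?thesis using s IH pass by (auto simp: switch_def)
  qed
qed

text \<open>Decreasing labels mean that the slide into the head of \<open>es\<close> is performed
  last, which is the order of the recursion in \<open>infuse\<close>.\<close>

lemma Slide_fill:
  assumes ch: "chain (es @ cs)"
  shows "Slide (fill es) (fill cs) = fill (fst (infuse es cs))"
proof -
  have d: "distinct es" using chain_distinct[OF ch] by simp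
  have "map (box_of (fill es)) (rev [1..<Suc (length es)]) = rev es"
  proof -
    have "map (box_of (fill es)) [1..<Suc (length es)] = es"
      by (rule nth_equalityI) (use d in \<open>auto simp: box_of_fill simp del: upt_Suc\<close>)
    then show ?thesis by (simp only: rev_map[symmetric])
  qed
  then have "Slide (fill es) (fill cs) = fold (\<lambda>b T. jdt_slide T b) (rev es) (fill cs)"
    unfolding Slide_def shape_fill distinct_card[OF d]
    using fold_map[of "\<lambda>b T. jdt_slide T b" "box_of (fill es)" "rev [1..<Suc (length es)]"]
    by (simp only: comp_def)
  also have "\<dots> = fill (fst (infuse es cs))"
    using ch
  proof (induction es)
    case (Cons e es)
    have c1: "chain (es @ cs)" using chain_suffix[of "[e]"] Cons.prems by simp
    obtain cs' es' where i: "infuse es cs = (cs', es')" by (rule prod.exhaust)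
    have "chain ([e] @ cs' @ es')" using chain_infuse(1)[of "[e]" es cs "[]"] Cons.prems i by simp
    then have "chain (e # cs')" using chain_prefix[of "e # cs'" es'] by simp
    then show ?case using Cons.IH[OF c1] jdt_slide_fill[of "[]" e cs'] i by (simp add: case_prod_beta)
  qed simp
  finally show ?thesis .
qed

section \<open>Pairs of pictures and infusion\<close>

text \<open>Two pictures stacked on each other with fixed total shape. The intermediate shape is
  left implicit, as infusion changes it; \<open>pairs_split\<close> recovers it.\<close>

definition pairs :: "box list \<Rightarrow> box list \<Rightarrow> box set \<Rightarrow> (box list \<times> box list) set" where
  "pairs dx dy C = {(xs, ys). pic dx xs \<and> pic dy ys \<and> chain (xs @ ys) \<and> set xs \<union> set ys = C}"

lemma infuse_pairs:
  assumes "sdom dx" "sdom dy" "(xs, ys) \<in> pairs dx dy C"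
  shows "infuse xs ys \<in> pairs dy dx C" "(\<lambda>(a, b). infuse a b) (infuse xs ys) = (xs, ys)"
proof -
  obtain ys' xs' where i: "infuse xs ys = (ys', xs')" by (rule prod.exhaust)
  have ch: "chain ([] @ xs @ ys @ [])" using assms(3) by (simp add: pairs_def)
  show "infuse xs ys \<in> pairs dy dx C" "(\<lambda>(a, b). infuse a b) (infuse xs ys) = (xs, ys)"
    using chain_infuse[OF ch i] pic_infuse[OF assms(2,1), of ys xs] assms(3) i by (auto simp: pairs_def)
qed

abbreviation dl :: "partition \<Rightarrow> partition \<Rightarrow> box list" where
  "dl \<beta> \<gamma> \<equiv> rls (skew \<beta> \<gamma>)"

lemma pairs_split:
  assumes "(xs, ys) \<in> pairs dx dy (skew \<gamma> \<beta>)" "\<beta> \<le> \<gamma>"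
  obtains \<mu> where "boxes \<mu> = boxes \<beta> \<union> set xs" "\<beta> \<le> \<mu>" "\<mu> \<le> \<gamma>"
    "xs \<in> pictures dx (skew \<mu> \<beta>)" "ys \<in> pictures dy (skew \<gamma> \<mu>)"
proof (rule chain_skew_split[of xs ys \<gamma> \<beta>])
  show "chain (xs @ ys)" "set xs \<union> set ys = skew \<gamma> \<beta>" using assms(1) by (auto simp: pairs_def)
qed (use assms that in \<open>auto simp: pairs_def pictures_def\<close>)

lemma pairs_joinI:
  assumes "sdom dx" "sdom dy" "xs \<in> pictures dx (skew \<mu> \<beta>)" "ys \<in> pictures dy (skew \<gamma> \<mu>)" "\<beta> \<le> \<mu>" "\<mu> \<le> \<gamma>"
  shows "(xs, ys) \<in> pairs dx dy (skew \<gamma> \<beta>)"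
proof -
  have "chain xs" "chain ys"
    using assms(3,4) conv_skew pic_chain[OF assms(1)] pic_chain[OF assms(2)] by (auto simp: pictures_def)
  from chain_skew_append[OF this _ _ assms(5,6)] show ?thesis
    using assms(3,4) by (auto simp: pairs_def pictures_def)
qed

lemma pairs_join:
  assumes "xs \<in> pictures (dl a b) (skew \<mu> \<beta>)" "ys \<in> pictures (dl c d) (skew \<gamma> \<mu>)" "\<beta> \<le> \<mu>" "\<mu> \<le> \<gamma>"
  shows "(xs, ys) \<in> pairs (dl a b) (dl c d) (skew \<gamma> \<beta>)"
  by (rule pairs_joinI[OF sdom_rls_skew sdom_rls_skew assms])

section \<open>Splitting a picture along the row rule\<close>

abbreviation sat :: "int \<Rightarrow> box \<times> box \<Rightarrow> bool" where
  "sat r p \<equiv> \<not> unsat r p"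

text \<open>Besides the arrows that leave \<open>(\<beta>1, \<beta>2)\<close> and satisfy the row
  rule this contains the trivial triple \<open>(\<beta>1, \<beta>2, [])\<close>, so that a Schur
  function becomes a single sum of \<tau> without a separate leading term.\<close>

definition Arr :: "int \<Rightarrow> partition \<Rightarrow> partition \<Rightarrow> (partition \<times> partition \<times> box list) set" where
  "Arr r \<beta>1 \<beta>2 = {(\<delta>, \<gamma>, ss). \<beta>1 \<le> \<delta> \<and> \<gamma> \<le> \<beta>2 \<and> ss \<in> pictures (dl \<beta>2 \<gamma>) (skew \<delta> \<beta>1) \<and>
     filter (unsat r) (zip (dl \<beta>2 \<gamma>) ss) = []}"

lemma zip_dl_sorted: "sorted_wrt (\<lambda>p q. rlless (fst p) (fst q)) (zip (dl \<beta> \<gamma>) ss)"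
proof -
  have "sorted_wrt rlless (take n (dl \<beta> \<gamma>))" for n
    using sdom_rls_skew by (simp add: sdom_def sorted_wrt_take)
  then have "sorted_wrt rlless (map fst (zip (dl \<beta> \<gamma>) ss))" by (simp add: map_fst_zip_take)
  then show ?thesis by (simp add: sorted_wrt_map)
qed

lemma zip_dl_eqI:
  assumes "sorted_wrt (\<lambda>p q. rlless (fst p) (fst q)) zs" "set zs = set (zip (dl \<beta> \<gamma>) ss)"
  shows "zs = zip (dl \<beta> \<gamma>) ss"
  by (rule sorted_wrt_eqI[OF assms(1) zip_dl_sorted assms(2)]) (rule rlless_asym)

text \<open>A step of k rows down and l columns right in the domain changes the entry of the row
  rule by k - l, while the image goes down by at least k rows; so the satisfying boxes are closed
  towards the south-east in the domain. The estimate for the inverse picture closes them towards the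
  north-west in the image. Hence both shapes can be cut, in opposite order: the satisfying part is
  outer in the domain and inner in the image.\<close>

lemma sat_split:
  fixes r :: int
  assumes le: "\<gamma>2 \<le> \<beta>2" "\<beta>1 \<le> \<delta>'" and ss: "ss \<in> pictures (dl \<beta>2 \<gamma>2) (skew \<delta>' \<beta>1)"
    and Z1: "Z1 = filter (sat r) (zip (dl \<beta>2 \<gamma>2) ss)"
    and Z2: "Z2 = filter (unsat r) (zip (dl \<beta>2 \<gamma>2) ss)"
  obtains \<delta> \<gamma>' where "boxes \<delta> = boxes \<beta>1 \<union> snd ` set Z1" "boxes \<gamma>' = boxes \<gamma>2 \<union> fst ` set Z2"
    "\<beta>1 \<le> \<delta>" "\<delta> \<le> \<delta>'" "\<gamma>2 \<le> \<gamma>'" "\<gamma>' \<le> \<beta>2"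
    "map snd Z1 \<in> pictures (dl \<beta>2 \<gamma>') (skew \<delta> \<beta>1)" "zip (dl \<beta>2 \<gamma>') (map snd Z1) = Z1"
    "map snd Z2 \<in> pictures (dl \<gamma>' \<gamma>2) (skew \<delta>' \<delta>)" "zip (dl \<gamma>' \<gamma>2) (map snd Z2) = Z2"
proof -
  let ?ds = "dl \<beta>2 \<gamma>2"
  let ?Z = "zip ?ds ss"
  have P: "pic ?ds ss" and sets: "set ss = skew \<delta>' \<beta>1" using ss by (auto simp: pictures_def)
  have Zset: "set Z1 \<union> set Z2 = set ?Z" "set Z1 \<inter> set Z2 = {}" unfolding Z1 Z2 by auto
  have sub: "set Z1 \<subseteq> set ?Z" "set Z2 \<subseteq> set ?Z" unfolding Z1 Z2 by auto
  have len: "length ?ds = length ss" by (rule pic_length[OF P])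
  have fstZ: "fst ` set ?Z = skew \<beta>2 \<gamma>2" "snd ` set ?Z = skew \<delta>' \<beta>1"
    using len sets by (metis list.set_map map_fst_zip set_rls_skew, metis list.set_map map_snd_zip)
  have dists: "distinct ss" "distinct ?ds" using pic_distinct[OF sdom_rls_skew P] sdom_distinct[OF sdom_rls_skew] by auto
  have inj: "inj_on fst (set ?Z)" "inj_on snd (set ?Z)"
    using dists len by (metis distinct_map map_fst_zip, metis distinct_map map_snd_zip)
  have up: "sat r (d', c')" if "(d, c) \<in> set ?Z" "(d', c') \<in> set ?Z" "sat r (d, c)" "nwle d d'" for d c d' c'
    using pic_row_shift[OF P _ that(1,2,4)] conv_skew that(3,4) by (auto simp: unsat_def nwle_def)
  have down: "sat r (d, c)" if "(d, c) \<in> set ?Z" "(d', c') \<in> set ?Z" "sat r (d', c')" "nwle c c'" for d c d' c'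
  proof -
    have "fst d + (fst c' - fst c) \<le> fst d' \<and> snd d' + (snd c' - snd c) \<le> snd d"
      by (rule pic_row_shift[OF pic_sym[OF P]]) (use that conv_skew sets in \<open>auto simp: set_zip_swap[of _ _ ss]\<close>)
    then show ?thesis using that(3,4) by (auto simp: unsat_def nwle_def)
  qed
  obtain \<gamma>' where \<gamma>': "boxes \<gamma>' = boxes \<gamma>2 \<union> fst ` set Z2" "\<gamma>2 \<le> \<gamma>'" "\<gamma>' \<le> \<beta>2"
    "fst ` set Z2 = skew \<gamma>' \<gamma>2" "fst ` set Z1 = skew \<beta>2 \<gamma>'"
  proof (rule skew_split[OF _ _ le(1), of "fst ` set Z2" "fst ` set Z1"])
    show "fst ` set Z2 \<union> fst ` set Z1 = skew \<beta>2 \<gamma>2" 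
      using fstZ(1) unfolding Zset(1)[symmetric] image_Un by blast
    show "fst ` set Z2 \<inter> fst ` set Z1 = {}" 
      using inj_on_image_Int[OF inj(1) sub(2,1)] Zset(2) by (simp add: Int_commute)
    show "\<not> nwle b a" if ab: "a \<in> fst ` set Z2" "b \<in> fst ` set Z1" for a b
    proof -
      obtain c c' where "(a, c) \<in> set ?Z" "unsat r (a, c)" "(b, c') \<in> set ?Z" "sat r (b, c')"
        using ab unfolding Z1 Z2 by auto
      then show ?thesis using up by blast
    qed
  qed blast
  obtain \<delta> where \<delta>: "boxes \<delta> = boxes \<beta>1 \<union> snd ` set Z1" "\<beta>1 \<le> \<delta>" "\<delta> \<le> \<delta>'"
    "snd ` set Z1 = skew \<delta> \<beta>1" "snd ` set Z2 = skew \<delta>' \<delta>"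
  proof (rule skew_split[OF _ _ le(2), of "snd ` set Z1" "snd ` set Z2"])
    show "snd ` set Z1 \<union> snd ` set Z2 = skew \<delta>' \<beta>1" 
      using fstZ(2) unfolding Zset(1)[symmetric] image_Un by blast
    show "snd ` set Z1 \<inter> snd ` set Z2 = {}" 
      using inj_on_image_Int[OF inj(2) sub] Zset(2) by simp
    show "\<not> nwle b a" if ab: "a \<in> snd ` set Z1" "b \<in> snd ` set Z2" for a b
    proof -
      obtain c c' where "(c, a) \<in> set ?Z" "sat r (c, a)" "(c', b) \<in> set ?Z" "unsat r (c', b)"
        using ab unfolding Z1 Z2 by auto
      then show ?thesis using down by blast
    qed
  qed blast
  have srt: "sorted_wrt rlless (map fst Z1)" "sorted_wrt rlless (map fst Z2)"
    unfolding Z1 Z2 sorted_wrt_map by (simp_all add: zip_dl_sorted sorted_wrt_filter)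
  have d1: "dl \<beta>2 \<gamma>' = map fst Z1" using rls_eq[OF srt(1)] \<gamma>'(5) by simp
  have d2: "dl \<gamma>' \<gamma>2 = map fst Z2" using rls_eq[OF srt(2)] \<gamma>'(4) by simp
  have z: "zip (map fst Z1) (map snd Z1) = Z1" "zip (map fst Z2) (map snd Z2) = Z2"
    by (simp_all add: zip_map_fst_snd)
  show ?thesis
  proof (rule that[OF \<delta>(1) \<gamma>'(1) \<delta>(2,3) \<gamma>'(2,3)])
    show "map snd Z1 \<in> pictures (dl \<beta>2 \<gamma>') (skew \<delta> \<beta>1)"
      unfolding pictures_def d1 using \<delta>(4) pic_subset[OF P, of "map fst Z1" "map snd Z1"] sub(1) by (simp add: z)
    show "map snd Z2 \<in> pictures (dl \<gamma>' \<gamma>2) (skew \<delta>' \<delta>)"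
      unfolding pictures_def d2 using \<delta>(5) pic_subset[OF P, of "map fst Z2" "map snd Z2"] sub(2) by (simp add: z)
  qed (simp_all add: d1 d2 z)
qed

text \<open>The row rule itself makes the two pieces fit. For neighbours in the domain on different
  sides of the cut it gives the inequality between the rows of their images; the one between the
  columns follows because a box of \<open>skew \<delta>' \<delta>\<close> is never north-west of a
  box of \<open>skew \<delta> \<beta>1\<close>.\<close>

lemma sat_glue:
  fixes r :: int
  assumes le: "\<gamma>2 \<le> \<gamma>'" "\<gamma>' \<le> \<beta>2" "\<beta>1 \<le> \<delta>" "\<delta> \<le> \<delta>'"
    and s1: "ss1 \<in> pictures (dl \<beta>2 \<gamma>') (skew \<delta> \<beta>1)" "filter (unsat r) (zip (dl \<beta>2 \<gamma>') ss1) = []"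
    and s2: "ss2 \<in> pictures (dl \<gamma>' \<gamma>2) (skew \<delta>' \<delta>)" "filter (sat r) (zip (dl \<gamma>' \<gamma>2) ss2) = []"
    and ss: "ss = map (\<lambda>d. the (map_of (zip (dl \<beta>2 \<gamma>') ss1 @ zip (dl \<gamma>' \<gamma>2) ss2) d)) (dl \<beta>2 \<gamma>2)"
  shows "ss \<in> pictures (dl \<beta>2 \<gamma>2) (skew \<delta>' \<beta>1)" "filter (sat r) (zip (dl \<beta>2 \<gamma>2) ss) = zip (dl \<beta>2 \<gamma>') ss1"
    "filter (unsat r) (zip (dl \<beta>2 \<gamma>2) ss) = zip (dl \<gamma>' \<gamma>2) ss2"
proof -
  let ?Z1 = "zip (dl \<beta>2 \<gamma>') ss1" and ?Z2 = "zip (dl \<gamma>' \<gamma>2) ss2" and ?ds = "dl \<beta>2 \<gamma>2"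
  let ?f = "\<lambda>d. the (map_of (?Z1 @ ?Z2) d)"
  have P1: "pic (dl \<beta>2 \<gamma>') ss1" and P2: "pic (dl \<gamma>' \<gamma>2) ss2" using s1 s2 by (auto simp: pictures_def)
  have set1: "fst ` set ?Z1 = skew \<beta>2 \<gamma>'" "snd ` set ?Z1 = skew \<delta> \<beta>1"
    using pic_length[OF P1] s1(1) by (simp_all add: pictures_def flip: list.set_map)
  have set2: "fst ` set ?Z2 = skew \<gamma>' \<gamma>2" "snd ` set ?Z2 = skew \<delta>' \<delta>"
    using pic_length[OF P2] s2(1) by (simp_all add: pictures_def flip: list.set_map)
  have un: "skew \<beta>2 \<gamma>2 = skew \<beta>2 \<gamma>' \<union> skew \<gamma>' \<gamma>2" "skew \<delta>' \<beta>1 = skew \<delta> \<beta>1 \<union> skew \<delta>' \<delta>"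
    using le by (auto simp: skew_def partition_le_iff)
  have dis: "skew \<beta>2 \<gamma>' \<inter> skew \<gamma>' \<gamma>2 = {}" by (auto simp: skew_def)
  have dist: "distinct (map fst (?Z1 @ ?Z2))"
    using dis pic_length[OF P1] pic_length[OF P2] sdom_distinct[OF sdom_rls_skew] by (simp add: set1 set2)
  have f: "?f d = c" if "(d, c) \<in> set ?Z1 \<union> set ?Z2" for d c
    using map_of_is_SomeI[OF dist] that by auto
  have Z: "set (zip ?ds ss) = set ?Z1 \<union> set ?Z2"
  proof -
    have "zip ?ds ss = map (\<lambda>d. (d, ?f d)) ?ds" unfolding ss by (simp add: zip_map2 zip_same_conv_map)
    then have "set (zip ?ds ss) = (\<lambda>d. (d, ?f d)) ` (fst ` (set ?Z1 \<union> set ?Z2))"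
      by (simp only: image_Un[of fst] set1 set2 un(1)[symmetric] set_map set_rls_skew)
    also have "\<dots> = (\<lambda>p. p) ` (set ?Z1 \<union> set ?Z2)"
      unfolding image_image by (rule image_cong) (auto simp: f simp del: map_of_append)
    finally show ?thesis by simp
  qed
  have u1: "sat r p" if "p \<in> set ?Z1" for p using s1(2) that by (metis filter_empty_conv)
  have u2: "unsat r p" if "p \<in> set ?Z2" for p using s2(2) that by (metis filter_empty_conv)
  have in1: "d \<in> skew \<beta>2 \<gamma>' \<and> c \<in> skew \<delta> \<beta>1" if "(d, c) \<in> set ?Z1" for d c
    using that set1 by (metis fst_conv image_eqI snd_conv)
  have in2: "d \<in> skew \<gamma>' \<gamma>2 \<and> c \<in> skew \<delta>' \<delta>" if "(d, c) \<in> set ?Z2" for d c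
    using that set2 by (metis fst_conv image_eqI snd_conv)
  have cross_d: "\<not> nwle d1 d2" if "(d1, c1) \<in> set ?Z1" "(d2, c2) \<in> set ?Z2" for d1 c1 d2 c2
    using in1[OF that(1)] in2[OF that(2)] boxes_down[of d2 \<gamma>' d1] skew_box_pos[of d1 \<beta>2 \<gamma>'] by (auto simp: skew_def)
  have cross_c: "\<not> nwle c2 c1" if "(d1, c1) \<in> set ?Z1" "(d2, c2) \<in> set ?Z2" for d1 c1 d2 c2
    using in1[OF that(1)] in2[OF that(2)] boxes_down[of c1 \<delta> c2] skew_box_pos[of c2 \<delta>' \<delta>] by (auto simp: skew_def)
  have getc: "\<exists>c. (d, c) \<in> set ?Z1 \<union> set ?Z2" if "d \<in> skew \<beta>2 \<gamma>2" for d
  proof -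
    have "d \<in> fst ` (set ?Z1 \<union> set ?Z2)" using that set1 set2 un by (simp add: image_Un)
    then show ?thesis by force
  qed
  have same: "dir d d' c c'" "dir c c' d d'"
    if "(d, c) \<in> set ?Z1 \<and> (d', c') \<in> set ?Z1 \<or> (d, c) \<in> set ?Z2 \<and> (d', c') \<in> set ?Z2" for d c d' c'
    using that pic_zipD[OF P1] pic_zipD[OF P2] by blast+
  have dirf: "dir a b (?f a) (?f b)" if ab: "a \<in> skew \<beta>2 \<gamma>2" "b \<in> skew \<beta>2 \<gamma>2" for a b
  proof (rule dir_of_steps[OF conv_skew[of \<beta>2 \<gamma>2], of ?f])
    fix i j assume ij: "(i, j) \<in> skew \<beta>2 \<gamma>2" "(i, Suc j) \<in> skew \<beta>2 \<gamma>2"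
    obtain c c' where c: "((i, j), c) \<in> set ?Z1 \<union> set ?Z2" "((i, Suc j), c') \<in> set ?Z1 \<union> set ?Z2"
      using getc ij by blast
    have le: "nwle (i, j) (i, Suc j)" by (simp add: nwle_def)
    have "fst c \<le> fst c' \<and> snd c' < snd c"
    proof (cases "((i, j), c) \<in> set ?Z2 \<and> ((i, Suc j), c') \<in> set ?Z1")
      case True
      \<comment> \<open>The entry drops by one along the row: failing at the left box and holding at
        the right one gives \<open>fst c \<le> fst c'\<close>.\<close>
      then have "\<not> nwle c c'" "unsat r ((i, j), c)" "sat r ((i, Suc j), c')" using cross_c u1 u2 by blast+
      then show ?thesis by (auto simp: unsat_def nwle_def)
    next
      case False
      then have "dir (i, j) (i, Suc j) c c'" using c same cross_d[of "(i, j)" c "(i, Suc j)" c'] le by blast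
      then show ?thesis by (simp add: dir_def swle_def nwle_def)
    qed
    then show "fst (?f (i, j)) \<le> fst (?f (i, Suc j)) \<and> snd (?f (i, Suc j)) < snd (?f (i, j))"
      using f[OF c(1)] f[OF c(2)] by simp
  next
    fix i j assume ij: "(i, j) \<in> skew \<beta>2 \<gamma>2" "(Suc i, j) \<in> skew \<beta>2 \<gamma>2"
    obtain c c' where c: "((i, j), c) \<in> set ?Z1 \<union> set ?Z2" "((Suc i, j), c') \<in> set ?Z1 \<union> set ?Z2"
      using getc ij by blast
    have le: "nwle (i, j) (Suc i, j)" by (simp add: nwle_def)
    have "fst c < fst c' \<and> snd c' \<le> snd c"
    proof (cases "((i, j), c) \<in> set ?Z2 \<and> ((Suc i, j), c') \<in> set ?Z1")
      case True
      then have "\<not> nwle c c'" "unsat r ((i, j), c)" "sat r ((Suc i, j), c')" using cross_c u1 u2 by blast+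
      then show ?thesis by (auto simp: unsat_def nwle_def)
    next
      case False
      then have "dir (i, j) (Suc i, j) c c'" using c same cross_d[of "(i, j)" c "(Suc i, j)" c'] le by blast
      then show ?thesis by (simp add: dir_def swle_def nwle_def)
    qed
    then show "fst (?f (i, j)) < fst (?f (Suc i, j)) \<and> snd (?f (Suc i, j)) \<le> snd (?f (i, j))"
      using f[OF c(1)] f[OF c(2)] by simp
  qed (use ab in auto)
  have dir1: "dir d d' c c'" if "(d, c) \<in> set ?Z1 \<union> set ?Z2" "(d', c') \<in> set ?Z1 \<union> set ?Z2" for d c d' c'
  proof -
    have "d \<in> skew \<beta>2 \<gamma>2" "d' \<in> skew \<beta>2 \<gamma>2" using that in1 in2 un by blast+
    from dirf[OF this] show ?thesis using f[OF that(1)] f[OF that(2)] by simp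
  qed
  \<comment> \<open>Since \<open>c1\<close> satisfies the rule, \<open>c2\<close> violates it and
    \<open>c1\<close> is not below \<open>c2\<close>, row minus column is strictly larger at
    \<open>d2\<close> than at \<open>d1\<close>. Together with the forward condition and the cut
    this leaves only positions of \<open>d2\<close> south-west of \<open>d1\<close>.\<close>
  have dir2: "dir c1 c2 d1 d2" if "(d1, c1) \<in> set ?Z1" "(d2, c2) \<in> set ?Z2" for d1 c1 d2 c2
  proof (cases "nwle c1 c2")
    case True
    have "dir d2 d1 c2 c1" using dir1 that by blast
    moreover have "sat r (d1, c1)" "unsat r (d2, c2)" "\<not> nwle d1 d2" using u1 u2 cross_d that by blast+
    ultimately show ?thesis using True
      by (cases d1; cases d2; cases c1; cases c2) (auto simp: dir_def nwle_def swle_def unsat_def)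
  qed (simp add: dir_def)
  have "pic ?ds ss"
    unfolding pic_zip Z case_prod_beta
  proof (intro conjI ballI)
    show "length ?ds = length ss" by (simp add: ss)
    fix p q assume "p \<in> set ?Z1 \<union> set ?Z2" "q \<in> set ?Z1 \<union> set ?Z2"
    then have a: "(fst p, snd p) \<in> set ?Z1 \<union> set ?Z2" "(fst q, snd q) \<in> set ?Z1 \<union> set ?Z2" by simp_all
    show "dir (fst p) (fst q) (snd p) (snd q)" by (rule dir1[OF a])
    consider "(fst p, snd p) \<in> set ?Z1 \<and> (fst q, snd q) \<in> set ?Z1 \<or>
        (fst p, snd p) \<in> set ?Z2 \<and> (fst q, snd q) \<in> set ?Z2"
      | "(fst p, snd p) \<in> set ?Z1" "(fst q, snd q) \<in> set ?Z2"
      | "(fst p, snd p) \<in> set ?Z2" "(fst q, snd q) \<in> set ?Z1" using a by blast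
    then show "dir (snd p) (snd q) (fst p) (fst q)"
    proof cases
      case 1 then show ?thesis by (rule same(2))
    next
      case 2 then show ?thesis by (rule dir2)
    next
      case 3 then show ?thesis using cross_c unfolding dir_def by blast
    qed
  qed
  moreover have "set ss = skew \<delta>' \<beta>1"
  proof -
    have "set ss = snd ` set (zip ?ds ss)" by (simp add: ss flip: list.set_map)
    then show ?thesis unfolding Z using set1 set2 un by (simp add: image_Un)
  qed
  ultimately show "ss \<in> pictures ?ds (skew \<delta>' \<beta>1)" by (simp add: pictures_def)
  show "filter (sat r) (zip ?ds ss) = ?Z1"
    by (rule zip_dl_eqI) (use Z u1 u2 in \<open>auto simp: sorted_wrt_filter zip_dl_sorted\<close>)
  show "filter (unsat r) (zip ?ds ss) = ?Z2"
    by (rule zip_dl_eqI) (use Z u1 u2 in \<open>auto simp: sorted_wrt_filter zip_dl_sorted\<close>)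
qed

section \<open>Pictures between straight shapes\<close>

definition rlen :: "partition \<Rightarrow> nat \<Rightarrow> nat" where
  "rlen \<mu> x = card {y. (x, y) \<in> boxes \<mu>}"

lemma boxes_rlen: "(x, y) \<in> boxes \<mu> \<longleftrightarrow> 1 \<le> x \<and> 1 \<le> y \<and> y \<le> rlen \<mu> x"
proof -
  let ?S = "{y. (x, y) \<in> boxes \<mu>}"
  have fin: "finite ?S"
    by (rule finite_subset[of _ "snd ` boxes \<mu>"]) force+
  have down: "y' \<in> ?S" if "y \<in> ?S" "1 \<le> y'" "y' \<le> y" for y y'
    using that boxes_down[of "(x, y)" \<mu> "(x, y')"] boxes_pos[of x y \<mu>] by (auto simp: nwle_def)
  have pos: "1 \<le> x \<and> 1 \<le> y" if "y \<in> ?S" for y using that boxes_pos by auto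
  show ?thesis
  proof
    assume "(x, y) \<in> boxes \<mu>"
    then have "{1..y} \<subseteq> ?S" using down[of y] by auto
    then have "card {1..y} \<le> rlen \<mu> x" unfolding rlen_def by (rule card_mono[OF fin])
    then show "1 \<le> x \<and> 1 \<le> y \<and> y \<le> rlen \<mu> x" using \<open>(x, y) \<in> boxes \<mu>\<close> boxes_pos by simp
  next
    assume a: "1 \<le> x \<and> 1 \<le> y \<and> y \<le> rlen \<mu> x"
    show "(x, y) \<in> boxes \<mu>"
    proof (rule ccontr)
      assume n: "(x, y) \<notin> boxes \<mu>"
      have "?S \<subseteq> {1..<y}"
      proof
        fix z assume z: "z \<in> ?S"
        have "\<not> y \<le> z" using down[OF z, of y] a n by auto
        then show "z \<in> {1..<y}" using pos[OF z] by simp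
      qed
      then have "rlen \<mu> x \<le> card {1..<y}" unfolding rlen_def by (rule card_mono[rotated]) simp
      then have "rlen \<mu> x \<le> y - 1" by simp
      then show False using a by linarith
    qed
  qed
qed

lemma rlen_antimono:
  assumes "1 \<le> x" "x \<le> x'"
  shows "rlen \<mu> x' \<le> rlen \<mu> x"
proof (cases "rlen \<mu> x' = 0")
  case False
  then have "(x', rlen \<mu> x') \<in> boxes \<mu>" using assms by (simp add: boxes_rlen)
  then have "(x, rlen \<mu> x') \<in> boxes \<mu>" by (rule boxes_down) (use assms False in \<open>auto simp: nwle_def\<close>)
  then show ?thesis by (simp add: boxes_rlen)
qed simp

text \<open>Every row is reversed. As a tableau this numbers the boxes row by row from left to
  right.\<close>

definition can :: "partition \<Rightarrow> box list" where
  "can \<mu> = map (\<lambda>(x, y). (x, Suc (rlen \<mu> x) - y)) (dl \<mu> \<emptyset>)"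

lemma set_dl_bot [simp]: "set (rls (boxes \<mu>)) = boxes \<mu>"
  using set_rls_skew[of \<mu> \<emptyset>] by simp

lemma can_pictures: "can \<mu> \<in> pictures (dl \<mu> \<emptyset>) (boxes \<mu>)"
proof -
  let ?g = "\<lambda>d. (fst d, Suc (rlen \<mu> (fst d)) - snd d)"
  have z: "set (zip (dl \<mu> \<emptyset>) (can \<mu>)) = (\<lambda>d. (d, ?g d)) ` boxes \<mu>"
    unfolding can_def by (simp add: zip_map2 zip_same_conv_map case_prod_unfold)
  have "pic (dl \<mu> \<emptyset>) (can \<mu>)"
    unfolding pic_zip z case_prod_beta
  proof (intro conjI ballI)
    show "length (dl \<mu> \<emptyset>) = length (can \<mu>)" by (simp add: can_def)
    fix p q assume "p \<in> (\<lambda>d. (d, ?g d)) ` boxes \<mu>" "q \<in> (\<lambda>d. (d, ?g d)) ` boxes \<mu>"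
    then obtain x y x' y' where pq: "p = ((x, y), (x, Suc (rlen \<mu> x) - y))" "q = ((x', y'), (x', Suc (rlen \<mu> x') - y'))"
      and b: "1 \<le> x" "1 \<le> y" "y \<le> rlen \<mu> x" "1 \<le> x'" "1 \<le> y'" "y' \<le> rlen \<mu> x'"
      by (auto simp: boxes_rlen)
    have m: "x \<le> x' \<Longrightarrow> rlen \<mu> x' \<le> rlen \<mu> x" using b(1) rlen_antimono by blast
    show "dir (fst p) (fst q) (snd p) (snd q)" "dir (snd p) (snd q) (fst p) (fst q)"
      unfolding pq using b m by (auto simp: dir_def nwle_def swle_def)
  qed
  moreover have "set (can \<mu>) = boxes \<mu>"
  proof (intro equalityI subsetI)
    fix b assume "b \<in> set (can \<mu>)"
    then show "b \<in> boxes \<mu>" by (auto simp: can_def boxes_rlen)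
  next
    fix b assume b: "b \<in> boxes \<mu>"
    then have "?g b \<in> boxes \<mu>" "?g (?g b) = b" by (cases b; auto simp: boxes_rlen)+
    then show "b \<in> set (can \<mu>)" unfolding can_def
      by (auto simp: case_prod_unfold intro!: image_eqI[of _ _ "?g b"])
  qed
  ultimately show ?thesis by (simp add: pictures_def)
qed

text \<open>The top row is an anchor: the box above \<open>d\<close> in row 1 has its image in row 1
  or lower, and by \<open>pic_row_shift\<close> the image of \<open>d\<close> is not above the row
  of \<open>d\<close>. The inverse picture gives the opposite inequality. Within the row, the images
  of its right end and of its left end bound \<open>snd c + snd d\<close> from below and from
  above.\<close>

lemma straight_pic:
  assumes P: "pic ds cs" and ds: "set ds = boxes \<mu>" and cs: "set cs = boxes \<nu>"
    and z: "(d, c) \<in> set (zip ds cs)"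
  shows "fst c = fst d" "rlen \<mu> (fst d) \<le> rlen \<nu> (fst d)" "Suc (rlen \<mu> (fst d)) \<le> snd c + snd d"
    "snd c + snd d \<le> Suc (rlen \<nu> (fst d))"
proof -
  have len: "length ds = length cs" by (rule pic_length[OF P])
  have ex: "\<exists>c. (d, c) \<in> set (zip ds cs)" if "d \<in> boxes \<mu>" for d
    using that len ds by (metis in_set_impl_in_set_zip1)
  have ex': "\<exists>d. (d, c) \<in> set (zip ds cs)" if "c \<in> boxes \<nu>" for c
    using that len cs by (metis in_set_impl_in_set_zip2)
  have inD: "d \<in> boxes \<mu>" "c \<in> boxes \<nu>" if "(d, c) \<in> set (zip ds cs)" for d c
    using that ds cs by (auto dest: set_zip_leftD set_zip_rightD)
  have le1: "fst d \<le> fst c" if z: "(d, c) \<in> set (zip ds cs)" for d c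
  proof -
    have d: "1 \<le> fst d" "1 \<le> snd d" "snd d \<le> rlen \<mu> (fst d)"
      using inD[OF z] boxes_rlen[of "fst d" "snd d" \<mu>] by auto
    have "(1, snd d) \<in> boxes \<mu>" by (rule boxes_down[OF inD(1)[OF z]]) (use d in \<open>auto simp: nwle_def\<close>)
    then obtain c0 where c0: "((1, snd d), c0) \<in> set (zip ds cs)" using ex by blast
    have "1 \<le> fst c0" using inD(2)[OF c0] boxes_pos[of "fst c0" "snd c0"] by simp
    moreover have "fst c0 + (fst d - fst (1, snd d)) \<le> fst c"
      using pic_row_shift[OF P _ c0 z] d conv_boxes ds by (auto simp: nwle_def)
    ultimately show ?thesis using d by simp
  qed
  have le2: "fst c \<le> fst d" if z: "(d, c) \<in> set (zip ds cs)" for d c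
  proof -
    have d: "1 \<le> fst c" "1 \<le> snd c" "snd c \<le> rlen \<nu> (fst c)"
      using inD[OF z] boxes_rlen[of "fst c" "snd c" \<nu>] by auto
    have "(1, snd c) \<in> boxes \<nu>" by (rule boxes_down[OF inD(2)[OF z]]) (use d in \<open>auto simp: nwle_def\<close>)
    then obtain d0 where d0: "(d0, (1, snd c)) \<in> set (zip ds cs)" using ex' by blast
    have "1 \<le> fst d0" using inD(1)[OF d0] boxes_pos[of "fst d0" "snd d0"] by simp
    moreover have "fst d0 + (fst c - fst (1, snd c)) \<le> fst d"
      using pic_row_shift[OF pic_sym[OF P], of "(1, snd c)" d0 c d] d0 z d conv_boxes cs
      by (auto simp: nwle_def set_zip_swap[of _ _ cs])
    ultimately show ?thesis using d by simp
  qed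
  have row: "fst c = fst d" if "(d, c) \<in> set (zip ds cs)" for d c
    using le1[OF that] le2[OF that] by simp
  show "fst c = fst d" by (rule row[OF z])
  have d: "1 \<le> fst d" "1 \<le> snd d" "snd d \<le> rlen \<mu> (fst d)"
    using inD[OF z] boxes_rlen[of "fst d" "snd d" \<mu>] by auto
  obtain c1 where c1: "((fst d, 1), c1) \<in> set (zip ds cs)" using ex[of "(fst d, 1)"] d by (auto simp: boxes_rlen)
  obtain c2 where c2: "((fst d, rlen \<mu> (fst d)), c2) \<in> set (zip ds cs)"
    using ex[of "(fst d, rlen \<mu> (fst d))"] d by (auto simp: boxes_rlen)
  have "1 \<le> snd c2" using inD(2)[OF c2] boxes_pos[of "fst c2" "snd c2"] by simp
  moreover have "snd c2 + (rlen \<mu> (fst d) - snd d) \<le> snd c"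
    using pic_row_shift[OF P _ z c2] d conv_boxes ds by (auto simp: nwle_def)
  ultimately show u: "Suc (rlen \<mu> (fst d)) \<le> snd c + snd d" using d by simp
  have "(fst c1, snd c1) \<in> boxes \<nu>" using inD(2)[OF c1] by simp
  then have "snd c1 \<le> rlen \<nu> (fst d)" unfolding boxes_rlen using row[OF c1] by simp
  moreover have "snd c + (snd d - 1) \<le> snd c1"
    using pic_row_shift[OF P _ c1 z] d conv_boxes ds by (auto simp: nwle_def)
  ultimately show l: "snd c + snd d \<le> Suc (rlen \<nu> (fst d))" using d by simp
  show "rlen \<mu> (fst d) \<le> rlen \<nu> (fst d)" using u l by simp
qed

lemma straight_pictures:
  assumes "cs \<in> pictures (dl \<mu> \<emptyset>) (boxes \<nu>)"
  shows "\<nu> = \<mu>" "cs = can \<mu>"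
proof -
  let ?ds = "dl \<mu> \<emptyset>"
  have P: "pic ?ds cs" and cs: "set cs = boxes \<nu>" and ds: "set ?ds = boxes \<mu>" using assms by (simp_all add: pictures_def)
  have len: "length ?ds = length cs" by (rule pic_length[OF P])
  have sub: "rlen \<mu> x \<le> rlen \<nu> x" if "1 \<le> x" for x
  proof (cases "rlen \<mu> x = 0")
    case False
    then have "(x, 1) \<in> set ?ds" using that ds by (simp add: boxes_rlen)
    then obtain c where "((x, 1), c) \<in> set (zip ?ds cs)" using len by (metis in_set_impl_in_set_zip1)
    from straight_pic(2)[OF P ds cs this] show ?thesis by simp
  qed simp
  have sub': "rlen \<nu> x \<le> rlen \<mu> x" if "1 \<le> x" for x
  proof (cases "rlen \<nu> x = 0")
    case False
    then have "(x, 1) \<in> set cs" using that cs by (simp add: boxes_rlen)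
    then obtain c where "((x, 1), c) \<in> set (zip cs ?ds)" using len by (metis in_set_impl_in_set_zip1)
    from straight_pic(2)[OF pic_sym[OF P] cs ds this] show ?thesis by simp
  qed simp
  have eq: "rlen \<nu> x = rlen \<mu> x" if "1 \<le> x" for x using sub sub' that by (simp add: le_antisym)
  have "boxes \<nu> = boxes \<mu>"
  proof (rule set_eqI)
    fix b show "b \<in> boxes \<nu> \<longleftrightarrow> b \<in> boxes \<mu>"
      using eq[of "fst b"] boxes_rlen[of "fst b" "snd b"] by (cases "1 \<le> fst b") auto
  qed
  then show \<nu>: "\<nu> = \<mu>" by (simp add: boxes_inject)
  show "cs = can \<mu>"
  proof (rule nth_equalityI)
    show "length cs = length (can \<mu>)" using len by (simp add: can_def)
    fix k assume k: "k < length cs"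
    then have z: "(?ds ! k, cs ! k) \<in> set (zip ?ds cs)" using len by (auto simp: set_zip)
    note s = straight_pic[OF P ds cs z]
    have "snd (?ds ! k) \<le> rlen \<mu> (fst (?ds ! k))"
      using k len ds boxes_rlen[of "fst (?ds ! k)" "snd (?ds ! k)" \<mu>] nth_mem[of k ?ds] by simp
    then have "cs ! k = (fst (?ds ! k), Suc (rlen \<mu> (fst (?ds ! k))) - snd (?ds ! k))"
      using s unfolding \<nu> by (auto simp: prod_eq_iff simp del: skew_bot)
    then show "cs ! k = can \<mu> ! k" using k len by (simp add: can_def case_prod_unfold)
  qed
qed

section \<open>Counting pictures\<close>

lemma finite_pictures: "finite C \<Longrightarrow> finite (pictures ds C)"
proof -
  assume "finite C"
  then have "finite {cs. set cs \<subseteq> C \<and> length cs = length ds}" by (rule finite_lists_length_eq)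
  then show ?thesis by (rule finite_subset[rotated]) (auto simp: pictures_def dest: pic_length)
qed

lemma finite_below: "finite {\<kappa>. \<kappa> \<le> (\<nu> :: partition)}"
  by (rule finite_subset[OF _ finite_partitions_card_le[of "card (boxes \<nu>)"]])
    (auto simp: partition_le_iff card_mono)

text \<open>Infusion with \<open>can \<mu>\<close> rectifies a picture to a straight shape
  \<open>\<kappa>\<close>, and the displaced copy of \<open>can \<mu>\<close> records how. Nothing
  is lost, because the inner partner is the only one possible.\<close>

lemma card_pictures_skew:
  assumes ds: "sdom ds" and le: "\<mu> \<le> \<nu>"
  shows "card (pictures ds (skew \<nu> \<mu>)) =
    (\<Sum>\<kappa> | \<kappa> \<le> \<nu>. card (pictures ds (boxes \<kappa>)) * card (pictures (dl \<mu> \<emptyset>) (skew \<nu> \<kappa>)))"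
proof -
  let ?S = "Sigma {\<kappa>. \<kappa> \<le> \<nu>} (\<lambda>\<kappa>. pictures ds (boxes \<kappa>) \<times> pictures (dl \<mu> \<emptyset>) (skew \<nu> \<kappa>))"
  let ?f = "\<lambda>cs. (Partition (set (fst (infuse (can \<mu>) cs))), infuse (can \<mu>) cs)"
  let ?g = "\<lambda>(\<kappa> :: partition, p). snd (infuse (fst p) (snd p))"
  have sm: "sdom (dl \<mu> \<emptyset>)" by (rule sdom_rls_skew)
  have "bij_betw ?f (pictures ds (skew \<nu> \<mu>)) ?S"
  proof (rule bij_betw_byWitness[where f' = ?g])
    have fw: "?f cs \<in> ?S \<and> ?g (?f cs) = cs" if cs: "cs \<in> pictures ds (skew \<nu> \<mu>)" for cs
    proof -
      have "(can \<mu>, cs) \<in> pairs (dl \<mu> \<emptyset>) ds (skew \<nu> \<emptyset>)"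
        by (rule pairs_joinI[OF sm ds _ cs _ le]) (use can_pictures in simp_all)
      note p = infuse_pairs[OF sm ds this]
      obtain cs' us where i: "infuse (can \<mu>) cs = (cs', us)" by (rule prod.exhaust)
      obtain \<kappa> where l: "boxes \<kappa> = boxes \<emptyset> \<union> set cs'" "\<kappa> \<le> \<nu>" "cs' \<in> pictures ds (skew \<kappa> \<emptyset>)" "us \<in> pictures (dl \<mu> \<emptyset>) (skew \<nu> \<kappa>)"
      proof (rule pairs_split[OF _ bot_least])
        show "(cs', us) \<in> pairs ds (dl \<mu> \<emptyset>) (skew \<nu> \<emptyset>)" using p(1) i by simp
      qed
      have "Partition (set cs') = \<kappa>" using l(1) boxes_inverse[of \<kappa>] by simp
      then show ?thesis using l p(2) i by simp
    qed
    have bw: "?g x \<in> pictures ds (skew \<nu> \<mu>) \<and> ?f (?g x) = x" if x: "x \<in> ?S" for x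
    proof -
      obtain \<kappa> cs' us where xe: "x = (\<kappa>, cs', us)" and l: "\<kappa> \<le> \<nu>" "cs' \<in> pictures ds (boxes \<kappa>)" "us \<in> pictures (dl \<mu> \<emptyset>) (skew \<nu> \<kappa>)"
        using x by auto
      have "(cs', us) \<in> pairs ds (dl \<mu> \<emptyset>) (skew \<nu> \<emptyset>)"
        by (rule pairs_joinI[OF ds sm _ l(3) _ l(1)]) (use l(2) in simp_all)
      note p = infuse_pairs[OF ds sm this]
      obtain us' cs where i: "infuse cs' us = (us', cs)" by (rule prod.exhaust)
      obtain \<mu>' where m: "us' \<in> pictures (dl \<mu> \<emptyset>) (skew \<mu>' \<emptyset>)" "cs \<in> pictures ds (skew \<nu> \<mu>')"
      proof (rule pairs_split[OF _ bot_least])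
        show "(us', cs) \<in> pairs (dl \<mu> \<emptyset>) ds (skew \<nu> \<emptyset>)" using p(1) i by simp
      qed
      \<comment> \<open>The list that returns to the inner place is a picture of
        \<open>\<mu>\<close> onto a straight shape, which determines both the shape and the
        list.\<close>
      have e: "\<mu>' = \<mu>" "us' = can \<mu>" using straight_pictures[of us' \<mu> \<mu>'] m(1) by simp_all
      have "Partition (set cs') = \<kappa>" using l(2) boxes_inverse[of \<kappa>] by (simp add: pictures_def)
      then show ?thesis using m(2) p(2) i e by (simp add: xe)
    qed
    show "\<forall>cs \<in> pictures ds (skew \<nu> \<mu>). ?g (?f cs) = cs" using fw by blast
    show "\<forall>x \<in> ?S. ?f (?g x) = x" using bw by blast
    show "?f ` pictures ds (skew \<nu> \<mu>) \<subseteq> ?S" using fw by blast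
    show "?g ` ?S \<subseteq> pictures ds (skew \<nu> \<mu>)" using bw by blast
  qed
  then have "card (pictures ds (skew \<nu> \<mu>)) = card ?S" by (rule bij_betw_same_card)
  also have "\<dots> = (\<Sum>\<kappa> | \<kappa> \<le> \<nu>. card (pictures ds (boxes \<kappa>) \<times> pictures (dl \<mu> \<emptyset>) (skew \<nu> \<kappa>)))"
    by (rule card_SigmaI) (simp_all add: finite_below finite_pictures finite_cartesian_product)
  finally show ?thesis by (simp add: card_cartesian_product)
qed

lemma card_straight_pictures: "card (pictures (dl \<kappa> \<emptyset>) (boxes \<kappa>')) = (if \<kappa>' = \<kappa> then 1 else 0)"
proof (cases "\<kappa>' = \<kappa>")
  case True
  then have "pictures (dl \<kappa> \<emptyset>) (boxes \<kappa>') = {can \<kappa>}" using can_pictures straight_pictures(2) by blast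
  then show ?thesis using True by simp
next
  case False
  then have "pictures (dl \<kappa> \<emptyset>) (boxes \<kappa>') = {}" using straight_pictures(1) by blast
  then show ?thesis using False by simp
qed

text \<open>Symmetry of the Littlewood-Richardson coefficients: for a straight domain the sum of
  \<open>card_pictures_skew\<close> collapses to the term of that shape.\<close>

lemma card_pictures_swap:
  assumes "\<mu> \<le> \<nu>"
  shows "card (pictures (dl \<kappa> \<emptyset>) (skew \<nu> \<mu>)) = (if \<kappa> \<le> \<nu> then card (pictures (dl \<mu> \<emptyset>) (skew \<nu> \<kappa>)) else 0)"
  unfolding card_pictures_skew[OF sdom_rls_skew assms] card_straight_pictures
  by (simp add: if_distrib[of "\<lambda>x. x * _"] sum.delta[OF finite_below] cong: if_cong)

text \<open>The counterpart of expanding a skew Schur function in Schur functions: the coefficients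
  depend on \<open>ds\<close> and \<open>\<kappa>\<close> only, and the target enters only through
  straight domains.\<close>

lemma card_pictures_decompose:
  assumes "sdom ds" "\<mu> \<le> \<nu>"
  shows "card (pictures ds (skew \<nu> \<mu>)) =
    (\<Sum>\<kappa> | \<kappa> \<le> \<nu>. card (pictures ds (boxes \<kappa>)) * card (pictures (dl \<kappa> \<emptyset>) (skew \<nu> \<mu>)))"
  unfolding card_pictures_skew[OF assms] by (rule sum.cong[OF refl]) (simp add: card_pictures_swap[OF assms(2)] del: skew_bot)

section \<open>Disjoint unions of straight shapes\<close>

text \<open>The domain \<open>star \<beta> \<alpha>\<close> places \<open>\<beta>\<close> to the north-east of \<open>\<alpha>\<close>.\<close>

definition shiftR :: "partition \<Rightarrow> box \<Rightarrow> box" where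
  "shiftR \<alpha> b = (fst b, snd b + Max (insert 0 (snd ` boxes \<alpha>)))"

text \<open>The shifts are by the number of columns of \<open>\<alpha>\<close> and the number of
  rows of \<open>\<beta>\<close>; \<open>insert 0\<close> covers the empty partition.\<close>

definition shiftD :: "partition \<Rightarrow> box \<Rightarrow> box" where
  "shiftD \<beta> b = (fst b + Max (insert 0 (fst ` boxes \<beta>)), snd b)"

definition star :: "partition \<Rightarrow> partition \<Rightarrow> box list" where
  "star \<beta> \<alpha> = map (shiftR \<alpha>) (dl \<beta> \<emptyset>) @ map (shiftD \<beta>) (dl \<alpha> \<emptyset>)"

lemma shift_sep:
  assumes "b \<in> boxes \<beta>" "a \<in> boxes \<alpha>"
  shows "fst (shiftR \<alpha> b) < fst (shiftD \<beta> a)" "snd (shiftD \<beta> a) < snd (shiftR \<alpha> b)"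
proof -
  have "fst b \<le> Max (insert 0 (fst ` boxes \<beta>))" "snd a \<le> Max (insert 0 (snd ` boxes \<alpha>))"
    using assms by (auto intro!: Max_ge)
  then show "fst (shiftR \<alpha> b) < fst (shiftD \<beta> a)" "snd (shiftD \<beta> a) < snd (shiftR \<alpha> b)"
    using boxes_pos[of "fst a" "snd a" \<alpha>] boxes_pos[of "fst b" "snd b" \<beta>] assms
    unfolding shiftR_def shiftD_def fst_conv snd_conv prod.collapse by linarith+
qed

lemma shift_order:
  "nwle (shiftR \<alpha> a) (shiftR \<alpha> b) = nwle a b" "nwle (shiftD \<beta> a) (shiftD \<beta> b) = nwle a b"
  "rlless (shiftR \<alpha> a) (shiftR \<alpha> b) = rlless a b" "rlless (shiftD \<beta> a) (shiftD \<beta> b) = rlless a b"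
  "dir (shiftR \<alpha> a) (shiftR \<alpha> b) c c' = dir a b c c'" "dir (shiftD \<beta> a) (shiftD \<beta> b) c c' = dir a b c c'"
  "dir c c' (shiftR \<alpha> a) (shiftR \<alpha> b) = dir c c' a b" "dir c c' (shiftD \<beta> a) (shiftD \<beta> b) = dir c c' a b"
  by (auto simp: shiftR_def shiftD_def nwle_def rlless_def dir_def swle_def)

lemma inj_shift: "inj_on (shiftR \<alpha>) A" "inj_on (shiftD \<beta>) A"
  by (auto simp: inj_on_def shiftR_def shiftD_def prod_eq_iff)

lemma set_star: "set (star \<beta> \<alpha>) = shiftR \<alpha> ` boxes \<beta> \<union> shiftD \<beta> ` boxes \<alpha>"
  by (simp add: star_def)

lemma conv_shift: "conv S \<Longrightarrow> conv (shiftR \<alpha> ` S)" "conv S \<Longrightarrow> conv (shiftD \<beta> ` S)"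
proof -
  assume S: "conv S"
  show "conv (shiftR \<alpha> ` S)"
    unfolding conv_def
  proof (intro ballI allI impI)
    fix x y b assume xy: "x \<in> shiftR \<alpha> ` S" "y \<in> shiftR \<alpha> ` S" and le: "nwle x b \<and> nwle b y"
    then obtain a c where ac: "a \<in> S" "c \<in> S" "x = shiftR \<alpha> a" "y = shiftR \<alpha> c" by auto
    have b: "b = shiftR \<alpha> (fst b, snd b - Max (insert 0 (snd ` boxes \<alpha>)))" (is "b = shiftR \<alpha> ?b")
    proof -
      have "Max (insert 0 (snd ` boxes \<alpha>)) \<le> snd b" using le unfolding ac shiftR_def nwle_def by (metis le_add2 order_trans snd_conv)
      then show ?thesis unfolding shiftR_def prod_eq_iff fst_conv snd_conv by linarith
    qed
    have "nwle a ?b" "nwle ?b c" using le shift_order(1) b unfolding ac by metis+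
    then have "?b \<in> S" by (rule convD[OF S ac(1,2)])
    then show "b \<in> shiftR \<alpha> ` S" by (subst b) (rule imageI)
  qed
  show "conv (shiftD \<beta> ` S)"
    unfolding conv_def
  proof (intro ballI allI impI)
    fix x y b assume xy: "x \<in> shiftD \<beta> ` S" "y \<in> shiftD \<beta> ` S" and le: "nwle x b \<and> nwle b y"
    then obtain a c where ac: "a \<in> S" "c \<in> S" "x = shiftD \<beta> a" "y = shiftD \<beta> c" by auto
    have b: "b = shiftD \<beta> (fst b - Max (insert 0 (fst ` boxes \<beta>)), snd b)" (is "b = shiftD \<beta> ?b")
    proof -
      have "Max (insert 0 (fst ` boxes \<beta>)) \<le> fst b" using le unfolding ac shiftD_def nwle_def by (metis le_add2 order_trans fst_conv)
      then show ?thesis unfolding shiftD_def prod_eq_iff fst_conv snd_conv by linarith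
    qed
    have "nwle a ?b" "nwle ?b c" using le shift_order(2) b unfolding ac by metis+
    then have "?b \<in> S" by (rule convD[OF S ac(1,2)])
    then show "b \<in> shiftD \<beta> ` S" by (subst b) (rule imageI)
  qed
qed

lemma sdom_star: "sdom (star \<beta> \<alpha>)"
proof -
  have "sorted_wrt rlless (dl \<mu> \<emptyset>)" for \<mu> using sdom_rls_skew[of \<mu> \<emptyset>] by (simp add: sdom_def)
  then have "sorted_wrt rlless (star \<beta> \<alpha>)"
    unfolding star_def sorted_wrt_append sorted_wrt_map shift_order
    using shift_sep(1)[of _ \<beta> _ \<alpha>] by (auto simp: rlless_def[of "shiftR _ _" "shiftD _ _"])
  moreover have "conv (shiftR \<alpha> ` boxes \<beta> \<union> shiftD \<beta> ` boxes \<alpha>)" (is "conv (?B \<union> ?A)")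
    unfolding conv_def
  proof (intro ballI allI impI)
    fix x y b assume xy: "x \<in> ?B \<union> ?A" "y \<in> ?B \<union> ?A" and le: "nwle x b \<and> nwle b y"
    have "nwle x y" using le nwle_trans by blast
    then have "x \<in> ?B \<and> y \<in> ?B \<or> x \<in> ?A \<and> y \<in> ?A"
      using xy shift_sep[of _ \<beta> _ \<alpha>] by (fastforce simp: nwle_def)
    then show "b \<in> ?B \<union> ?A"
      using le convD[OF conv_shift(1)[OF conv_boxes]] convD[OF conv_shift(2)[OF conv_boxes]] by blast
  qed
  ultimately show ?thesis by (simp add: sdom_def set_star)
qed

lemma pic_map_shift:
  "pic (map (shiftR \<alpha>) ds) cs = pic ds cs" "pic (map (shiftD \<beta>) ds) cs = pic ds cs"
  unfolding pic_zip by (auto simp: zip_map1 shift_order case_prod_unfold)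

text \<open>The part \<open>\<beta>\<close> is read before \<open>\<alpha>\<close>, so its image is
  an inner straight shape and the picture on it must be \<open>can \<beta>\<close>. What remains
  free is a picture of \<open>\<alpha>\<close> onto \<open>skew \<kappa> \<beta>\<close>, since the
  two parts are incomparable and impose no forward condition on each other.\<close>

lemma pictures_star:
  "pictures (star \<beta> \<alpha>) (boxes \<kappa>) = (if \<beta> \<le> \<kappa> then (\<lambda>es. can \<beta> @ es) ` pictures (dl \<alpha> \<emptyset>) (skew \<kappa> \<beta>) else {})"
proof -
  have fw: "\<beta> \<le> \<kappa> \<and> (\<exists>es \<in> pictures (dl \<alpha> \<emptyset>) (skew \<kappa> \<beta>). cs = can \<beta> @ es)" if cs: "cs \<in> pictures (star \<beta> \<alpha>) (boxes \<kappa>)" for cs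
  proof -
    have P: "pic (star \<beta> \<alpha>) cs" and s: "set cs = boxes \<kappa>" using cs by (auto simp: pictures_def)
    have ch: "chain cs" by (rule pic_chain[OF sdom_star P]) (simp add: s conv_boxes)
    define xs ys where "xs = take (length (dl \<beta> \<emptyset>)) cs" and "ys = drop (length (dl \<beta> \<emptyset>)) cs"
    have e: "cs = xs @ ys" by (simp add: xs_def ys_def)
    have l: "length (dl \<beta> \<emptyset>) = length xs" "length (dl \<alpha> \<emptyset>) = length ys"
      using pic_length[OF P] by (simp_all add: xs_def ys_def star_def)
    have z: "zip (star \<beta> \<alpha>) cs = zip (map (shiftR \<alpha>) (dl \<beta> \<emptyset>)) xs @ zip (map (shiftD \<beta>) (dl \<alpha> \<emptyset>)) ys"
      unfolding star_def e using l by (intro zip_append) simp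
    have "pic (map (shiftR \<alpha>) (dl \<beta> \<emptyset>)) xs" "pic (map (shiftD \<beta>) (dl \<alpha> \<emptyset>)) ys"
      by (rule pic_subset[OF P], unfold z, use l in auto)+
    then have "(xs, ys) \<in> pairs (dl \<beta> \<emptyset>) (dl \<alpha> \<emptyset>) (skew \<kappa> \<emptyset>)"
      using ch s unfolding pairs_def pic_map_shift e by simp
    then obtain \<mu> where m: "\<mu> \<le> \<kappa>" "xs \<in> pictures (dl \<beta> \<emptyset>) (skew \<mu> \<emptyset>)" "ys \<in> pictures (dl \<alpha> \<emptyset>) (skew \<kappa> \<mu>)"
      by (rule pairs_split) simp
    have "\<mu> = \<beta>" "xs = can \<beta>" using straight_pictures[of xs \<beta> \<mu>] m(2) by simp_all
    then show ?thesis using m e by blast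
  qed
  have bw: "can \<beta> @ es \<in> pictures (star \<beta> \<alpha>) (boxes \<kappa>)" if le: "\<beta> \<le> \<kappa>" and es: "es \<in> pictures (dl \<alpha> \<emptyset>) (skew \<kappa> \<beta>)" for es
  proof -
    have "(can \<beta>, es) \<in> pairs (dl \<beta> \<emptyset>) (dl \<alpha> \<emptyset>) (skew \<kappa> \<emptyset>)"
      by (rule pairs_join[OF _ es _ le]) (use can_pictures in simp_all)
    then have p: "pic (dl \<beta> \<emptyset>) (can \<beta>)" "pic (dl \<alpha> \<emptyset>) es" "chain (can \<beta> @ es)" "set (can \<beta> @ es) = boxes \<kappa>"
      by (simp_all add: pairs_def)
    let ?dx = "map (shiftR \<alpha>) (dl \<beta> \<emptyset>)" and ?dy = "map (shiftD \<beta>) (dl \<alpha> \<emptyset>)"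
    have l: "length ?dx = length (can \<beta>)" "length ?dy = length es" using pic_length[OF p(1)] pic_length[OF p(2)] by simp_all
    have pp: "pic ?dx (can \<beta>)" "pic ?dy es" using p by (simp_all only: pic_map_shift)
    have cross: "\<not> nwle a b \<and> \<not> nwle b a" if "a \<in> set ?dx" "b \<in> set ?dy" for a b
      using that shift_sep[of _ \<beta> _ \<alpha>] by (fastforce simp: nwle_def)
    have "pic (star \<beta> \<alpha>) (can \<beta> @ es)"
    proof (rule picI[OF sdom_star])
      show "length (star \<beta> \<alpha>) = length (can \<beta> @ es)" using l by (simp add: star_def)
      show "sorted_wrt (\<lambda>a b. \<not> nwle b a) (can \<beta> @ es)" using p(3) by (simp add: chain_def)
      fix i j assume ij: "i < length (star \<beta> \<alpha>)" "j < length (star \<beta> \<alpha>)"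
      have st: "star \<beta> \<alpha> = ?dx @ ?dy" by (simp add: star_def)
      define n where "n = length ?dx"
      have z1: "(?dx ! k, can \<beta> ! k) \<in> set (zip ?dx (can \<beta>))" if "k < n" for k
        using that l unfolding n_def set_zip by (auto simp del: nth_map)
      have z2: "(?dy ! k, es ! k) \<in> set (zip ?dy es)" if "k < length ?dy" for k
        using that l unfolding set_zip by (auto simp del: nth_map)
      have len: "length (star \<beta> \<alpha>) = n + length ?dy" by (simp add: star_def n_def)
      have nth: "star \<beta> \<alpha> ! k = (if k < n then ?dx ! k else ?dy ! (k - n))"
        "(can \<beta> @ es) ! k = (if k < n then can \<beta> ! k else es ! (k - n))" for k
        using l unfolding st n_def by (simp_all only: nth_append)
      have in1: "?dx ! k \<in> set ?dx" if "k < n" for k using that unfolding n_def by (rule nth_mem)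
      have in2: "?dy ! k \<in> set ?dy" if "k < length ?dy" for k using that by (rule nth_mem)
      consider "i < n" "j < n" | "i < n" "\<not> j < n" | "\<not> i < n" "j < n" | "\<not> i < n" "\<not> j < n" by blast
      then show "dir (star \<beta> \<alpha> ! i) (star \<beta> \<alpha> ! j) ((can \<beta> @ es) ! i) ((can \<beta> @ es) ! j)"
      proof cases
        case 1
        then show ?thesis unfolding nth using pic_zipD(1)[OF pp(1) z1 z1] by simp
      next
        case 2
        then have "j - n < length ?dy" using ij(2) len by simp
        then show ?thesis unfolding nth using 2 cross[OF in1 in2] by (simp add: dir_def del: nth_map)
      next
        case 3
        then have "i - n < length ?dy" using ij(1) len by simp
        then show ?thesis unfolding nth using 3 cross[OF in1 in2] by (simp add: dir_def del: nth_map)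
      next
        case 4
        then have "i - n < length ?dy" "j - n < length ?dy" using ij len by simp_all
        then show ?thesis unfolding nth using 4 pic_zipD(1)[OF pp(2) z2 z2] by simp
      qed
    qed
    then show ?thesis using p(4) by (simp add: pictures_def)
  qed
  show ?thesis using fw bw by (auto simp del: skew_bot)
qed

lemma card_pictures_star:
  "card (pictures (star \<beta> \<alpha>) (boxes \<kappa>)) = (if \<beta> \<le> \<kappa> then card (pictures (dl \<alpha> \<emptyset>) (skew \<kappa> \<beta>)) else 0)"
  unfolding pictures_star by (simp add: card_image inj_on_def)

section \<open>Semistandard tableaux as pictures\<close>

text \<open>The content is prescribed from 1 onwards: entries are positive, and \<open>k 0\<close>
  is left free.\<close>

definition ssyts :: "box set \<Rightarrow> (nat \<Rightarrow> nat) \<Rightarrow> filling set" where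
  "ssyts D k = {T. semistandard_tableau D T \<and> (\<forall>i\<ge>1. card {b \<in> D. T b = i} = k i)}"

abbreviation lk :: "box list \<Rightarrow> box list \<Rightarrow> box \<Rightarrow> box" where
  "lk ds cs b \<equiv> the (map_of (zip ds cs) b)"

lemma lk_zip:
  assumes "length ds = length cs" "b \<in> set ds"
  shows "(b, lk ds cs b) \<in> set (zip ds cs)"
proof -
  obtain c where "map_of (zip ds cs) b = Some c" using assms by (metis map_of_zip_is_Some)
  then show ?thesis by (simp add: map_of_SomeD)
qed

lemma map_lk: "distinct ds \<Longrightarrow> length ds = length cs \<Longrightarrow> map (lk ds cs) ds = cs"
  by (rule nth_equalityI) (simp_all add: map_of_zip_nth)

lemma pic_lk:
  assumes "sdom ds" "pic ds cs"
  shows "lk ds cs ` set ds = set cs" "inj_on (lk ds cs) (set ds)"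
    "b \<in> set ds \<Longrightarrow> b' \<in> set ds \<Longrightarrow> dir b b' (lk ds cs b) (lk ds cs b')"
    "b \<in> set ds \<Longrightarrow> b' \<in> set ds \<Longrightarrow> dir (lk ds cs b) (lk ds cs b') b b'"
proof -
  have len: "length ds = length cs" by (rule pic_length[OF assms(2)])
  show "lk ds cs ` set ds = set cs"
    using map_lk[OF sdom_distinct[OF assms(1)] len] by (metis list.set_map)
  show "b \<in> set ds \<Longrightarrow> b' \<in> set ds \<Longrightarrow> dir b b' (lk ds cs b) (lk ds cs b')" for b b'
    by (rule pic_zipD(1)[OF assms(2) lk_zip[OF len] lk_zip[OF len]])
  show d: "b \<in> set ds \<Longrightarrow> b' \<in> set ds \<Longrightarrow> dir (lk ds cs b) (lk ds cs b') b b'" for b b'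
    by (rule pic_zipD(2)[OF assms(2) lk_zip[OF len] lk_zip[OF len]])
  show "inj_on (lk ds cs) (set ds)"
  proof (rule inj_onI)
    fix x y assume "x \<in> set ds" "y \<in> set ds" "lk ds cs x = lk ds cs y"
    then show "x = y" using d[of x y] d[of y x] by (auto simp: dir_def swle_def nwle_def prod_eq_iff)
  qed
qed

text \<open>A semistandard tableau of content \<open>k\<close> is a picture onto a disjoint union of rows of lengths \<open>k 1, k 2, \<dots>\<close>,
  each row lying strictly to the left of the rows above it; here \<open>s i = k i + k (i + 1) + \<dots>\<close>.\<close>

lemma bij_betw_pictures_ssyts:
  assumes ds: "sdom ds" and s: "\<And>i. s i = k i + s (Suc i)"
    and C: "C = {(i, j). 1 \<le> i \<and> s (Suc i) < j \<and> j \<le> s i}"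
  shows "bij_betw (\<lambda>cs b. if b \<in> set ds then fst (lk ds cs b) else 0) (pictures ds C) (ssyts (set ds) k)"
    (is "bij_betw ?\<Phi> _ _")
  unfolding bij_betw_def
proof
  let ?D = "set ds"
  have dist: "distinct ds" by (rule sdom_distinct[OF ds])
  have anti: "s b \<le> s a" if "a \<le> b" for a b
  proof (rule lift_Suc_antimono_le[OF _ that])
    show "s (Suc i) \<le> s i" for i using s[of i] by linarith
  qed
  \<comment> \<open>Boxes with the same entry, read from right to left, fill a row of
    \<open>C\<close> from left to right. So the column of an image is a rank among equal entries,
    and the first coordinates determine the picture.\<close>
  have column: "snd (lk ds cs b) = s (Suc (fst (lk ds cs b))) +
      card {b' \<in> ?D. fst (lk ds cs b') = fst (lk ds cs b) \<and> snd b \<le> snd b'}"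
    if cs: "cs \<in> pictures ds C" and b: "b \<in> ?D" for cs b
  proof -
    have P: "pic ds cs" and setcs: "set cs = C" using cs by (auto simp: pictures_def)
    note l = pic_lk[OF ds P]
    let ?i = "fst (lk ds cs b)"
    have bC: "lk ds cs b \<in> C" using l(1) b setcs by blast
    have "lk ds cs ` {b' \<in> ?D. fst (lk ds cs b') = ?i \<and> snd b \<le> snd b'} = {?i} \<times> {s (Suc ?i)<..snd (lk ds cs b)}"
      (is "_ ` ?A = ?B")
    proof (intro equalityI subsetI)
      fix c assume "c \<in> lk ds cs ` ?A"
      then obtain b' where b': "b' \<in> ?D" "fst (lk ds cs b') = ?i" "snd b \<le> snd b'" "c = lk ds cs b'" by auto
      have "c \<in> C" using l(1) b' setcs by blast
      moreover have "\<not> snd (lk ds cs b) < snd c"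
        using l(4)[OF b b'(1)] b' by (auto simp: dir_def nwle_def)
      ultimately show "c \<in> ?B" using b' by (cases c) (auto simp: C)
    next
      fix c assume c: "c \<in> ?B"
      then have "c \<in> C" using bC unfolding C by (cases c; cases "lk ds cs b") auto
      then obtain b' where b': "b' \<in> ?D" "c = lk ds cs b'" using l(1) setcs by auto
      have "nwle (lk ds cs b') (lk ds cs b)" using c b' by (cases c) (auto simp: nwle_def)
      then have "snd b \<le> snd b'" using l(4)[OF b'(1) b] by (auto simp: dir_def swle_def)
      then show "c \<in> lk ds cs ` ?A" using b' c by auto
    qed
    moreover have "card (lk ds cs ` ?A) = card ?A"
      by (rule card_image[OF inj_on_subset[OF l(2)]]) blast
    ultimately have "card ?A = card ?B" by argo
    also have "\<dots> = snd (lk ds cs b) - s (Suc ?i)" by simp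
    finally have "card ?A = snd (lk ds cs b) - s (Suc ?i)" .
    moreover have "s (Suc ?i) < snd (lk ds cs b)" using bC by (auto simp: C)
    ultimately show ?thesis by simp
  qed
  show "inj_on ?\<Phi> (pictures ds C)"
  proof (rule inj_onI)
    fix cs cs' assume a: "cs \<in> pictures ds C" "cs' \<in> pictures ds C" "?\<Phi> cs = ?\<Phi> cs'"
    have len: "length ds = length cs" "length ds = length cs'" using a(1,2) by (auto simp: pictures_def dest: pic_length)
    have f: "fst (lk ds cs b) = fst (lk ds cs' b)" if "b \<in> ?D" for b
      using fun_cong[OF a(3), of b] that by simp
    have "lk ds cs b = lk ds cs' b" if b: "b \<in> ?D" for b
    proof -
      have "{b' \<in> ?D. fst (lk ds cs b') = fst (lk ds cs b) \<and> snd b \<le> snd b'} =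
          {b' \<in> ?D. fst (lk ds cs' b') = fst (lk ds cs' b) \<and> snd b \<le> snd b'}" using f b by auto
      then have "snd (lk ds cs b) = snd (lk ds cs' b)"
        unfolding column[OF a(1) b] column[OF a(2) b] f[OF b] by (simp only:)
      moreover note f[OF b]
      ultimately show ?thesis by (simp add: prod_eq_iff)
    qed
    then have "map (lk ds cs) ds = map (lk ds cs') ds" by simp
    then show "cs = cs'" using map_lk[OF dist] len by metis
  qed
  show "?\<Phi> ` pictures ds C = ssyts ?D k"
  proof (intro equalityI subsetI)
    fix T assume "T \<in> ?\<Phi> ` pictures ds C"
    then obtain cs where cs: "cs \<in> pictures ds C" "T = ?\<Phi> cs" by blast
    have P: "pic ds cs" and setcs: "set cs = C" using cs by (auto simp: pictures_def)
    note l = pic_lk[OF ds P]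
    have Tb: "T b = fst (lk ds cs b)" if "b \<in> ?D" for b using that cs(2) by simp
    have pos: "1 \<le> fst (lk ds cs b)" if "b \<in> ?D" for b
    proof -
      have "lk ds cs b \<in> C" using l(1) that setcs by blast
      then show ?thesis by (auto simp: C)
    qed
    have "shape T = ?D" unfolding shape_def using pos cs(2) by force
    moreover have "T (i, j) \<le> T (i, j')" if "(i, j) \<in> ?D" "(i, j') \<in> ?D" "j < j'" for i j j'
      using l(3)[OF that(1,2)] that by (simp add: Tb dir_def nwle_def swle_def)
    moreover have "T (i, j) < T (i', j)" if "(i, j) \<in> ?D" "(i', j) \<in> ?D" "i < i'" for i i' j
      using l(3)[OF that(1,2)] that by (simp add: Tb dir_def nwle_def swle_def)
    moreover have "card {b \<in> ?D. T b = i} = k i" if i: "1 \<le> i" for i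
    proof -
      have "lk ds cs ` {b \<in> ?D. T b = i} = {c \<in> C. fst c = i}"
        unfolding setcs[symmetric] l(1)[symmetric] using Tb by (force simp del: split_paired_All)
      also have "\<dots> = {i} \<times> {s (Suc i)<..s i}" using i by (auto simp: C)
      finally have "lk ds cs ` {b \<in> ?D. T b = i} = {i} \<times> {s (Suc i)<..s i}" .
      moreover have "card (lk ds cs ` {b \<in> ?D. T b = i}) = card {b \<in> ?D. T b = i}"
        by (rule card_image[OF inj_on_subset[OF l(2)]]) blast
      ultimately have "card {b \<in> ?D. T b = i} = card ({i} \<times> {s (Suc i)<..s i})" by argo
      then show ?thesis using s[of i] by simp
    qed
    ultimately show "T \<in> ssyts ?D k" unfolding ssyts_def semistandard_tableau_def by blast
  next
    fix T assume T: "T \<in> ssyts ?D k"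
    \<comment> \<open>The rank found above, now used to build the picture: the number of equal
      entries weakly to the right. Equal entries occupy distinct columns, so ranks separate
      them.\<close>
    define rk where "rk b = card {b' \<in> ?D. T b' = T b \<and> snd b \<le> snd b'}" for b
    define g where "g b = (T b, s (Suc (T b)) + rk b)" for b
    have cv: "conv ?D" using ds by (simp add: sdom_def)
    have pos: "1 \<le> T b" if "b \<in> ?D" for b
    proof -
      have "shape T = ?D" using T by (simp add: ssyts_def semistandard_tableau_def)
      then have "T b \<noteq> 0" using that unfolding shape_def by blast
      then show ?thesis by simp
    qed
    have row: "T (i, j) \<le> T (i, j')" if "(i, j) \<in> ?D" "(i, j') \<in> ?D" "j \<le> j'" for i j j'
    proof (cases "j = j'")
      case False
      then show ?thesis using T that unfolding ssyts_def semistandard_tableau_def by (simp add: le_neq_implies_less)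
    qed simp
    have col: "T (i, j) < T (i', j)" if "(i, j) \<in> ?D" "(i', j) \<in> ?D" "i < i'" for i i' j
      using T that unfolding ssyts_def semistandard_tableau_def by blast
    have cnt: "card {b \<in> ?D. T b = i} = k i" if "1 \<le> i" for i using T that unfolding ssyts_def by blast
    have mono: "T b \<le> T b' \<and> (fst b < fst b' \<longrightarrow> T b < T b')" if "b \<in> ?D" "b' \<in> ?D" "nwle b b'" for b b'
    proof -
      have m: "(fst b, snd b') \<in> ?D"
        by (rule convD[OF cv that(1,2)]) (use that(3) in \<open>auto simp: nwle_def\<close>)
      have 1: "T b \<le> T (fst b, snd b')" using row[of "fst b" "snd b" "snd b'"] m that by (simp add: nwle_def)
      show ?thesis
      proof (cases "fst b < fst b'")
        case True
        then show ?thesis using 1 col[of "fst b" "snd b'" "fst b'"] m that by simp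
      next
        case False
        then have "fst b = fst b'" using that(3) by (simp add: nwle_def)
        then show ?thesis using 1 by simp
      qed
    qed
    have rk_mono: "rk b' < rk b" if b: "b \<in> ?D" "b' \<in> ?D" and e: "T b = T b'" "snd b < snd b'" for b b'
      unfolding rk_def
    proof (rule psubset_card_mono)
      show "{x \<in> ?D. T x = T b' \<and> snd b' \<le> snd x} \<subset> {x \<in> ?D. T x = T b \<and> snd b \<le> snd x}"
      proof
        show "{x \<in> ?D. T x = T b' \<and> snd b' \<le> snd x} \<subseteq> {x \<in> ?D. T x = T b \<and> snd b \<le> snd x}"
          using e by auto
        have "b \<notin> {x \<in> ?D. T x = T b' \<and> snd b' \<le> snd x}" "b \<in> {x \<in> ?D. T x = T b \<and> snd b \<le> snd x}"
          using b e by auto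
        then show "{x \<in> ?D. T x = T b' \<and> snd b' \<le> snd x} \<noteq> {x \<in> ?D. T x = T b \<and> snd b \<le> snd x}" by blast
      qed
    qed simp
    have same_col: "b = b'" if "b \<in> ?D" "b' \<in> ?D" "T b = T b'" "snd b = snd b'" for b b'
    proof (rule ccontr)
      assume "b \<noteq> b'"
      then have "fst b < fst b' \<or> fst b' < fst b" using that(4) by (auto simp: prod_eq_iff)
      then show False
        using mono[OF that(1,2)] mono[OF that(2,1)] that(3,4) by (auto simp: nwle_def)
    qed
    have rk_le: "rk b \<le> k (T b)" "1 \<le> rk b" if "b \<in> ?D" for b
    proof -
      have "rk b \<le> card {b' \<in> ?D. T b' = T b}" unfolding rk_def by (rule card_mono) auto
      then show "rk b \<le> k (T b)" using cnt[OF pos[OF that]] by simp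
      have "{b} \<subseteq> {b' \<in> ?D. T b' = T b \<and> snd b \<le> snd b'}" using that by auto
      then have "card {b} \<le> rk b" unfolding rk_def by (rule card_mono[rotated]) simp
      then show "1 \<le> rk b" by simp
    qed
    have gC: "g b \<in> C" if "b \<in> ?D" for b
      using rk_le[OF that] pos[OF that] s[of "T b"] by (simp add: g_def C)
    \<comment> \<open>This is where the rows of \<open>C\<close> must recede to the left: a larger
      entry has to land strictly to the left.\<close>
    have sep: "snd (g b') < snd (g b)" if "b \<in> ?D" "b' \<in> ?D" "T b < T b'" for b b'
    proof -
      have "snd (g b') \<le> s (T b')" using gC[OF that(2)] by (simp add: C g_def)
      also have "\<dots> \<le> s (Suc (T b))" by (rule anti) (use that(3) in simp)
      also have "\<dots> < snd (g b)" using gC[OF that(1)] by (simp add: C g_def)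
      finally show ?thesis .
    qed
    have d1: "dir b b' (g b) (g b')" if b: "b \<in> ?D" "b' \<in> ?D" for b b'
    proof (cases "nwle b b'")
      case True
      note m = mono[OF b True]
      show ?thesis
      proof (cases "T b = T b'")
        case True
        have "rk b' \<le> rk b" "snd b < snd b' \<Longrightarrow> rk b' < rk b"
          using rk_mono[OF b True] same_col[OF b True] \<open>nwle b b'\<close> by (cases "snd b = snd b'"; auto simp: nwle_def)+
        then show ?thesis using m True unfolding dir_def swle_def g_def by auto
      next
        case False
        then have "T b < T b'" using m by simp
        then show ?thesis using sep[OF b] unfolding dir_def swle_def by (auto simp: g_def)
      qed
    qed (simp add: dir_def)
    have d2: "dir (g b) (g b') b b'" if b: "b \<in> ?D" "b' \<in> ?D" for b b'
    proof (cases "nwle (g b) (g b')")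
      case True
      then have le: "T b \<le> T b'" "snd (g b) \<le> snd (g b')" by (simp_all add: nwle_def g_def)
      then have e: "T b = T b'" using sep[OF b] by (metis le_neq_implies_less not_less)
      then have r: "rk b \<le> rk b'" using le(2) by (simp add: g_def)
      have sn: "snd b' \<le> snd b" using rk_mono[OF b e] r by (meson not_le)
      have fs: "fst b \<le> fst b'"
      proof (rule ccontr)
        assume "\<not> fst b \<le> fst b'"
        then show False using mono[OF b(2,1)] sn e by (auto simp: nwle_def)
      qed
      have "rk b < rk b' \<Longrightarrow> snd b' \<noteq> snd b" using same_col[OF b e] by auto
      then show ?thesis using sn fs e unfolding dir_def swle_def g_def by auto
    qed (simp add: dir_def)
    have z: "set (zip ds (map g ds)) = (\<lambda>b. (b, g b)) ` ?D" by (simp add: zip_map2 zip_same_conv_map)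
    have P: "pic ds (map g ds)" unfolding pic_zip z using d1 d2 by simp
    have "g ` ?D = C"
    proof (intro equalityI subsetI)
      fix c assume "c \<in> C"
      then obtain i j where c: "c = (i, j)" and ij: "1 \<le> i" "s (Suc i) < j" "j \<le> s i" by (auto simp: C)
      let ?R = "{b \<in> ?D. T b = i}"
      have inj: "inj_on rk ?R"
      proof (rule inj_onI)
        fix x y assume "x \<in> ?R" "y \<in> ?R" "rk x = rk y"
        then have xy: "x \<in> ?D" "y \<in> ?D" "T x = T y" "rk x = rk y" by auto
        have "\<not> snd x < snd y" using rk_mono[OF xy(1,2,3)] xy(4) by auto
        moreover have "\<not> snd y < snd x" using rk_mono[OF xy(2,1) xy(3)[symmetric]] xy(4) by auto
        ultimately show "x = y" using same_col[OF xy(1,2,3)] by linarith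
      qed
      have "rk ` ?R \<subseteq> {1..k i}" using rk_le by auto
      moreover have "card (rk ` ?R) = card {1..k i}" using card_image[OF inj] cnt[OF ij(1)] by simp
      ultimately have "rk ` ?R = {1..k i}" by (intro card_subset_eq) auto
      moreover have "j - s (Suc i) \<in> {1..k i}" using ij s[of i] by auto
      ultimately have "j - s (Suc i) \<in> rk ` ?R" by argo
      then obtain b where "b \<in> ?D" "T b = i" "rk b = j - s (Suc i)" by auto
      then have "g b = c" "b \<in> ?D" using ij(2) by (auto simp: g_def c)
      then show "c \<in> g ` ?D" by blast
    qed (use gC in blast)
    then have "map g ds \<in> pictures ds C" using P by (simp add: pictures_def)
    moreover have "T = ?\<Phi> (map g ds)"
    proof
      fix b
      show "T b = ?\<Phi> (map g ds) b"
      proof (cases "b \<in> ?D")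
        case True
        have "(b, lk ds (map g ds) b) \<in> set (zip ds (map g ds))" by (rule lk_zip) (use True in simp_all)
        then have "lk ds (map g ds) b = g b" unfolding z by auto
        then show ?thesis using True by (simp add: g_def)
      next
        case False
        have "shape T = ?D" using T by (simp add: ssyts_def semistandard_tableau_def)
        then have "T b = 0" using False unfolding shape_def by blast
        then show ?thesis using False by simp
      qed
    qed
    ultimately show "T \<in> ?\<Phi> ` pictures ds C" by blast
  qed
qed

lemma row_partition:
  assumes "\<And>i j. i \<le> j \<Longrightarrow> s j \<le> s i" "\<And>i. n < i \<Longrightarrow> s i = (0 :: nat)"
  obtains \<nu> where "boxes \<nu> = {(i, j). 1 \<le> i \<and> 1 \<le> j \<and> j \<le> s i}"
proof (rule partition_of_set[of "{(i, j). 1 \<le> i \<and> 1 \<le> j \<and> j \<le> s i}"])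
  have "{(i, j). 1 \<le> i \<and> 1 \<le> j \<and> j \<le> s i} \<subseteq> {..n} \<times> {..s 0}"
    using assms(1)[of 0] assms(2) by (auto intro: order_trans leI)
  then show "finite {(i, j). 1 \<le> i \<and> 1 \<le> j \<and> j \<le> s i}" by (rule finite_subset) simp
  show "a \<in> {(i, j). 1 \<le> i \<and> 1 \<le> j \<and> j \<le> s i}"
    if "b \<in> {(i, j). 1 \<le> i \<and> 1 \<le> j \<and> j \<le> s i}" "nwle a b" "1 \<le> fst a" "1 \<le> snd a" for a b
    using that assms(1)[of "fst a" "fst b"] by (cases a; cases b) (auto simp: nwle_def)
qed auto

text \<open>Tableaux of content \<open>k\<close> are pictures onto a skew shape made of disjoint
  rows, the difference of two partitions with row lengths \<open>s i\<close> and
  \<open>s (Suc i)\<close>; the bound \<open>n\<close> makes these finite. So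
  \<open>card_pictures_decompose\<close> applies. The second conclusion allows the bound
  \<open>\<nu>\<close> on the shapes to be removed afterwards.\<close>

lemma card_ssyts_decompose:
  assumes ds: "sdom ds" and k: "\<And>i. n < i \<Longrightarrow> k i = 0"
  obtains \<nu> where "card (ssyts (set ds) k) = (\<Sum>\<kappa> | \<kappa> \<le> \<nu>. card (pictures ds (boxes \<kappa>)) * card (ssyts (boxes \<kappa>) k))"
    "\<And>\<kappa>. \<not> \<kappa> \<le> \<nu> \<Longrightarrow> ssyts (boxes \<kappa>) k = {}"
proof -
  define s where "s i = (\<Sum>l = i..n. k l)" for i
  have s: "s i = k i + s (Suc i)" for i
  proof (cases "i \<le> n")
    case True then show ?thesis unfolding s_def by (rule sum.atLeast_Suc_atMost)
  qed (simp add: s_def k)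
  have anti: "s j \<le> s i" if "i \<le> j" for i j
    unfolding s_def by (rule sum_mono2) (use that in auto)
  have zero: "s i = 0" if "n < i" for i using that by (simp add: s_def)
  obtain \<nu> where \<nu>: "boxes \<nu> = {(i, j). 1 \<le> i \<and> 1 \<le> j \<and> j \<le> s i}"
    by (rule row_partition[of s n]) (use anti zero in auto)
  obtain \<mu> where \<mu>: "boxes \<mu> = {(i, j). 1 \<le> i \<and> 1 \<le> j \<and> j \<le> s (Suc i)}"
    by (rule row_partition[of "\<lambda>i. s (Suc i)" n]) (use anti zero in auto)
  have le: "\<mu> \<le> \<nu>" unfolding partition_le_iff \<nu> \<mu> using anti by (auto intro: order_trans)
  have C: "skew \<nu> \<mu> = {(i, j). 1 \<le> i \<and> s (Suc i) < j \<and> j \<le> s i}" unfolding skew_def \<nu> \<mu> by auto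
  have c: "card (ssyts (set ds) k) = card (pictures ds (skew \<nu> \<mu>))" if "sdom ds" for ds
    using bij_betw_same_card[OF bij_betw_pictures_ssyts[OF that s C]] by simp
  have cl: "card (ssyts (boxes \<kappa>) k) = card (pictures (dl \<kappa> \<emptyset>) (skew \<nu> \<mu>))" for \<kappa>
    using c[OF sdom_rls_skew[of \<kappa> \<emptyset>]] by simp
  show ?thesis
  proof
    show "card (ssyts (set ds) k) = (\<Sum>\<kappa> | \<kappa> \<le> \<nu>. card (pictures ds (boxes \<kappa>)) * card (ssyts (boxes \<kappa>) k))"
      unfolding c[OF ds] cl by (rule card_pictures_decompose[OF ds le])
    show "ssyts (boxes \<kappa>) k = {}" if "\<not> \<kappa> \<le> \<nu>" for \<kappa>
    proof -
      have "card (pictures (dl \<kappa> \<emptyset>) (skew \<nu> \<mu>)) = 0" using card_pictures_swap[OF le, of \<kappa>] that by simp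
      then have "pictures (dl \<kappa> \<emptyset>) (skew \<nu> \<mu>) = {}" using finite_pictures[of "skew \<nu> \<mu>"] by simp
      then show ?thesis
        using bij_betw_pictures_ssyts[OF sdom_rls_skew[of \<kappa> \<emptyset>] s C] by (simp add: bij_betw_def)
    qed
  qed
qed

lemma card_filter_star:
  fixes i :: nat
  shows "card {b \<in> set (star \<beta> \<alpha>). T b = i} =
    card {b \<in> boxes \<beta>. T (shiftR \<alpha> b) = i} + card {b \<in> boxes \<alpha>. T (shiftD \<beta> b) = i}"
proof -
  have "{b \<in> set (star \<beta> \<alpha>). T b = i} =
      shiftR \<alpha> ` {b \<in> boxes \<beta>. T (shiftR \<alpha> b) = i} \<union> shiftD \<beta> ` {b \<in> boxes \<alpha>. T (shiftD \<beta> b) = i}"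
    unfolding set_star by auto
  moreover have "shiftR \<alpha> ` {b \<in> boxes \<beta>. T (shiftR \<alpha> b) = i} \<inter> shiftD \<beta> ` {b \<in> boxes \<alpha>. T (shiftD \<beta> b) = i} = {}"
    using shift_sep(1)[of _ \<beta> _ \<alpha>] by fastforce
  ultimately show ?thesis
    by (simp add: card_Un_disjoint card_image inj_shift)
qed

text \<open>The two parts of the star share neither rows nor columns, so the tableau conditions on
  them are independent and the contents add up.\<close>

lemma bij_betw_ssyts_star:
  "bij_betw (\<lambda>T. (\<lambda>b. if b \<in> boxes \<alpha> then T (shiftD \<beta> b) else 0, \<lambda>b. if b \<in> boxes \<beta> then T (shiftR \<alpha> b) else 0))
    (ssyts (set (star \<beta> \<alpha>)) k)
    {(Q, P). semistandard_tableau (boxes \<alpha>) Q \<and> semistandard_tableau (boxes \<beta>) P \<and>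
      (\<forall>i\<ge>1. card {b \<in> boxes \<alpha>. Q b = i} + card {b \<in> boxes \<beta>. P b = i} = k i)}"
  (is "bij_betw ?f ?A ?B")
proof -
  define g :: "filling \<times> filling \<Rightarrow> filling" where "g = (\<lambda>(Q, P) b.
     if b \<in> shiftR \<alpha> ` boxes \<beta> then P (the_inv_into (boxes \<beta>) (shiftR \<alpha>) b)
     else if b \<in> shiftD \<beta> ` boxes \<alpha> then Q (the_inv_into (boxes \<alpha>) (shiftD \<beta>) b) else 0)"
  have gR: "g (Q, P) (shiftR \<alpha> b) = P b" if "b \<in> boxes \<beta>" for Q P b
    using that by (simp add: g_def the_inv_into_f_f inj_shift)
  have gD: "g (Q, P) (shiftD \<beta> b) = Q b" if "b \<in> boxes \<alpha>" for Q P b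
  proof -
    have "shiftD \<beta> b \<notin> shiftR \<alpha> ` boxes \<beta>" using shift_sep(1)[OF _ that, of _ \<beta>] by fastforce
    then show ?thesis using that by (simp add: g_def the_inv_into_f_f inj_shift)
  qed
  have g0: "g x b = 0" if "b \<notin> set (star \<beta> \<alpha>)" for x b
    using that by (auto simp: g_def set_star split: prod.splits)
  have shR: "shiftR \<alpha> (i, j) = (i, j + Max (insert 0 (snd ` boxes \<alpha>)))" for i j by (simp add: shiftR_def)
  have shD: "shiftD \<beta> (i, j) = (i + Max (insert 0 (fst ` boxes \<beta>)), j)" for i j by (simp add: shiftD_def)
  have fw: "?f T \<in> ?B \<and> g (?f T) = T" if T: "T \<in> ?A" for T
  proof -
    have sh: "T b \<noteq> 0 \<longleftrightarrow> b \<in> set (star \<beta> \<alpha>)" for b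
      using T by (auto simp: ssyts_def semistandard_tableau_def shape_def)
    have rows: "T (i, j) \<le> T (i, j')" if "(i, j) \<in> set (star \<beta> \<alpha>)" "(i, j') \<in> set (star \<beta> \<alpha>)" "j < j'" for i j j'
      using T that unfolding ssyts_def semistandard_tableau_def by blast
    have cols: "T (i, j) < T (i', j)" if "(i, j) \<in> set (star \<beta> \<alpha>)" "(i', j) \<in> set (star \<beta> \<alpha>)" "i < i'" for i i' j
      using T that unfolding ssyts_def semistandard_tableau_def by blast
    have inR: "shiftR \<alpha> b \<in> set (star \<beta> \<alpha>)" if "b \<in> boxes \<beta>" for b using that by (simp add: set_star)
    have inD: "shiftD \<beta> b \<in> set (star \<beta> \<alpha>)" if "b \<in> boxes \<alpha>" for b using that by (simp add: set_star)
    have rD: "(i, j) \<in> boxes \<alpha> \<Longrightarrow> (i, j') \<in> boxes \<alpha> \<Longrightarrow> j < j' \<Longrightarrow> T (shiftD \<beta> (i, j)) \<le> T (shiftD \<beta> (i, j'))"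
      "(i, j) \<in> boxes \<alpha> \<Longrightarrow> (i', j) \<in> boxes \<alpha> \<Longrightarrow> i < i' \<Longrightarrow> T (shiftD \<beta> (i, j)) < T (shiftD \<beta> (i', j))" for i i' j j'
      using rows cols inD[of "(i, j)"] inD[of "(i, j')"] inD[of "(i', j)"] by (simp_all add: shD)
    have rR: "(i, j) \<in> boxes \<beta> \<Longrightarrow> (i, j') \<in> boxes \<beta> \<Longrightarrow> j < j' \<Longrightarrow> T (shiftR \<alpha> (i, j)) \<le> T (shiftR \<alpha> (i, j'))"
      "(i, j) \<in> boxes \<beta> \<Longrightarrow> (i', j) \<in> boxes \<beta> \<Longrightarrow> i < i' \<Longrightarrow> T (shiftR \<alpha> (i, j)) < T (shiftR \<alpha> (i', j))" for i i' j j'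
      using rows cols inR[of "(i, j)"] inR[of "(i, j')"] inR[of "(i', j)"] by (simp_all add: shR)
    have 1: "semistandard_tableau (boxes \<alpha>) (fst (?f T))"
      unfolding semistandard_tableau_def shape_def
      using sh inD rD by auto
    have 2: "semistandard_tableau (boxes \<beta>) (snd (?f T))"
      unfolding semistandard_tableau_def shape_def
      using sh inR rR by auto
    have 3: "card {b \<in> boxes \<alpha>. fst (?f T) b = i} + card {b \<in> boxes \<beta>. snd (?f T) b = i} = k i" if "1 \<le> i" for i
    proof -
      have "card {b \<in> set (star \<beta> \<alpha>). T b = i} = k i" using T that by (simp add: ssyts_def)
      moreover have "{b \<in> boxes \<alpha>. fst (?f T) b = i} = {b \<in> boxes \<alpha>. T (shiftD \<beta> b) = i}"
        "{b \<in> boxes \<beta>. snd (?f T) b = i} = {b \<in> boxes \<beta>. T (shiftR \<alpha> b) = i}" by auto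
      ultimately show ?thesis unfolding card_filter_star by simp
    qed
    have "g (?f T) b = T b" for b
    proof (cases "b \<in> set (star \<beta> \<alpha>)")
      case True
      then show ?thesis unfolding set_star by (auto simp: gR gD)
    next
      case False
      then have "T b = 0" using sh[of b] by blast
      then show ?thesis using g0[OF False] by simp
    qed
    then have "g (?f T) = T" by blast
    then show ?thesis using 1 2 3 by simp
  qed
  have bw: "g x \<in> ?A \<and> ?f (g x) = x" if x: "x \<in> ?B" for x
  proof -
    obtain Q P where xe: "x = (Q, P)" by (cases x)
    have Q: "semistandard_tableau (boxes \<alpha>) Q" and P: "semistandard_tableau (boxes \<beta>) P"
      and k: "\<And>i. 1 \<le> i \<Longrightarrow> card {b \<in> boxes \<alpha>. Q b = i} + card {b \<in> boxes \<beta>. P b = i} = k i"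
      using x xe by auto
    have Qs: "Q b \<noteq> 0 \<longleftrightarrow> b \<in> boxes \<alpha>" and Ps: "P b \<noteq> 0 \<longleftrightarrow> b \<in> boxes \<beta>" for b
      using Q P by (auto simp: semistandard_tableau_def shape_def)
    have "shape (g x) = set (star \<beta> \<alpha>)"
    proof (rule set_eqI)
      fix b show "b \<in> shape (g x) \<longleftrightarrow> b \<in> set (star \<beta> \<alpha>)"
      proof (cases "b \<in> set (star \<beta> \<alpha>)")
        case True
        then show ?thesis unfolding set_star shape_def xe using Qs Ps by (auto simp: gR gD)
      qed (simp add: shape_def g0)
    qed
    moreover have "g x (i, j) \<le> g x (i, j')"
      if m: "(i, j) \<in> set (star \<beta> \<alpha>)" "(i, j') \<in> set (star \<beta> \<alpha>)" "j < j'" for i j j'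
    proof -
      consider p q where "p \<in> boxes \<beta>" "q \<in> boxes \<beta>" "(i, j) = shiftR \<alpha> p" "(i, j') = shiftR \<alpha> q"
        | p q where "p \<in> boxes \<alpha>" "q \<in> boxes \<alpha>" "(i, j) = shiftD \<beta> p" "(i, j') = shiftD \<beta> q"
        using m(1,2) shift_sep(1)[of _ \<beta> _ \<alpha>] unfolding set_star by (metis (no_types, lifting) UnE fst_conv imageE less_irrefl)
      then show ?thesis
      proof cases
        case 1
        have "P p \<le> P q" using P 1 m(3) unfolding semistandard_tableau_def
          by (cases p; cases q) (auto simp: shR)
        then show ?thesis using 1 by (simp add: xe gR)
      next
        case 2
        have "Q p \<le> Q q" using Q 2 m(3) unfolding semistandard_tableau_def
          by (cases p; cases q) (auto simp: shD)
        then show ?thesis using 2 by (simp add: xe gD)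
      qed
    qed
    moreover have "g x (i, j) < g x (i', j)"
      if m: "(i, j) \<in> set (star \<beta> \<alpha>)" "(i', j) \<in> set (star \<beta> \<alpha>)" "i < i'" for i i' j
    proof -
      consider p q where "p \<in> boxes \<beta>" "q \<in> boxes \<beta>" "(i, j) = shiftR \<alpha> p" "(i', j) = shiftR \<alpha> q"
        | p q where "p \<in> boxes \<alpha>" "q \<in> boxes \<alpha>" "(i, j) = shiftD \<beta> p" "(i', j) = shiftD \<beta> q"
        using m(1,2) shift_sep(2)[of _ \<beta> _ \<alpha>] unfolding set_star by (metis (no_types, lifting) UnE snd_conv imageE less_irrefl)
      then show ?thesis
      proof cases
        case 1
        have "P p < P q" using P 1 m(3) unfolding semistandard_tableau_def
          by (cases p; cases q) (auto simp: shR)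
        then show ?thesis using 1 by (simp add: xe gR)
      next
        case 2
        have "Q p < Q q" using Q 2 m(3) unfolding semistandard_tableau_def
          by (cases p; cases q) (auto simp: shD)
        then show ?thesis using 2 by (simp add: xe gD)
      qed
    qed
    moreover have "card {b \<in> set (star \<beta> \<alpha>). g x b = i} = k i" if "1 \<le> i" for i
    proof -
      have "{b \<in> boxes \<beta>. g x (shiftR \<alpha> b) = i} = {b \<in> boxes \<beta>. P b = i}"
        "{b \<in> boxes \<alpha>. g x (shiftD \<beta> b) = i} = {b \<in> boxes \<alpha>. Q b = i}" by (auto simp: xe gR gD)
      then show ?thesis unfolding card_filter_star using k[OF that] by simp
    qed
    ultimately have "g x \<in> ?A" unfolding ssyts_def semistandard_tableau_def by blast
    moreover have "?f (g x) = x"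
    proof -
      have "(\<lambda>b. if b \<in> boxes \<alpha> then g x (shiftD \<beta> b) else 0) = Q" using Qs by (auto simp: xe gD fun_eq_iff)
      moreover have "(\<lambda>b. if b \<in> boxes \<beta> then g x (shiftR \<alpha> b) else 0) = P" using Ps by (auto simp: xe gR fun_eq_iff)
      ultimately show ?thesis unfolding xe by simp
    qed
    ultimately show ?thesis by blast
  qed
  show ?thesis
  proof (rule bij_betw_byWitness[where f' = g])
    show "\<forall>T \<in> ?A. g (?f T) = T" using fw by blast
    show "\<forall>x \<in> ?B. ?f (g x) = x" using bw by blast
    show "?f ` ?A \<subseteq> ?B" using fw by blast
    show "g ` ?B \<subseteq> ?A" using bw by blast
  qed
qed

section \<open>The Littlewood--Richardson rule\<close>

lemma pictures_distinct: "ss \<in> pictures (dl \<beta> \<gamma>) C \<Longrightarrow> distinct ss"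
  unfolding pictures_def using pic_distinct[OF sdom_rls_skew] by blast

definition LR :: "partition \<Rightarrow> partition \<Rightarrow> (partition \<times> box list) set" where
  "LR \<alpha> \<beta> = {(\<mu>, es). \<beta> \<le> \<mu> \<and> es \<in> pictures (dl \<alpha> \<emptyset>) (skew \<mu> \<beta>)}"

lemma bij_betw_LR: "bij_betw (\<lambda>(\<mu>, es). (\<mu>, fill es)) (LR \<alpha> \<beta>) {(\<mu>, T). \<beta> \<le> \<mu> \<and> T \<in> RW \<mu> \<beta> \<alpha> \<emptyset>}"
  (is "bij_betw ?f ?A ?B")
  unfolding bij_betw_def
proof
  show "inj_on ?f ?A"
    by (rule inj_onI) (auto simp: LR_def intro: fill_inj dest!: pictures_distinct simp del: skew_bot)
  show "?f ` ?A = ?B"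
    unfolding set_eq_iff
    using bij_betw_imp_surj_on[OF bij_betw_fill_RW, of \<alpha> \<emptyset> _ \<beta>]
    by (fastforce simp: LR_def image_iff set_eq_iff simp del: skew_bot)
qed

lemma finite_LR: "finite (LR \<alpha> \<beta>)"
  using bij_betw_finite[OF bij_betw_LR] finite_RW_pairs by blast

lemma lookup_weight:
  assumes "finite (shape T)"
  shows "Poly_Mapping.lookup (weight v T) w = card {b \<in> shape T. v (T b) = w}"
proof -
  have "Poly_Mapping.lookup (weight v T) w = (\<Sum>b \<in> shape T. if v (T b) = w then 1 else 0)"
    unfolding weight_def lookup_sum by (rule sum.cong) (auto simp: lookup_single when_def)
  also have "\<dots> = card {b \<in> shape T. v (T b) = w}"
    using assms by (simp add: sum.If_cases Int_def)
  finally show ?thesis .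
qed

lemma mcoeff_sum: "mcoeff (sum f A) m = (\<Sum>a \<in> A. mcoeff (f a) m)"
  by (induction A rule: infinite_finite_induct) (simp_all add: zero_pseries.rep_eq plus_pseries.rep_eq)

lemma card_weight_pairs:
  assumes "inj v"
  shows "mcoeff (schur v \<alpha> * schur v \<beta>) m =
    int (card {(Q, P). semistandard_tableau (boxes \<alpha>) Q \<and> semistandard_tableau (boxes \<beta>) P \<and> weight v Q + weight v P = m})"
proof -
  let ?A = "\<lambda>\<alpha> a. {T. semistandard_tableau (boxes \<alpha>) T \<and> weight v T = a}"
  let ?F = "{(a, b). a + b = m}"
  let ?S = "Sigma ?F (\<lambda>(a, b). ?A \<alpha> a \<times> ?A \<beta> b)"
  have fin: "finite (?A \<alpha> a)" for \<alpha> a by (rule finite_semistandard_weight[OF assms])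
  have "mcoeff (schur v \<alpha> * schur v \<beta>) m = (\<Sum>p \<in> ?F. int (card (?A \<alpha> (fst p)) * card (?A \<beta> (snd p))))"
    by (simp add: times_pseries.rep_eq schur.rep_eq case_prod_unfold)
  also have "\<dots> = int (card ?S)"
    using fin finite_monomial_factorizations[of m]
    by (subst card_SigmaI) (simp_all add: card_cartesian_product case_prod_unfold)
  also have "card ?S = card {(Q, P). semistandard_tableau (boxes \<alpha>) Q \<and> semistandard_tableau (boxes \<beta>) P \<and> weight v Q + weight v P = m}"
    by (rule bij_betw_same_card[of snd],
        rule bij_betw_byWitness[where f' = "\<lambda>(Q, P). ((weight v Q, weight v P), (Q, P))"]) auto
  finally show ?thesis .
qed

text \<open>Comparing coefficients, a pair of tableaux is one tableau on
  \<open>star \<beta> \<alpha>\<close>. Decomposing this domain into straight shapes, the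
  multiplicity of \<open>\<kappa>\<close> is the number of pictures of the star onto
  \<open>\<kappa>\<close>, which \<open>card_pictures_star\<close> evaluates.\<close>

lemma LR_rule:
  assumes v: "inj v"
  shows "schur v \<alpha> * schur v \<beta> = (\<Sum>(\<mu>, es) \<in> LR \<alpha> \<beta>. schur v \<mu>)"
proof (rule mcoeff_inject[THEN iffD1], rule ext)
  fix m
  let ?P = "{(Q, P). semistandard_tableau (boxes \<alpha>) Q \<and> semistandard_tableau (boxes \<beta>) P \<and> weight v Q + weight v P = m}"
  let ?T = "\<lambda>\<mu>. {T. semistandard_tableau (boxes \<mu>) T \<and> weight v T = m}"
  let ?c = "\<lambda>D T w. card {b \<in> D. v (T b) = w}"
  have wt: "weight v T = m \<longleftrightarrow> (\<forall>w. ?c (boxes \<mu>) T w = Poly_Mapping.lookup m w)" if "semistandard_tableau (boxes \<mu>) T" for \<mu> T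
    using that lookup_weight[of T v] by (auto simp: semistandard_tableau_def poly_mapping_eq_iff fun_eq_iff)
  have wt2: "weight v Q + weight v P = m \<longleftrightarrow> (\<forall>w. ?c (boxes \<alpha>) Q w + ?c (boxes \<beta>) P w = Poly_Mapping.lookup m w)"
    if "semistandard_tableau (boxes \<alpha>) Q" "semistandard_tableau (boxes \<beta>) P" for Q P
    using that lookup_weight[of Q v] lookup_weight[of P v]
    by (auto simp: semistandard_tableau_def poly_mapping_eq_iff fun_eq_iff lookup_add)
  have c0: "?c (boxes \<mu>) T w = 0" if "semistandard_tableau (boxes \<mu>) T" "w \<notin> v ` {1..}" for \<mu> T w
  proof -
    have "1 \<le> T b" if "b \<in> boxes \<mu>" for b
      using \<open>semistandard_tableau (boxes \<mu>) T\<close> that by (auto simp: semistandard_tableau_def shape_def Suc_le_eq)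
    then have "{b \<in> boxes \<mu>. v (T b) = w} = {}" using that(2) by auto
    then show ?thesis by simp
  qed
  have "card ?P = (\<Sum>(\<mu>, es) \<in> LR \<alpha> \<beta>. card (?T \<mu>))"
  proof (cases "\<forall>w. w \<notin> v ` {1..} \<longrightarrow> Poly_Mapping.lookup m w = 0")
    \<comment> \<open>A monomial with a variable outside the image of \<open>{1..}\<close> under
      \<open>v\<close> has coefficient 0 on both sides, since entries of tableaux are
      positive.\<close>
    case False
    then obtain w where w: "w \<notin> v ` {1..}" "Poly_Mapping.lookup m w \<noteq> 0" by blast
    have "weight v T \<noteq> m" if st: "semistandard_tableau (boxes \<mu>) T" for \<mu> T
      using wt[OF st] c0[OF st w(1)] w(2) by metis
    then have eT: "?T \<mu> = {}" for \<mu> by blast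
    have "weight v Q + weight v P \<noteq> m"
      if st: "semistandard_tableau (boxes \<alpha>) Q" "semistandard_tableau (boxes \<beta>) P" for Q P
      
    proof
      assume "weight v Q + weight v P = m"
      then have "?c (boxes \<alpha>) Q w + ?c (boxes \<beta>) P w = Poly_Mapping.lookup m w" using wt2[OF st] by blast
      then show False using c0[OF st(1) w(1)] c0[OF st(2) w(1)] w(2) by simp
    qed
    then have eP: "?P = {}" by blast
    show ?thesis unfolding eT eP by (simp add: case_prod_unfold)
  next
    case True
    define k where "k i = Poly_Mapping.lookup m (v i)" for i
    have "finite {i. k i \<noteq> 0}"
    proof -
      have "{i. k i \<noteq> 0} = v -` Poly_Mapping.keys m" by (auto simp: k_def in_keys_iff)
      then show ?thesis using finite_vimageI[OF Poly_Mapping.finite_keys v] by simp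
    qed
    then obtain n where "\<forall>i \<in> {i. k i \<noteq> 0}. i \<le> n" using finite_nat_set_iff_bounded_le by blast
    then have n: "k i = 0" if "n < i" for i using that by (metis (mono_tags, lifting) mem_Collect_eq not_le)
    have split: "(\<forall>w. F w = Poly_Mapping.lookup m w) \<longleftrightarrow> (\<forall>i\<ge>1. F (v i) = k i)"
      if "\<And>w. w \<notin> v ` {1..} \<Longrightarrow> F w = 0" for F
    proof
      assume a: "\<forall>i\<ge>1. F (v i) = k i"
      show "\<forall>w. F w = Poly_Mapping.lookup m w"
      proof
        fix w show "F w = Poly_Mapping.lookup m w"
          using a that[of w] True by (cases "w \<in> v ` {1..}") (auto simp: k_def)
      qed
    qed (simp add: k_def)
    have T: "?T \<mu> = ssyts (boxes \<mu>) k" for \<mu>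
    proof (rule set_eqI)
      fix T
      show "T \<in> ?T \<mu> \<longleftrightarrow> T \<in> ssyts (boxes \<mu>) k"
      proof (cases "semistandard_tableau (boxes \<mu>) T")
        case st: True
        have "weight v T = m \<longleftrightarrow> (\<forall>i\<ge>1. card {b \<in> boxes \<mu>. T b = i} = k i)"
          unfolding wt[OF st] 
          by (subst split) (use c0[OF st] in \<open>simp_all add: inj_eq[OF v]\<close>)
        then show ?thesis using st by (simp add: ssyts_def)
      qed (simp add: ssyts_def)
    qed
    have P: "?P = {(Q, P). semistandard_tableau (boxes \<alpha>) Q \<and> semistandard_tableau (boxes \<beta>) P \<and>
      (\<forall>i\<ge>1. card {b \<in> boxes \<alpha>. Q b = i} + card {b \<in> boxes \<beta>. P b = i} = k i)}" (is "_ = ?P'")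
    proof (rule set_eqI)
      fix x :: "filling \<times> filling"
      obtain Q P where x: "x = (Q, P)" by (cases x)
      show "x \<in> ?P \<longleftrightarrow> x \<in> ?P'"
      proof (cases "semistandard_tableau (boxes \<alpha>) Q \<and> semistandard_tableau (boxes \<beta>) P")
        case st: True
        have "weight v Q + weight v P = m \<longleftrightarrow>
            (\<forall>i\<ge>1. card {b \<in> boxes \<alpha>. Q b = i} + card {b \<in> boxes \<beta>. P b = i} = k i)"
          unfolding wt2[OF conjunct1[OF st] conjunct2[OF st]]
          by (subst split) (use c0[OF conjunct1[OF st]] c0[OF conjunct2[OF st]] in \<open>simp_all add: inj_eq[OF v]\<close>)
        then show ?thesis using st by (simp add: x)
      qed (auto simp: x)
    qed
    obtain \<nu> where \<nu>: "card (ssyts (set (star \<beta> \<alpha>)) k) = (\<Sum>\<kappa> | \<kappa> \<le> \<nu>. card (pictures (star \<beta> \<alpha>) (boxes \<kappa>)) * card (ssyts (boxes \<kappa>) k))"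
      "\<And>\<kappa>. \<not> \<kappa> \<le> \<nu> \<Longrightarrow> ssyts (boxes \<kappa>) k = {}"
      by (rule card_ssyts_decompose[OF sdom_star[of \<beta> \<alpha>] n]) blast+
    have below: "\<kappa> \<le> \<nu>" if "card (ssyts (boxes \<kappa>) k) \<noteq> 0" for \<kappa>
      using \<nu>(2)[of \<kappa>] that by fastforce
    have "card ?P = card (ssyts (set (star \<beta> \<alpha>)) k)"
      unfolding P by (rule bij_betw_same_card[OF bij_betw_ssyts_star, symmetric])
    also have "\<dots> = (\<Sum>\<kappa> | \<kappa> \<le> \<nu>. (if \<beta> \<le> \<kappa> then card (pictures (dl \<alpha> \<emptyset>) (skew \<kappa> \<beta>)) else 0) * card (ssyts (boxes \<kappa>) k))"
      unfolding \<nu>(1) card_pictures_star ..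
    also have "\<dots> = (\<Sum>\<kappa> \<in> {\<kappa>. \<kappa> \<le> \<nu> \<and> \<beta> \<le> \<kappa>}. card (pictures (dl \<alpha> \<emptyset>) (skew \<kappa> \<beta>)) * card (ssyts (boxes \<kappa>) k))"
      by (rule sum.mono_neutral_cong_right) (auto simp: finite_below)
    also have "\<dots> = (\<Sum>\<kappa> \<in> {\<kappa>. \<kappa> \<le> \<nu> \<and> \<beta> \<le> \<kappa>}. \<Sum>es \<in> pictures (dl \<alpha> \<emptyset>) (skew \<kappa> \<beta>). card (ssyts (boxes \<kappa>) k))"
      by simp
    also have "\<dots> = (\<Sum>(\<mu>, es) \<in> Sigma {\<kappa>. \<kappa> \<le> \<nu> \<and> \<beta> \<le> \<kappa>} (\<lambda>\<kappa>. pictures (dl \<alpha> \<emptyset>) (skew \<kappa> \<beta>)). card (ssyts (boxes \<mu>) k))"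
      by (rule sum.Sigma) (auto intro: finite_pictures finite_subset[OF _ finite_below[of \<nu>]])
    \<comment> \<open>Shapes not contained in \<open>\<nu>\<close> carry no tableaux of this
      content, so the bound disappears.\<close>
    also have "\<dots> = (\<Sum>(\<mu>, es) \<in> LR \<alpha> \<beta>. card (ssyts (boxes \<mu>) k))"
      by (rule sum.mono_neutral_left[OF finite_LR]) (use below in \<open>auto simp: LR_def\<close>)
    finally show ?thesis unfolding T .
  qed
  then show "mcoeff (schur v \<alpha> * schur v \<beta>) m = mcoeff (\<Sum>(\<mu>, es) \<in> LR \<alpha> \<beta>. schur v \<mu>) m"
    unfolding card_weight_pairs[OF v] mcoeff_sum by (simp add: schur.rep_eq case_prod_unfold)
qed

section \<open>Decomposing sums over arrows\<close>

text \<open>The pairs (T_1, T_2) in which T_2 satisfies the row rule, recorded by the outcome of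
  their infusion. Then \<open>ss\<close> starts at the fixed shape \<open>\<beta>1\<close> and can
  be cut there, while the condition on T_2 becomes one on \<open>snd (infuse ss es)\<close>.\<close>

definition infused :: "int \<Rightarrow> partition \<Rightarrow> partition \<Rightarrow> partition \<Rightarrow> (partition \<times> partition \<times> box list \<times> box list) set" where
  "infused r \<alpha> \<beta>1 \<beta>2 = {(\<gamma>1, \<gamma>2, ss, es). \<beta>1 \<le> \<gamma>1 \<and> \<gamma>2 \<le> \<beta>2 \<and>
     (ss, es) \<in> pairs (dl \<beta>2 \<gamma>2) (dl \<alpha> \<emptyset>) (skew \<gamma>1 \<beta>1) \<and>
     filter (unsat r) (zip (dl \<beta>2 \<gamma>2) (snd (infuse ss es))) = []}"

definition reverse_infused :: "int \<Rightarrow> partition \<Rightarrow> partition \<Rightarrow> partition \<Rightarrow> (partition \<times> partition \<times> box list \<times> box list) set" where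
  "reverse_infused r \<alpha> \<beta>1 \<beta>2 = {(\<gamma>1, \<gamma>2, ss, es) \<in> infused r \<alpha> \<beta>1 \<beta>2. filter (sat r) (zip (dl \<beta>2 \<gamma>2) ss) = []}"

lemma pairs_pic: "(xs, ys) \<in> pairs dx dy C \<Longrightarrow> pic dx xs" "(xs, ys) \<in> pairs dx dy C \<Longrightarrow> pic dy ys"
  "(xs, ys) \<in> pairs dx dy C \<Longrightarrow> chain (xs @ ys)"
  by (simp_all add: pairs_def)

lemma Partition_eq: "boxes \<mu> = D \<Longrightarrow> Partition D = \<mu>"
  using boxes_inverse by blast

text \<open>The satisfying part of \<open>ss\<close> becomes an element of \<open>Arr\<close>; the
  violating part stays with \<open>es\<close> and forms an element of \<open>reverse_infused\<close>
  over the smaller vertex. The summand may be arbitrary, because the final vertex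
  \<open>(\<gamma>1, \<gamma>2)\<close> is the same on both sides.\<close>

lemma sum_infused_split:
  assumes finA: "finite (Arr r \<beta>1 \<beta>2)" and finL: "\<And>\<delta> \<gamma>'. finite (infused r \<alpha> \<delta> \<gamma>')"
  shows "(\<Sum>(\<gamma>1, \<gamma>2, ss, es) \<in> infused r \<alpha> \<beta>1 \<beta>2. f \<gamma>1 \<gamma>2) =
    (\<Sum>(\<delta>, \<gamma>', ss1) \<in> Arr r \<beta>1 \<beta>2. \<Sum>(\<gamma>1, \<gamma>2, ss, es) \<in> reverse_infused r \<alpha> \<delta> \<gamma>'. (f \<gamma>1 \<gamma>2 :: 'a :: comm_monoid_add))"
proof -
  \<comment> \<open>\<open>j\<close> cuts and \<open>i\<close> glues; the shapes of the intermediate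
    vertex are read off from the boxes of the two parts.\<close>
  define j where "j = (\<lambda>(\<gamma>1, \<gamma>2, ss, es :: box list).
     let Z1 = filter (sat r) (zip (dl \<beta>2 \<gamma>2) ss); Z2 = filter (unsat r) (zip (dl \<beta>2 \<gamma>2) ss) in
     ((Partition (boxes \<beta>1 \<union> snd ` set Z1), Partition (boxes \<gamma>2 \<union> fst ` set Z2), map snd Z1),
      (\<gamma>1 :: partition, \<gamma>2, map snd Z2, es)))"
  define i where "i = (\<lambda>((\<delta> :: partition, \<gamma>', ss1 :: box list), (\<gamma>1 :: partition, \<gamma>2, ss2 :: box list, es :: box list)).
     (\<gamma>1, \<gamma>2, map (\<lambda>d. the (map_of (zip (dl \<beta>2 \<gamma>') ss1 @ zip (dl \<gamma>' \<gamma>2) ss2) d)) (dl \<beta>2 \<gamma>2), es))"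
  let ?S = "Sigma (Arr r \<beta>1 \<beta>2) (\<lambda>(\<delta>, \<gamma>', ss1). reverse_infused r \<alpha> \<delta> \<gamma>')"
  have split: "j x \<in> ?S \<and> i (j x) = x" if x: "x \<in> infused r \<alpha> \<beta>1 \<beta>2" for x
  proof -
    obtain \<gamma>1 \<gamma>2 ss es where xe: "x = (\<gamma>1, \<gamma>2, ss, es)" by (cases x)
    have le: "\<beta>1 \<le> \<gamma>1" "\<gamma>2 \<le> \<beta>2" and p: "(ss, es) \<in> pairs (dl \<beta>2 \<gamma>2) (dl \<alpha> \<emptyset>) (skew \<gamma>1 \<beta>1)"
      and st: "filter (unsat r) (zip (dl \<beta>2 \<gamma>2) (snd (infuse ss es))) = []"
      using x by (simp_all add: xe infused_def)
    obtain \<delta>' where \<delta>': "\<beta>1 \<le> \<delta>'" "\<delta>' \<le> \<gamma>1" "ss \<in> pictures (dl \<beta>2 \<gamma>2) (skew \<delta>' \<beta>1)" "es \<in> pictures (dl \<alpha> \<emptyset>) (skew \<gamma>1 \<delta>')"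
      using pairs_split[OF p le(1)] by blast
    let ?Z = "zip (dl \<beta>2 \<gamma>2) ss"
    define Z1 where "Z1 = filter (sat r) ?Z"
    define Z2 where "Z2 = filter (unsat r) ?Z"
    obtain \<delta> \<gamma>' where b: "boxes \<delta> = boxes \<beta>1 \<union> snd ` set Z1" "boxes \<gamma>' = boxes \<gamma>2 \<union> fst ` set Z2"
      and l: "\<beta>1 \<le> \<delta>" "\<delta> \<le> \<delta>'" "\<gamma>2 \<le> \<gamma>'" "\<gamma>' \<le> \<beta>2"
      and q: "map snd Z1 \<in> pictures (dl \<beta>2 \<gamma>') (skew \<delta> \<beta>1)" "zip (dl \<beta>2 \<gamma>') (map snd Z1) = Z1"
        "map snd Z2 \<in> pictures (dl \<gamma>' \<gamma>2) (skew \<delta>' \<delta>)" "zip (dl \<gamma>' \<gamma>2) (map snd Z2) = Z2"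
      using sat_split[OF le(2) \<delta>'(1,3) Z1_def Z2_def] by blast
    have jx: "j x = ((\<delta>, \<gamma>', map snd Z1), (\<gamma>1, \<gamma>2, map snd Z2, es))"
      unfolding j_def xe Let_def case_prod_conv Z1_def[symmetric] Z2_def[symmetric]
      using b by (simp add: Partition_eq)
    have f1: "filter (unsat r) Z1 = []" "filter (sat r) Z2 = []" unfolding Z1_def Z2_def
      by (simp_all add: filter_empty_conv)
    have f2: "filter (unsat r) Z2 = Z2" unfolding Z2_def by simp
    have A: "(\<delta>, \<gamma>', map snd Z1) \<in> Arr r \<beta>1 \<beta>2"
      unfolding Arr_def using l q f1(1) by simp
    have p2: "(map snd Z2, es) \<in> pairs (dl \<gamma>' \<gamma>2) (dl \<alpha> \<emptyset>) (skew \<gamma>1 \<delta>)"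
      by (rule pairs_join[OF q(3) \<delta>'(4) l(2) \<delta>'(2)])
    \<comment> \<open>The central point: removing the satisfying boxes before infusion does not
      change which boxes violate the rule after it.\<close>
    have "filter (unsat r) (zip (dl \<gamma>' \<gamma>2) (snd (infuse (map snd Z2) es))) =
       filter (unsat r) (zip (dl \<beta>2 \<gamma>2) (snd (infuse ss es)))"
    proof (rule infuse_unsat[OF sdom_rls_skew sdom_rls_skew pairs_pic(1)[OF p2] pairs_pic(1)[OF p]
          pairs_pic(3)[OF p2] pairs_pic(3)[OF p]])
      show "filter (unsat r) (zip (dl \<gamma>' \<gamma>2) (map snd Z2)) = filter (unsat r) ?Z"
        unfolding q(4) f2 by (rule Z2_def)
    qed
    then have B: "(\<gamma>1, \<gamma>2, map snd Z2, es) \<in> reverse_infused r \<alpha> \<delta> \<gamma>'"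
      unfolding reverse_infused_def infused_def using st p2 l \<delta>'(2) q(4) f1(2) by auto
    \<comment> \<open>Gluing the parts gives a list with the same set of pairs; as both lists follow
      the reading order of the domain, it is \<open>ss\<close> again.\<close>
    define ss' where "ss' = map (\<lambda>d. the (map_of (zip (dl \<beta>2 \<gamma>') (map snd Z1) @ zip (dl \<gamma>' \<gamma>2) (map snd Z2)) d)) (dl \<beta>2 \<gamma>2)"
    have g: "ss' \<in> pictures (dl \<beta>2 \<gamma>2) (skew \<delta>' \<beta>1)" "filter (sat r) (zip (dl \<beta>2 \<gamma>2) ss') = Z1"
      "filter (unsat r) (zip (dl \<beta>2 \<gamma>2) ss') = Z2"
      using sat_glue[OF l(3,4,1,2) q(1) _ q(3) _ ss'_def, of r] f1 by (simp_all add: q(2,4))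
    have "set (zip (dl \<beta>2 \<gamma>2) ss') = set Z1 \<union> set Z2"
      unfolding g(2)[symmetric] g(3)[symmetric] by auto
    also have "\<dots> = set ?Z" unfolding Z1_def Z2_def by auto
    finally have "zip (dl \<beta>2 \<gamma>2) ss' = ?Z" by (intro zip_dl_eqI zip_dl_sorted)
    moreover have "length (dl \<beta>2 \<gamma>2) = length ss'" "length (dl \<beta>2 \<gamma>2) = length ss"
      using g(1) \<delta>'(3) by (auto simp: pictures_def dest: pic_length)
    ultimately have "ss' = ss" by (metis map_snd_zip)
    then have "i (j x) = x" unfolding jx unfolding i_def xe ss'_def by simp
    moreover have "j x \<in> ?S" unfolding jx using A B by simp
    ultimately show ?thesis by blast
  qed
  have glue: "i y \<in> infused r \<alpha> \<beta>1 \<beta>2 \<and> j (i y) = y" if y: "y \<in> ?S" for y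
  proof -
    obtain \<delta> \<gamma>' ss1 \<gamma>1 \<gamma>2 ss2 es where ye: "y = ((\<delta>, \<gamma>', ss1), (\<gamma>1, \<gamma>2, ss2, es))"
      by (metis surj_pair)
    have A: "\<beta>1 \<le> \<delta>" "\<gamma>' \<le> \<beta>2" "ss1 \<in> pictures (dl \<beta>2 \<gamma>') (skew \<delta> \<beta>1)" "filter (unsat r) (zip (dl \<beta>2 \<gamma>') ss1) = []"
      using y by (simp_all add: ye Arr_def)
    have B: "\<delta> \<le> \<gamma>1" "\<gamma>2 \<le> \<gamma>'" "(ss2, es) \<in> pairs (dl \<gamma>' \<gamma>2) (dl \<alpha> \<emptyset>) (skew \<gamma>1 \<delta>)"
      "filter (unsat r) (zip (dl \<gamma>' \<gamma>2) (snd (infuse ss2 es))) = []" "filter (sat r) (zip (dl \<gamma>' \<gamma>2) ss2) = []"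
      using y by (simp_all add: ye reverse_infused_def infused_def)
    obtain \<delta>' where \<delta>': "\<delta> \<le> \<delta>'" "\<delta>' \<le> \<gamma>1" "ss2 \<in> pictures (dl \<gamma>' \<gamma>2) (skew \<delta>' \<delta>)" "es \<in> pictures (dl \<alpha> \<emptyset>) (skew \<gamma>1 \<delta>')"
      using pairs_split[OF B(3,1)] by blast
    define ss where "ss = map (\<lambda>d. the (map_of (zip (dl \<beta>2 \<gamma>') ss1 @ zip (dl \<gamma>' \<gamma>2) ss2) d)) (dl \<beta>2 \<gamma>2)"
    note g = sat_glue[OF B(2) A(2,1) \<delta>'(1) A(3,4) \<delta>'(3) B(5) ss_def]
    have iy: "i y = (\<gamma>1, \<gamma>2, ss, es)" unfolding i_def ye ss_def by simp
    have p: "(ss, es) \<in> pairs (dl \<beta>2 \<gamma>2) (dl \<alpha> \<emptyset>) (skew \<gamma>1 \<beta>1)"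
      by (rule pairs_join[OF g(1) \<delta>'(4) order_trans[OF A(1) \<delta>'(1)] \<delta>'(2)])
    have f2: "filter (unsat r) (zip (dl \<gamma>' \<gamma>2) ss2) = zip (dl \<gamma>' \<gamma>2) ss2"
      using B(5) by (simp add: filter_id_conv filter_empty_conv)
    have "filter (unsat r) (zip (dl \<gamma>' \<gamma>2) (snd (infuse ss2 es))) =
       filter (unsat r) (zip (dl \<beta>2 \<gamma>2) (snd (infuse ss es)))"
      by (rule infuse_unsat[OF sdom_rls_skew sdom_rls_skew])
        (use pairs_pic[OF p] pairs_pic[OF B(3)] f2 g(3) in simp_all)
    then have "i y \<in> infused r \<alpha> \<beta>1 \<beta>2"
      unfolding iy infused_def using p B(1,2,4) A(1,2) by auto
    moreover have "j (i y) = y"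
    proof -
      have len: "length (dl \<beta>2 \<gamma>') = length ss1" "length (dl \<gamma>' \<gamma>2) = length ss2"
        using A(3) \<delta>'(3) by (auto simp: pictures_def dest: pic_length)
      have "snd ` set (zip (dl \<beta>2 \<gamma>') ss1) = skew \<delta> \<beta>1"
        using A(3) len(1) by (simp add: pictures_def flip: list.set_map)
      moreover have "fst ` set (zip (dl \<gamma>' \<gamma>2) ss2) = skew \<gamma>' \<gamma>2"
        using len(2) by (simp flip: list.set_map)
      moreover have "Partition (boxes \<beta>1 \<union> skew \<delta> \<beta>1) = \<delta>" "Partition (boxes \<gamma>2 \<union> skew \<gamma>' \<gamma>2) = \<gamma>'"
        using A(1) B(2) by (auto intro!: Partition_eq simp: skew_def partition_le_iff)
      ultimately show ?thesis
        unfolding iy unfolding j_def ye Let_def case_prod_conv g(2,3) using len by simp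
    qed
    ultimately show ?thesis by simp
  qed
  have "(\<Sum>(\<delta>, \<gamma>', ss1) \<in> Arr r \<beta>1 \<beta>2. \<Sum>(\<gamma>1, \<gamma>2, ss, es) \<in> reverse_infused r \<alpha> \<delta> \<gamma>'. f \<gamma>1 \<gamma>2) =
     (\<Sum>(a, b) \<in> ?S. (\<lambda>(\<gamma>1, \<gamma>2, ss, es). f \<gamma>1 \<gamma>2) b)"
  proof -
    have "finite (reverse_infused r \<alpha> \<delta> \<gamma>')" for \<delta> \<gamma>'
      by (rule finite_subset[OF _ finL[of \<delta> \<gamma>']]) (auto simp: reverse_infused_def)
    then show ?thesis
      by (subst sum.Sigma[symmetric]) (use finA in \<open>auto simp: case_prod_unfold\<close>)
  qed
  also have "\<dots> = (\<Sum>(\<gamma>1, \<gamma>2, ss, es) \<in> infused r \<alpha> \<beta>1 \<beta>2. f \<gamma>1 \<gamma>2)"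
    by (rule sum.reindex_bij_witness[of _ j i])
      (use split glue in \<open>auto simp: i_def case_prod_unfold\<close>)
  finally show ?thesis by simp
qed

section \<open>Arrows of the quiver\<close>

lemma zip_unsat_nth:
  assumes "length ds = length cs"
  shows "filter (unsat r) (zip ds cs) = [] \<longleftrightarrow> (\<forall>k < length ds. r + int (fst (ds ! k)) - int (snd (ds ! k)) \<le> int (fst (cs ! k)))"
    "filter (sat r) (zip ds cs) = [] \<longleftrightarrow> (\<forall>k < length ds. r + int (fst (ds ! k)) - int (snd (ds ! k)) > int (fst (cs ! k)))"
proof -
  have z: "set (zip ds cs) = (\<lambda>k. (ds ! k, cs ! k)) ` {..<length ds}" using assms by (auto simp: set_zip)
  show "filter (unsat r) (zip ds cs) = [] \<longleftrightarrow> (\<forall>k < length ds. r + int (fst (ds ! k)) - int (snd (ds ! k)) \<le> int (fst (cs ! k)))"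
    "filter (sat r) (zip ds cs) = [] \<longleftrightarrow> (\<forall>k < length ds. r + int (fst (ds ! k)) - int (snd (ds ! k)) > int (fst (cs ! k)))"
    unfolding filter_empty_conv z by (auto simp: unsat_def not_less)
qed

lemma row_rule_fill:
  assumes cs: "cs \<in> pictures (dl \<beta>2 \<gamma>2) (skew \<gamma>1 \<beta>1)"
  shows "row_rule r ((\<beta>1, \<beta>2), (\<gamma>1, \<gamma>2), fill cs) \<longleftrightarrow> filter (unsat r) (zip (dl \<beta>2 \<gamma>2) cs) = []"
    "reverse_row_rule r ((\<beta>1, \<beta>2), (\<gamma>1, \<gamma>2), fill cs) \<longleftrightarrow> filter (sat r) (zip (dl \<beta>2 \<gamma>2) cs) = []"
proof -
  have P: "pic (dl \<beta>2 \<gamma>2) cs" and s: "set cs = skew \<gamma>1 \<beta>1" using cs by (auto simp: pictures_def)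
  have d: "distinct cs" "distinct (dl \<beta>2 \<gamma>2)"
    using pic_distinct[OF sdom_rls_skew P] sdom_distinct[OF sdom_rls_skew] by auto
  have len: "length (dl \<beta>2 \<gamma>2) = length cs" by (rule pic_length[OF P])
  have n: "card (skew \<gamma>1 \<beta>1) = length cs" using d s distinct_card by metis
  have r1: "(\<forall>i \<in> {1..length cs}. Q i) \<longleftrightarrow> (\<forall>k < length cs. Q (Suc k))" for Q
  proof safe
    fix i assume "\<forall>k < length cs. Q (Suc k)" "i \<in> {1..length cs}" then show "Q i" by (cases i) auto
  qed simp
  have e: "row_of (fill cs) (Suc k) = fst (cs ! k)"
    "row_rule_entry r \<beta>2 \<gamma>2 (Suc k) = r + int (fst (dl \<beta>2 \<gamma>2 ! k)) - int (snd (dl \<beta>2 \<gamma>2 ! k))"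
    if "k < length cs" for k
    using that d len
    by (simp_all add: row_of_def box_of_fill row_rule_entry_def row_rule_filling_def rl_eq_fill case_prod_unfold)
  show "row_rule r ((\<beta>1, \<beta>2), (\<gamma>1, \<gamma>2), fill cs) \<longleftrightarrow> filter (unsat r) (zip (dl \<beta>2 \<gamma>2) cs) = []"
    "reverse_row_rule r ((\<beta>1, \<beta>2), (\<gamma>1, \<gamma>2), fill cs) \<longleftrightarrow> filter (sat r) (zip (dl \<beta>2 \<gamma>2) cs) = []"
    unfolding row_rule.simps reverse_row_rule.simps n r1 zip_unsat_nth[OF len] len
    by (auto simp: e)
qed

lemma RW_arc_iff:
  "((\<beta>1, \<beta>2), (\<gamma>1, \<gamma>2), T) \<in> arcs RW_quiver \<longleftrightarrow>
    (\<beta>1, \<beta>2) \<noteq> (\<gamma>1, \<gamma>2) \<and> \<beta>1 \<le> \<gamma>1 \<and> \<gamma>2 \<le> \<beta>2 \<and> T \<in> RW \<gamma>1 \<beta>1 \<beta>2 \<gamma>2"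
  by (simp add: RW_quiver_def)

lemma skew_self [simp]: "skew \<beta> \<beta> = {}"
  by (simp add: skew_def)

lemma trivial_arrow: "(\<beta>1, \<beta>2, []) \<in> Arr r \<beta>1 \<beta>2"
  by (simp add: Arr_def pictures_def pic_def pict_def)

lemma Arr_trivial_iff:
  assumes "(\<delta>, \<gamma>, ss) \<in> Arr r \<beta>1 \<beta>2"
  shows "(\<delta>, \<gamma>, ss) = (\<beta>1, \<beta>2, []) \<longleftrightarrow> (\<delta>, \<gamma>) = (\<beta>1, \<beta>2)"
  using assms by (auto simp: Arr_def pictures_def)

lemma Arr_nontrivial:
  assumes "(\<delta>, \<gamma>, ss) \<in> Arr r \<beta>1 \<beta>2" "(\<delta>, \<gamma>, ss) \<noteq> (\<beta>1, \<beta>2, [])"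
  shows "((\<beta>1, \<beta>2), (\<delta>, \<gamma>), fill ss) \<in> arcs RW_quiver" "row_rule r ((\<beta>1, \<beta>2), (\<delta>, \<gamma>), fill ss)"
proof -
  have ss: "ss \<in> pictures (dl \<beta>2 \<gamma>) (skew \<delta> \<beta>1)" using assms(1) by (simp add: Arr_def)
  have "fill ss \<in> RW \<delta> \<beta>1 \<beta>2 \<gamma>" using ss bij_betw_fill_RW bij_betwE by blast
  then show "((\<beta>1, \<beta>2), (\<delta>, \<gamma>), fill ss) \<in> arcs RW_quiver"
    using assms Arr_trivial_iff[OF assms(1)] by (auto simp: RW_arc_iff Arr_def)
  show "row_rule r ((\<beta>1, \<beta>2), (\<delta>, \<gamma>), fill ss)"
    using assms(1) row_rule_fill(1)[OF ss] by (simp add: Arr_def del: row_rule.simps)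
qed

lemma arc_fill:
  assumes "((\<beta>1, \<beta>2), (\<delta>, \<gamma>), T) \<in> arcs RW_quiver" "row_rule r ((\<beta>1, \<beta>2), (\<delta>, \<gamma>), T)"
  obtains ss where "T = fill ss" "(\<delta>, \<gamma>, ss) \<in> Arr r \<beta>1 \<beta>2 - {(\<beta>1, \<beta>2, [])}"
proof -
  have a: "(\<beta>1, \<beta>2) \<noteq> (\<delta>, \<gamma>)" "\<beta>1 \<le> \<delta>" "\<gamma> \<le> \<beta>2" "T \<in> RW \<delta> \<beta>1 \<beta>2 \<gamma>"
    using assms(1) by (simp_all add: RW_arc_iff)
  then obtain ss where ss: "ss \<in> pictures (dl \<beta>2 \<gamma>) (skew \<delta> \<beta>1)" "T = fill ss"
    using bij_betw_imp_surj_on[OF bij_betw_fill_RW] by (metis imageE)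
  then have "(\<delta>, \<gamma>, ss) \<in> Arr r \<beta>1 \<beta>2"
    using a assms(2) row_rule_fill(1)[OF ss(1)] by (simp add: Arr_def del: row_rule.simps)
  then show ?thesis using that[OF ss(2)] a(1) by auto
qed

lemma bij_betw_Arr:
  "bij_betw (\<lambda>(\<delta>, \<gamma>, ss). ((\<beta>1, \<beta>2), (\<delta>, \<gamma>), fill ss)) (Arr r \<beta>1 \<beta>2 - {(\<beta>1, \<beta>2, [])})
     {a \<in> out_arcs RW_quiver (\<beta>1, \<beta>2). row_rule r a}" (is "bij_betw ?f ?A ?B")
  unfolding bij_betw_def
proof
  show "inj_on ?f ?A"
  proof (rule inj_onI)
    fix x y assume xy: "x \<in> ?A" "y \<in> ?A" "?f x = ?f y"
    obtain \<delta> \<gamma> ss \<delta>' \<gamma>' ss' where e: "x = (\<delta>, \<gamma>, ss)" "y = (\<delta>', \<gamma>', ss')" by (metis surj_pair)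
    have "distinct ss" "distinct ss'" using xy(1,2) pictures_distinct unfolding e Arr_def by blast+
    then show "x = y" using xy(3) fill_inj[of ss ss'] by (simp add: e)
  qed
  show "?f ` ?A = ?B"
  proof (intro equalityI subsetI)
    fix a assume "a \<in> ?f ` ?A"
    then obtain \<delta> \<gamma> ss where "(\<delta>, \<gamma>, ss) \<in> ?A" "a = ((\<beta>1, \<beta>2), (\<delta>, \<gamma>), fill ss)" by auto
    then show "a \<in> ?B"
      using Arr_nontrivial[of \<delta> \<gamma> ss r \<beta>1 \<beta>2] by (auto simp: RW_quiver_def simp del: row_rule.simps)
  next
    fix a assume a: "a \<in> ?B"
    obtain \<delta> \<gamma> T where ae: "a = ((\<beta>1, \<beta>2), (\<delta>, \<gamma>), T)" using a by (auto simp: RW_quiver_def)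
    then have "((\<beta>1, \<beta>2), (\<delta>, \<gamma>), T) \<in> arcs RW_quiver" "row_rule r ((\<beta>1, \<beta>2), (\<delta>, \<gamma>), T)" using a by simp_all
    then obtain ss where "T = fill ss" "(\<delta>, \<gamma>, ss) \<in> ?A" by (rule arc_fill)
    then show "a \<in> ?f ` ?A" using ae by force
  qed
qed

lemma finite_Arr: "finite (Arr r \<beta>1 \<beta>2)"
proof -
  have "finite {a \<in> out_arcs RW_quiver (\<beta>1, \<beta>2). row_rule r a}"
    by (rule finite_subset[OF _ finite_out_arcs_RW_quiver]) blast
  then have "finite (Arr r \<beta>1 \<beta>2 - {(\<beta>1, \<beta>2, [])})"
    using bij_betw_finite[OF bij_betw_Arr] by blast
  then show ?thesis by simp
qed

text \<open>The recursion of \<tau> solved for the Schur function, with \<tau> itself as the term of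
  the trivial triple.\<close>

lemma schur2_eq_sum_tau: "schur2 (\<beta>1, \<beta>2) = (\<Sum>(\<delta>, \<gamma>, ss) \<in> Arr r \<beta>1 \<beta>2. tau r (\<delta>, \<gamma>))"
proof -
  have "(\<Sum>a | a \<in> out_arcs RW_quiver (\<beta>1, \<beta>2) \<and> row_rule r a. tau r (head RW_quiver a)) =
    (\<Sum>(\<delta>, \<gamma>, ss) \<in> Arr r \<beta>1 \<beta>2 - {(\<beta>1, \<beta>2, [])}. tau r (\<delta>, \<gamma>))"
    using sum.reindex_bij_betw[OF bij_betw_Arr, of "\<lambda>a. tau r (head RW_quiver a)" \<beta>1 \<beta>2 r]
    by (simp add: case_prod_unfold RW_quiver_def)
  then have "schur2 (\<beta>1, \<beta>2) = tau r (\<beta>1, \<beta>2) + (\<Sum>(\<delta>, \<gamma>, ss) \<in> Arr r \<beta>1 \<beta>2 - {(\<beta>1, \<beta>2, [])}. tau r (\<delta>, \<gamma>))"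
    using tau.simps[of r "(\<beta>1, \<beta>2)"] by simp
  also have "\<dots> = (\<Sum>(\<delta>, \<gamma>, ss) \<in> Arr r \<beta>1 \<beta>2. tau r (\<delta>, \<gamma>))"
    using sum.remove[OF finite_Arr trivial_arrow, of "\<lambda>(\<delta>, \<gamma>, ss). tau r (\<delta>, \<gamma>)" r \<beta>1 \<beta>2] by simp
  finally show ?thesis .
qed

text \<open>The predicate \<open>Q\<close> is carried along to cover the unrestricted sum and the sum over the tableaux whose slide
  satisfies the reverse row rule.\<close>

lemma sum_LR_Arr:
  fixes f :: "partition \<Rightarrow> partition \<Rightarrow> 'a :: comm_monoid_add"
  shows "(\<Sum>(\<mu>, es) \<in> LR \<alpha> \<beta>1. \<Sum>(\<gamma>1, \<gamma>2, cs) | (\<gamma>1, \<gamma>2, cs) \<in> Arr r \<mu> \<beta>2 \<and> Q \<gamma>2 (fst (infuse es cs)). f \<gamma>1 \<gamma>2) =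
    (\<Sum>(\<gamma>1, \<gamma>2, ss, es) | (\<gamma>1, \<gamma>2, ss, es) \<in> infused r \<alpha> \<beta>1 \<beta>2 \<and> Q \<gamma>2 ss. f \<gamma>1 \<gamma>2)" (is "?l = ?r")
  and finite_infused: "finite (infused r \<alpha> \<beta>1 \<beta>2)"
proof -
  define i where "i = (\<lambda>((\<mu> :: partition, es), (\<gamma>1 :: partition, \<gamma>2 :: partition, cs)). (\<gamma>1, \<gamma>2, infuse es cs))"
  \<comment> \<open>Infusion is its own inverse; the shape \<open>\<mu>\<close> between the two
    tableaux, absent from the outcome, is recovered as \<open>\<beta>1\<close> together with the
    boxes of the inner list.\<close>
  define j where "j = (\<lambda>(\<gamma>1 :: partition, \<gamma>2 :: partition, ss, es). case infuse ss es of (es', cs') \<Rightarrow>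
     ((Partition (boxes \<beta>1 \<union> set es'), es'), (\<gamma>1, \<gamma>2, cs')))"
  let ?A = "\<lambda>Q (\<mu>, es). {(\<gamma>1, \<gamma>2, cs). (\<gamma>1, \<gamma>2, cs) \<in> Arr r \<mu> \<beta>2 \<and> Q \<gamma>2 (fst (infuse es cs))}"
  let ?B = "\<lambda>Q. {(\<gamma>1, \<gamma>2, ss, es). (\<gamma>1, \<gamma>2, ss, es) \<in> infused r \<alpha> \<beta>1 \<beta>2 \<and> Q \<gamma>2 ss}"
  have fin: "finite (?A Q x)" for Q x
    by (cases x) (auto intro!: finite_subset[OF _ finite_Arr[of r "fst x" \<beta>2]])
  have fw: "i x \<in> ?B Q \<and> j (i x) = x" if x: "x \<in> Sigma (LR \<alpha> \<beta>1) (?A Q)" for x Q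
  proof -
    obtain \<mu> es \<gamma>1 \<gamma>2 cs where xe: "x = ((\<mu>, es), (\<gamma>1, \<gamma>2, cs))" by (metis surj_pair)
    have a: "\<beta>1 \<le> \<mu>" "es \<in> pictures (dl \<alpha> \<emptyset>) (skew \<mu> \<beta>1)" "\<mu> \<le> \<gamma>1" "\<gamma>2 \<le> \<beta>2"
      "cs \<in> pictures (dl \<beta>2 \<gamma>2) (skew \<gamma>1 \<mu>)" "filter (unsat r) (zip (dl \<beta>2 \<gamma>2) cs) = []" "Q \<gamma>2 (fst (infuse es cs))"
      using x by (auto simp: xe LR_def Arr_def simp del: skew_bot)
    have p: "(es, cs) \<in> pairs (dl \<alpha> \<emptyset>) (dl \<beta>2 \<gamma>2) (skew \<gamma>1 \<beta>1)" by (rule pairs_join[OF a(2,5,1,3)])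
    obtain ss es' where i: "infuse es cs = (ss, es')" by (rule prod.exhaust)
    have q: "(ss, es') \<in> pairs (dl \<beta>2 \<gamma>2) (dl \<alpha> \<emptyset>) (skew \<gamma>1 \<beta>1)" "infuse ss es' = (es, cs)"
      using infuse_pairs[OF sdom_rls_skew sdom_rls_skew p] i by simp_all
    have "Partition (boxes \<beta>1 \<union> set es) = \<mu>"
      using a(1,2) by (auto intro!: Partition_eq simp: pictures_def skew_def partition_le_iff)
    then show ?thesis using a q order_trans[OF a(1,3)] i
      by (auto simp: xe i_def j_def infused_def simp del: skew_bot)
  qed
  have bw: "j y \<in> Sigma (LR \<alpha> \<beta>1) (?A Q) \<and> i (j y) = y" if y: "y \<in> ?B Q" for y Q
  proof -
    obtain \<gamma>1 \<gamma>2 ss es where ye: "y = (\<gamma>1, \<gamma>2, ss, es)" by (metis surj_pair)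
    obtain es' cs where i: "infuse ss es = (es', cs)" by (rule prod.exhaust)
    have a: "\<beta>1 \<le> \<gamma>1" "\<gamma>2 \<le> \<beta>2" "(ss, es) \<in> pairs (dl \<beta>2 \<gamma>2) (dl \<alpha> \<emptyset>) (skew \<gamma>1 \<beta>1)"
      "filter (unsat r) (zip (dl \<beta>2 \<gamma>2) cs) = []" "Q \<gamma>2 ss"
      using y i by (auto simp: ye infused_def simp del: skew_bot)
    have q: "(es', cs) \<in> pairs (dl \<alpha> \<emptyset>) (dl \<beta>2 \<gamma>2) (skew \<gamma>1 \<beta>1)" "infuse es' cs = (ss, es)"
      using infuse_pairs[OF sdom_rls_skew sdom_rls_skew a(3)] i by simp_all
    obtain \<mu> where \<mu>: "boxes \<mu> = boxes \<beta>1 \<union> set es'" "\<beta>1 \<le> \<mu>" "\<mu> \<le> \<gamma>1"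
      "es' \<in> pictures (dl \<alpha> \<emptyset>) (skew \<mu> \<beta>1)" "cs \<in> pictures (dl \<beta>2 \<gamma>2) (skew \<gamma>1 \<mu>)"
      by (rule pairs_split[OF q(1) a(1)])
    then show ?thesis using a q i Partition_eq[OF \<mu>(1)]
      by (auto simp: ye i_def j_def LR_def Arr_def simp del: skew_bot)
  qed
  have "?l = (\<Sum>(a, b) \<in> Sigma (LR \<alpha> \<beta>1) (?A Q). (\<lambda>(\<gamma>1, \<gamma>2, cs). f \<gamma>1 \<gamma>2) b)"
    using fin[of Q] by (subst sum.Sigma[symmetric]) (auto simp: finite_LR case_prod_unfold)
  also have "\<dots> = ?r"
    by (rule sum.reindex_bij_witness[of _ j i]) (use fw bw in \<open>auto simp: i_def case_prod_unfold\<close>)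
  finally show "?l = ?r" .
  have "finite (Sigma (LR \<alpha> \<beta>1) (?A (\<lambda>_ _. True)))"
    using fin by (intro finite_SigmaI finite_LR)
  then have "finite (i ` Sigma (LR \<alpha> \<beta>1) (?A (\<lambda>_ _. True)))" by (rule finite_imageI)
  then show "finite (infused r \<alpha> \<beta>1 \<beta>2)"
  proof (rule finite_subset[rotated])
    show "infused r \<alpha> \<beta>1 \<beta>2 \<subseteq> i ` Sigma (LR \<alpha> \<beta>1) (?A (\<lambda>_ _. True))"
    proof
      fix y assume "y \<in> infused r \<alpha> \<beta>1 \<beta>2"
      then have "y \<in> ?B (\<lambda>_ _. True)" by auto
      note b = bw[OF this]
      show "y \<in> i ` Sigma (LR \<alpha> \<beta>1) (?A (\<lambda>_ _. True))"
        by (rule image_eqI[of _ i "j y"]) (use b in simp_all)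
    qed
  qed
qed


section \<open>The product formula\<close>

lemma inj_X: "inj X"
  by (simp add: inj_on_def)

text \<open>\<open>?s * schur2 (\<beta>1, \<beta>2)\<close> is computed twice. The
  Littlewood-Richardson rule followed by arrows gives the sum over \<open>infused\<close>, which
  \<open>sum_infused_split\<close> regroups by \<open>Arr\<close>; expanding \<open>schur2\<close>
  in \<tau> gives products grouped by \<open>Arr\<close> as well. Nontrivial arrows shrink the
  second partition, so those terms cancel by induction.\<close>

lemma schur_times_tau:
  "schur X \<alpha> * tau r (\<beta>1, \<beta>2) = (\<Sum>(\<gamma>1, \<gamma>2, ss, es) \<in> reverse_infused r \<alpha> \<beta>1 \<beta>2. tau r (\<gamma>1, \<gamma>2))"
proof (induction "card (boxes \<beta>2)" arbitrary: \<beta>1 \<beta>2 rule: less_induct)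
  case less
  let ?s = "schur X \<alpha>"
  let ?T = "\<lambda>\<delta> \<gamma>'. \<Sum>(\<gamma>1, \<gamma>2, ss, es) \<in> reverse_infused r \<alpha> \<delta> \<gamma>'. tau r (\<gamma>1, \<gamma>2)"
  have IH: "?s * tau r (\<delta>, \<gamma>) = ?T \<delta> \<gamma>" if a: "(\<delta>, \<gamma>, ss) \<in> Arr r \<beta>1 \<beta>2 - {(\<beta>1, \<beta>2, [])}" for \<delta> \<gamma> ss
  proof (rule less)
    show "card (boxes \<gamma>) < card (boxes \<beta>2)"
      using RW_quiver_decreasing[OF Arr_nontrivial(1), of \<delta> \<gamma> ss r \<beta>1 \<beta>2] a by (simp add: RW_quiver_def)
  qed
  have "?s * schur2 (\<beta>1, \<beta>2) = (\<Sum>(\<mu>, es) \<in> LR \<alpha> \<beta>1. schur2 (\<mu>, \<beta>2))"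
    by (simp add: schur2_def mult.assoc[symmetric] LR_rule[OF inj_X] sum_distrib_right case_prod_unfold)
  also have "\<dots> = (\<Sum>(\<mu>, es) \<in> LR \<alpha> \<beta>1. \<Sum>(\<gamma>1, \<gamma>2, cs) | (\<gamma>1, \<gamma>2, cs) \<in> Arr r \<mu> \<beta>2 \<and> True. tau r (\<gamma>1, \<gamma>2))"
    by (intro sum.cong refl) (auto simp: schur2_eq_sum_tau[of _ _ r] case_prod_unfold)
  also have "\<dots> = (\<Sum>(\<gamma>1, \<gamma>2, ss, es) | (\<gamma>1, \<gamma>2, ss, es) \<in> infused r \<alpha> \<beta>1 \<beta>2 \<and> True. tau r (\<gamma>1, \<gamma>2))"
    by (rule sum_LR_Arr)
  also have "\<dots> = (\<Sum>(\<gamma>1, \<gamma>2, ss, es) \<in> infused r \<alpha> \<beta>1 \<beta>2. tau r (\<gamma>1, \<gamma>2))"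
    by (simp add: case_prod_unfold)
  also have "\<dots> = (\<Sum>(\<delta>, \<gamma>', ss1) \<in> Arr r \<beta>1 \<beta>2. ?T \<delta> \<gamma>')"
    by (rule sum_infused_split[OF finite_Arr finite_infused])
  also have "\<dots> = ?T \<beta>1 \<beta>2 + (\<Sum>(\<delta>, \<gamma>', ss1) \<in> Arr r \<beta>1 \<beta>2 - {(\<beta>1, \<beta>2, [])}. ?T \<delta> \<gamma>')"
    by (subst sum.remove[OF finite_Arr trivial_arrow]) simp
  also have "(\<Sum>(\<delta>, \<gamma>', ss1) \<in> Arr r \<beta>1 \<beta>2 - {(\<beta>1, \<beta>2, [])}. ?T \<delta> \<gamma>') =
      (\<Sum>(\<delta>, \<gamma>', ss1) \<in> Arr r \<beta>1 \<beta>2 - {(\<beta>1, \<beta>2, [])}. ?s * tau r (\<delta>, \<gamma>'))"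
  proof (rule sum.cong[OF refl])
    fix x assume x: "x \<in> Arr r \<beta>1 \<beta>2 - {(\<beta>1, \<beta>2, [])}"
    obtain \<delta> \<gamma> ss where "x = (\<delta>, \<gamma>, ss)" by (cases x)
    then show "(case x of (\<delta>, \<gamma>', ss1) \<Rightarrow> ?T \<delta> \<gamma>') = (case x of (\<delta>, \<gamma>', ss1) \<Rightarrow> ?s * tau r (\<delta>, \<gamma>'))"
      using IH[of \<delta> \<gamma> ss] x by simp
  qed
  finally have "?s * schur2 (\<beta>1, \<beta>2) = ?T \<beta>1 \<beta>2 +
      (\<Sum>(\<delta>, \<gamma>', ss1) \<in> Arr r \<beta>1 \<beta>2 - {(\<beta>1, \<beta>2, [])}. ?s * tau r (\<delta>, \<gamma>'))" .
  moreover have "?s * schur2 (\<beta>1, \<beta>2) = ?s * tau r (\<beta>1, \<beta>2) +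
      (\<Sum>(\<delta>, \<gamma>', ss1) \<in> Arr r \<beta>1 \<beta>2 - {(\<beta>1, \<beta>2, [])}. ?s * tau r (\<delta>, \<gamma>'))"
    unfolding schur2_eq_sum_tau[of \<beta>1 \<beta>2 r]
    by (subst sum.remove[OF finite_Arr trivial_arrow])
      (simp add: distrib_left sum_distrib_left case_prod_unfold)
  ultimately show ?case by simp
qed

text \<open>No arrow leaves \<open>(\<alpha>, \<emptyset>)\<close>, because arrows shrink the second
  partition, and the only tableau of empty shape contributes 1.\<close>

lemma tau_empty: "tau r (\<alpha>, \<emptyset>) = schur X \<alpha>"
proof -
  have "schur Y \<emptyset> = 1"
  proof (rule mcoeff_inject[THEN iffD1], rule ext)
    fix m
    have "semistandard_tableau {} T \<longleftrightarrow> T = (\<lambda>_. 0)" for T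
      by (auto simp: semistandard_tableau_def shape_def fun_eq_iff)
    moreover have "weight Y (\<lambda>_. 0) = 0" by (simp add: weight_def shape_def)
    ultimately have "{T. semistandard_tableau {} T \<and> weight Y T = m} = (if m = 0 then {\<lambda>_. 0} else {})"
      by auto
    then show "mcoeff (schur Y \<emptyset>) m = mcoeff 1 m"
      by (simp add: schur.rep_eq one_pseries.rep_eq)
  qed
  then have "schur2 (\<alpha>, \<emptyset>) = schur X \<alpha>" by (simp add: schur2_def)
  moreover have "Arr r \<alpha> \<emptyset> - {(\<alpha>, \<emptyset>, [])} = {}"
    using Arr_nontrivial(1)[of _ _ _ r \<alpha> \<emptyset>] RW_quiver_decreasing by (fastforce simp: RW_quiver_def)
  then have "Arr r \<alpha> \<emptyset> = {(\<alpha>, \<emptyset>, [])}" using trivial_arrow[of \<alpha> \<emptyset> r] by blast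
  ultimately show ?thesis using schur2_eq_sum_tau[of \<alpha> \<emptyset> r] by simp
qed

theorem mainTheorem2:
  fixes r :: int and \<alpha> \<beta>\<^sub>1 \<beta>\<^sub>2 :: partition
  assumes "r > 0"
  shows "tau r (\<alpha>, \<emptyset>) * tau r (\<beta>\<^sub>1, \<beta>\<^sub>2) =
    (\<Sum>(\<mu>, T\<^sub>1) \<in> {(\<mu>, T\<^sub>1). \<beta>\<^sub>1 \<le> \<mu> \<and> T\<^sub>1 \<in> RW \<mu> \<beta>\<^sub>1 \<alpha> \<emptyset>}.
       tau r (\<mu>, \<beta>\<^sub>2) +
       (\<Sum>(\<gamma>\<^sub>1, \<gamma>\<^sub>2, T\<^sub>2) \<in> {(\<gamma>\<^sub>1, \<gamma>\<^sub>2, T\<^sub>2).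
            ((\<mu>, \<beta>\<^sub>2), (\<gamma>\<^sub>1, \<gamma>\<^sub>2), T\<^sub>2) \<in> arcs RW_quiver \<and>
            row_rule r ((\<mu>, \<beta>\<^sub>2), (\<gamma>\<^sub>1, \<gamma>\<^sub>2), T\<^sub>2) \<and>
            (\<exists>\<delta>. ((\<beta>\<^sub>1, \<beta>\<^sub>2), (\<delta>, \<gamma>\<^sub>2), Slide T\<^sub>1 T\<^sub>2) \<in> arcs RW_quiver \<and>
                 reverse_row_rule r ((\<beta>\<^sub>1, \<beta>\<^sub>2), (\<delta>, \<gamma>\<^sub>2), Slide T\<^sub>1 T\<^sub>2))}.
          tau r (\<gamma>\<^sub>1, \<gamma>\<^sub>2)))" (is "_ = (\<Sum>(\<mu>, T\<^sub>1) \<in> ?W. tau r (\<mu>, \<beta>\<^sub>2) + (\<Sum>(\<gamma>\<^sub>1, \<gamma>\<^sub>2, T\<^sub>2) \<in> ?M \<mu> T\<^sub>1. _))")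
proof -
  let ?Q = "\<lambda>\<gamma>2 ss. filter (sat r) (zip (dl \<beta>\<^sub>2 \<gamma>2) ss) = []"
  let ?N = "\<lambda>\<mu> es. {(\<gamma>1, \<gamma>2, cs). (\<gamma>1, \<gamma>2, cs) \<in> Arr r \<mu> \<beta>\<^sub>2 \<and> ?Q \<gamma>2 (fst (infuse es cs))}"
  \<comment> \<open>The isolated term \<open>tau r (\<mu>, \<beta>\<^sub>2)\<close> is the
    contribution of the trivial triple, so bracket and sum merge into one sum over
    \<open>?N\<close>.\<close>
  have inner: "tau r (\<mu>, \<beta>\<^sub>2) + (\<Sum>(\<gamma>1, \<gamma>2, T2) \<in> ?M \<mu> (fill es). tau r (\<gamma>1, \<gamma>2)) =
      (\<Sum>(\<gamma>1, \<gamma>2, cs) \<in> ?N \<mu> es. tau r (\<gamma>1, \<gamma>2))" if L: "(\<mu>, es) \<in> LR \<alpha> \<beta>\<^sub>1" for \<mu> es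
  proof -
    have le: "\<beta>\<^sub>1 \<le> \<mu>" and es: "es \<in> pictures (dl \<alpha> \<emptyset>) (skew \<mu> \<beta>\<^sub>1)"
      using L by (simp_all add: LR_def del: skew_bot)
    \<comment> \<open>A filling of shape \<delta>/\<beta>_1 carries no partition \<delta>, hence the
      existential. The witness consists of \<open>\<beta>\<^sub>1\<close> and the boxes of the
      slide.\<close>
    have slide: "(\<exists>\<delta>. ((\<beta>\<^sub>1, \<beta>\<^sub>2), (\<delta>, \<gamma>2), Slide (fill es) (fill cs)) \<in> arcs RW_quiver \<and>
         reverse_row_rule r ((\<beta>\<^sub>1, \<beta>\<^sub>2), (\<delta>, \<gamma>2), Slide (fill es) (fill cs))) \<longleftrightarrow> ?Q \<gamma>2 (fst (infuse es cs))"
      if cs: "(\<gamma>1, \<gamma>2, cs) \<in> Arr r \<mu> \<beta>\<^sub>2 - {(\<mu>, \<beta>\<^sub>2, [])}" for \<gamma>1 \<gamma>2 cs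
    proof -
      have a: "\<mu> \<le> \<gamma>1" "\<gamma>2 \<le> \<beta>\<^sub>2" "cs \<in> pictures (dl \<beta>\<^sub>2 \<gamma>2) (skew \<gamma>1 \<mu>)"
        using cs by (simp_all add: Arr_def)
      have p: "(es, cs) \<in> pairs (dl \<alpha> \<emptyset>) (dl \<beta>\<^sub>2 \<gamma>2) (skew \<gamma>1 \<beta>\<^sub>1)" by (rule pairs_join[OF es a(3) le a(1)])
      obtain ss es' where i: "infuse es cs = (ss, es')" by (rule prod.exhaust)
      have q: "(ss, es') \<in> pairs (dl \<beta>\<^sub>2 \<gamma>2) (dl \<alpha> \<emptyset>) (skew \<gamma>1 \<beta>\<^sub>1)"
        using infuse_pairs[OF sdom_rls_skew sdom_rls_skew p] i by simp
      obtain \<delta> where \<delta>: "boxes \<delta> = boxes \<beta>\<^sub>1 \<union> set ss" "\<beta>\<^sub>1 \<le> \<delta>" "ss \<in> pictures (dl \<beta>\<^sub>2 \<gamma>2) (skew \<delta> \<beta>\<^sub>1)"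
        by (rule pairs_split[OF q order_trans[OF le a(1)]])
      have S: "Slide (fill es) (fill cs) = fill ss" using Slide_fill[OF pairs_pic(3)[OF p]] i by simp
      \<comment> \<open>The slide has to be an arrow of the quiver, with distinct ends; equality of
        the second partitions would leave \<open>cs\<close> empty and the arrow from
        \<open>\<mu>\<close> trivial.\<close>
      have ne: "\<beta>\<^sub>2 \<noteq> \<gamma>2"
      proof
        assume e: "\<beta>\<^sub>2 = \<gamma>2"
        then have "cs = []" using a(3) by (auto simp: pictures_def dest: pic_length)
        then have "skew \<gamma>1 \<mu> = {}" using a(3) by (auto simp: pictures_def)
        then have "\<mu> = \<gamma>1" using a(1) by (auto simp: skew_def partition_le_iff boxes_inject[symmetric])
        then show False using cs e \<open>cs = []\<close> by simp
      qed
      have rw: "fill ss \<in> RW \<delta> \<beta>\<^sub>1 \<beta>\<^sub>2 \<gamma>2" using \<delta>(3) bij_betw_fill_RW bij_betwE by blast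
      \<comment> \<open>Any other outer partition gives the same skew shape, namely the shape of the
        filling, so the reverse row rule does not depend on the witness.\<close>
      have other: "ss \<in> pictures (dl \<beta>\<^sub>2 \<gamma>2) (skew \<delta>' \<beta>\<^sub>1)" if "fill ss \<in> RW \<delta>' \<beta>\<^sub>1 \<beta>\<^sub>2 \<gamma>2" for \<delta>'
      proof -
        have "skew \<delta>' \<beta>\<^sub>1 = shape (fill ss)" "skew \<delta> \<beta>\<^sub>1 = shape (fill ss)"
          using that rw by (simp_all add: RW_def Let_def standard_tableau_def)
        then show ?thesis using \<delta>(3) by (simp only:)
      qed
      show ?thesis
      proof
        assume "\<exists>\<delta>. ((\<beta>\<^sub>1, \<beta>\<^sub>2), (\<delta>, \<gamma>2), Slide (fill es) (fill cs)) \<in> arcs RW_quiver \<and>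
          reverse_row_rule r ((\<beta>\<^sub>1, \<beta>\<^sub>2), (\<delta>, \<gamma>2), Slide (fill es) (fill cs))"
        then obtain \<delta>' where "fill ss \<in> RW \<delta>' \<beta>\<^sub>1 \<beta>\<^sub>2 \<gamma>2" "reverse_row_rule r ((\<beta>\<^sub>1, \<beta>\<^sub>2), (\<delta>', \<gamma>2), fill ss)"
          unfolding S RW_arc_iff by blast
        then show "?Q \<gamma>2 (fst (infuse es cs))" using row_rule_fill(2)[OF other] i by simp
      next
        assume "?Q \<gamma>2 (fst (infuse es cs))"
        then have "reverse_row_rule r ((\<beta>\<^sub>1, \<beta>\<^sub>2), (\<delta>, \<gamma>2), fill ss)"
          using row_rule_fill(2)[OF \<delta>(3)] i by simp
        moreover have "((\<beta>\<^sub>1, \<beta>\<^sub>2), (\<delta>, \<gamma>2), fill ss) \<in> arcs RW_quiver"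
          unfolding RW_arc_iff using \<delta>(2) a(2) ne rw by blast
        ultimately show "\<exists>\<delta>. ((\<beta>\<^sub>1, \<beta>\<^sub>2), (\<delta>, \<gamma>2), Slide (fill es) (fill cs)) \<in> arcs RW_quiver \<and>
          reverse_row_rule r ((\<beta>\<^sub>1, \<beta>\<^sub>2), (\<delta>, \<gamma>2), Slide (fill es) (fill cs))" unfolding S by blast
      qed
    qed
    \<comment> \<open>Infusing an empty list gives an empty list, for which the reverse row rule
      holds vacuously.\<close>
    have triv: "(\<mu>, \<beta>\<^sub>2, []) \<in> ?N \<mu> es" using trivial_arrow by simp
    have fin: "finite (?N \<mu> es)" by (rule finite_subset[OF _ finite_Arr[of r \<mu> \<beta>\<^sub>2]]) auto
    have bij: "bij_betw (\<lambda>(\<gamma>1, \<gamma>2, cs). (\<gamma>1, \<gamma>2, fill cs)) (?N \<mu> es - {(\<mu>, \<beta>\<^sub>2, [])}) (?M \<mu> (fill es))"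
      (is "bij_betw ?f ?A ?B")
      unfolding bij_betw_def
    proof
      show "inj_on ?f ?A"
      proof (rule inj_onI)
        fix x y assume xy: "x \<in> ?A" "y \<in> ?A" "?f x = ?f y"
        obtain \<delta> \<gamma> ss \<delta>' \<gamma>' ss' where e: "x = (\<delta>, \<gamma>, ss)" "y = (\<delta>', \<gamma>', ss')" by (metis surj_pair)
        have "distinct ss" "distinct ss'" using xy(1,2) pictures_distinct unfolding e Arr_def by blast+
        then show "x = y" using xy(3) fill_inj[of ss ss'] by (simp add: e)
      qed
      show "?f ` ?A = ?B"
      proof (intro equalityI subsetI)
        fix y assume "y \<in> ?f ` ?A"
        then obtain \<gamma>1 \<gamma>2 cs where y: "y = (\<gamma>1, \<gamma>2, fill cs)" "(\<gamma>1, \<gamma>2, cs) \<in> Arr r \<mu> \<beta>\<^sub>2 - {(\<mu>, \<beta>\<^sub>2, [])}"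
          "?Q \<gamma>2 (fst (infuse es cs))" by auto
        show "y \<in> ?B"
          using Arr_nontrivial[of \<gamma>1 \<gamma>2 cs r \<mu> \<beta>\<^sub>2] y(2,3) slide[OF y(2)] unfolding y(1) by blast
      next
        fix y assume "y \<in> ?B"
        then obtain \<gamma>1 \<gamma>2 T where y: "y = (\<gamma>1, \<gamma>2, T)" "((\<mu>, \<beta>\<^sub>2), (\<gamma>1, \<gamma>2), T) \<in> arcs RW_quiver"
          "row_rule r ((\<mu>, \<beta>\<^sub>2), (\<gamma>1, \<gamma>2), T)"
          "\<exists>\<delta>. ((\<beta>\<^sub>1, \<beta>\<^sub>2), (\<delta>, \<gamma>2), Slide (fill es) T) \<in> arcs RW_quiver \<and>
            reverse_row_rule r ((\<beta>\<^sub>1, \<beta>\<^sub>2), (\<delta>, \<gamma>2), Slide (fill es) T)" by blast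
        obtain cs where cs: "T = fill cs" "(\<gamma>1, \<gamma>2, cs) \<in> Arr r \<mu> \<beta>\<^sub>2 - {(\<mu>, \<beta>\<^sub>2, [])}" by (rule arc_fill[OF y(2,3)])
        then have "(\<gamma>1, \<gamma>2, cs) \<in> ?A" using slide[OF cs(2)] y(4) by blast
        then show "y \<in> ?f ` ?A" unfolding y(1) cs(1) by force
      qed
    qed
    have "(\<Sum>(\<gamma>1, \<gamma>2, T2) \<in> ?M \<mu> (fill es). tau r (\<gamma>1, \<gamma>2)) =
        (\<Sum>(\<gamma>1, \<gamma>2, cs) \<in> ?N \<mu> es - {(\<mu>, \<beta>\<^sub>2, [])}. tau r (\<gamma>1, \<gamma>2))"
      using sum.reindex_bij_betw[OF bij, of "\<lambda>(\<gamma>1, \<gamma>2, T2). tau r (\<gamma>1, \<gamma>2)"] by (simp add: case_prod_unfold)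
    then show ?thesis
      using sum.remove[OF fin triv, of "\<lambda>(\<gamma>1, \<gamma>2, cs). tau r (\<gamma>1, \<gamma>2)"] by simp
  qed
  have "(\<Sum>(\<mu>, T1) \<in> ?W. tau r (\<mu>, \<beta>\<^sub>2) + (\<Sum>(\<gamma>1, \<gamma>2, T2) \<in> ?M \<mu> T1. tau r (\<gamma>1, \<gamma>2))) =
    (\<Sum>(\<mu>, es) \<in> LR \<alpha> \<beta>\<^sub>1. tau r (\<mu>, \<beta>\<^sub>2) + (\<Sum>(\<gamma>1, \<gamma>2, T2) \<in> ?M \<mu> (fill es). tau r (\<gamma>1, \<gamma>2)))"
    using sum.reindex_bij_betw[OF bij_betw_LR, of "\<lambda>(\<mu>, T1). tau r (\<mu>, \<beta>\<^sub>2) + (\<Sum>(\<gamma>1, \<gamma>2, T2) \<in> ?M \<mu> T1. tau r (\<gamma>1, \<gamma>2))" \<alpha> \<beta>\<^sub>1]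
    by (simp only: case_prod_unfold fst_conv snd_conv)
  also have "\<dots> = (\<Sum>(\<mu>, es) \<in> LR \<alpha> \<beta>\<^sub>1. \<Sum>(\<gamma>1, \<gamma>2, cs) \<in> ?N \<mu> es. tau r (\<gamma>1, \<gamma>2))"
  proof (rule sum.cong[OF refl], goal_cases)
    case (1 x)
    then show ?case using inner[of "fst x" "snd x"] by (simp only: case_prod_unfold prod.collapse)
  qed
  also have "\<dots> = (\<Sum>(\<gamma>1, \<gamma>2, ss, es) | (\<gamma>1, \<gamma>2, ss, es) \<in> infused r \<alpha> \<beta>\<^sub>1 \<beta>\<^sub>2 \<and> ?Q \<gamma>2 ss. tau r (\<gamma>1, \<gamma>2))"
    by (rule sum_LR_Arr)
  also have "\<dots> = tau r (\<alpha>, \<emptyset>) * tau r (\<beta>\<^sub>1, \<beta>\<^sub>2)"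
    unfolding tau_empty schur_times_tau reverse_infused_def by simp
  finally show ?thesis by simp
qed

end
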